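(* Suppose the eigengap assumption, the bounded eigenvalue assumption and the sparsity assumption hold, that $\hat\alpha_n,\hat\beta_n$ satisfy the preliminary estimator condition, and that $\hat\Phi_n$ satisfies the inverse Hessian condition (all stated in the context, with a common $\kappa\in[1/2,1]$). Then the de-biased estimator $\hat x_n^{db}$ can be expanded as either $$\hat x_n^{db}=x^0-\mathcal L_{(1)}+\mathrm{rem}\qquad\text{or}\qquad \hat x_n^{db}=-x^0-\mathcal L_{(1)}+\mathrm{rem},$$ where $\|\mathrm{rem}\|_\infty=O_p(s^{2\kappa}\lambda^2)$.
   Context: **Model.** $(X_i,Y_i)_{i=1}^n$ are i.i.d. copies of $(X,Y)$, where $X\in\mathbb{R}^p$, $Y\in\mathbb{R}^q$ are centered sub-Gaussian random vectors (sub-Gaussian norms bounded by a fixed constant); $p,q$ may vary with $n$ and asymptotics are as $n\to\infty$. The joint covariance is $\Sigma=\begin{bmatrix}\Sigma_x&\Sigma_{xy}\\ \Sigma_{yx}&\Sigma_y\end{bmatrix}$. $\Sigma_{xy}$ has fixed rank $r\ge1$ and $\Sigma_{xy}=\Sigma_xU\Lambda V^T\Sigma_y$ with $U=[u_1\ldots u_r]$, $V=[v_1\ldots v_r]$, $U^T\Sigma_xU=V^T\Sigma_yV=I_r$, $\Lambda=\mathrm{diag}(\Lambda_1\ge\cdots\ge\Lambda_r>0)$. Put $\rho_0=\Lambda_1$, $\alpha_0=u_1$, $\beta_0=v_1$, $x^0=\rho_0^{1/2}\alpha_0$, $y^0=\rho_0^{1/2}\beta_0$; $\Lambda_2=0$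 if $r=1$. $s_U,s_V$ are the numbers of nonzero rows of $U,V$; $s=s_U+s_V$; $\lambda=(\log(p\vee q)/n)^{1/2}$. $\hat\Sigma_x,\hat\Sigma_y,\hat\Sigma_{xy}=\hat\Sigma_{yx}^T$ are the empirical covariance matrices, e.g. $\hat\Sigma_{xy}=n^{-1}\sum_iX_iY_i^T$. **Assumptions.** *Eigengap:* there is $\epsilon_0\in(0,1)$ with $\rho_0-\Lambda_2>\epsilon_0$ for all $n$. *Bounded eigenvalues:* there is $M>0$ such that all eigenvalues of $\Sigma_x,\Sigma_y$ lie in $[M^{-1},M]$. *Sparsity:* $s_U=o(p)$, $s_V=o(q)$, $s^{2\kappa}\lambda^2=o(n^{-1/2})$. *Preliminary estimator condition:* for some $\kappa\in[1/2,1]$, $\inf_{w\in\{\pm1\}}\|w\hat\alpha_n-\alpha_0\|_2+\inf_{w\in\{\pm1\}}\|w\hat\beta_n-\beta_0\|_2=O_p(s^\kappa\lambda)$ and $\inf_{w\in\{\pm1\}}\|w\hat\alpha_n-\alpha_0\|_1+\inf_{w\in\{\pm1\}}\|w\hat\beta_n-\beta_0\|_1=O_p(s^{\kappa+1/2}\lambda)$. *Inverse Hessian condition:* with $\Phi^0=(H^0)^{-1}$, $$H^0=2\rho_0\begin{bmatrix}\Sigma_x+2\Sigma_x\alpha_0\alpha_0^T\Sigma_x & -\Sigma_{xy}/\rho_0\\ -\Sigma_{yx}/\rho_0 & \Sigma_y+2\Sigma_y\beta_0\beta_0^T\Sigma_y\end{bmatrix},$$ the estimator $\hat\Phi_n\in\mathbb{R}^{(p+q)\times(p+q)}$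 satisfies $\max_{j}\|(\hat\Phi_n)_j-\Phi^0_j\|_1=O_p(s^{\kappa+1/2}\lambda)$ and $\max_{j}\|(\hat\Phi_n)_j-\Phi^0_j\|_2=O_p(s^{\kappa}\lambda)$, where $A_j$ is the $j$th column of $A$ and $1\le j\le p+q$. **De-biased estimators.** Let $\hat\rho_n=\hat\alpha_n^T\hat\Sigma_{xy}\hat\beta_n/\{(\hat\alpha_n^T\hat\Sigma_x\hat\alpha_n)^{1/2}(\hat\beta_n^T\hat\Sigma_y\hat\beta_n)^{1/2}\}$, $\hat x_n=|\hat\rho_n|^{1/2}\hat\alpha_n$, $\hat y_n=|\hat\rho_n|^{1/2}\hat\beta_n$, and $$\begin{bmatrix}\hat x_n^{db}\\ \hat y_n^{db}\end{bmatrix}=\begin{bmatrix}\hat x_n\\ \hat y_n\end{bmatrix}-\hat\Phi_n^T\begin{bmatrix}2(\hat x_n^T\hat\Sigma_x\hat x_n)\hat\Sigma_x\hat x_n-2\hat\Sigma_{xy}\hat y_n\\ 2(\hat y_n^T\hat\Sigma_y\hat y_n)\hat\Sigma_y\hat y_n-2\hat\Sigma_{yx}\hat x_n\end{bmatrix}.$$ **The leading term.** $\mathcal L_{(1)}\in\mathbb{R}^p$ is the vector of the first $p$ coordinates of $$\mathcal L=\begin{bmatrix}\mathcal L_{(1)}\\ \mathcal L_{(2)}\end{bmatrix}=2\Phi^0\begin{bmatrix}\rho_0(\hat\Sigma_x-\Sigma_x)x^0-(\hat\Sigma_{xy}-\Sigma_{xy})y^0+((x^0)^T(\hat\Sigma_x-\Sigma_x)x^0)\Sigma_xx^0\\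 \rho_0(\hat\Sigma_y-\Sigma_y)y^0-(\hat\Sigma_{yx}-\Sigma_{yx})x^0+((y^0)^T(\hat\Sigma_y-\Sigma_y)y^0)\Sigma_yy^0\end{bmatrix}.$$
   Formalization: The formal theorem adds that the probability of a negative estimated correlation tends to 0 (opposite signs of the two estimators make the claim false), and its second alternative reads -x^0 + L_(1) + rem, since L changes sign with (x^0, y^0); the printed sign is false. *)

theory Defs
  imports
    "HOL-Probability.Probability"
    "HOL-Library.Landau_Symbols"
    "Jordan_Normal_Form.DL_Rank"
    "Jordan_Normal_Form.Char_Poly"
begin

(* The dimensions p n and q n vary with the sample size, so vectors and matrices are the
   explicitly sized ones of Jordan_Normal_Form. The clashing notation for the type-indexed
   vectors and the inner product of HOL-Analysis is switched off. *)
unbundle no vec_syntax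
unbundle no inner_syntax
hide_type (open) Finite_Cartesian_Product.vec
hide_const (open) Finite_Cartesian_Product.vec Finite_Cartesian_Product.row
  Finite_Cartesian_Product.column Finite_Cartesian_Product.transpose

definition l1_norm :: "real vec \<Rightarrow> real" where
  "l1_norm v = (\<Sum>j<dim_vec v. \<bar>v $ j\<bar>)"

definition l2_norm :: "real vec \<Rightarrow> real" where
  "l2_norm v = sqrt (\<Sum>j<dim_vec v. (v $ j)\<^sup>2)"

definition linf_norm :: "real vec \<Rightarrow> real" where
  "linf_norm v = (MAX j\<in>{..<dim_vec v}. \<bar>v $ j\<bar>)"

definition outer_prod :: "real vec \<Rightarrow> real vec \<Rightarrow> real mat" where
  "outer_prod a b = mat (dim_vec a) (dim_vec b) (\<lambda>(i, j). a $ i * b $ j)"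

definition nonzero_rows :: "real mat \<Rightarrow> nat" where
  "nonzero_rows A = card {i. i < dim_row A \<and> row A i \<noteq> 0\<^sub>v (dim_col A)}"

definition sign_dist :: "(real vec \<Rightarrow> real) \<Rightarrow> real vec \<Rightarrow> real vec \<Rightarrow> real" where
  "sign_dist N a b = (MIN w\<in>{1, -1}. N (w \<cdot>\<^sub>v a - b))"

definition random_vec :: "'a measure \<Rightarrow> nat \<Rightarrow> ('a \<Rightarrow> real vec) \<Rightarrow> bool" where
  "random_vec M d Z \<longleftrightarrow>
     (\<forall>\<omega>\<in>space M. Z \<omega> \<in> carrier_vec d) \<and>
     (\<forall>j<d. (\<lambda>\<omega>. Z \<omega> $ j) \<in> borel_measurable M)"

definition random_mat :: "'a measure \<Rightarrow> nat \<Rightarrow> nat \<Rightarrow> ('a \<Rightarrow> real mat) \<Rightarrow> bool" where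
  "random_mat M d e A \<longleftrightarrow>
     (\<forall>\<omega>\<in>space M. A \<omega> \<in> carrier_mat d e) \<and>
     (\<forall>i<d. \<forall>j<e. (\<lambda>\<omega>. A \<omega> $$ (i, j)) \<in> borel_measurable M)"

(* The type of vectors carries no sigma-algebra; laws and independence of d-dimensional random
   vectors are those of their coordinate families in the product space. *)
abbreviation vec_space_borel :: "nat \<Rightarrow> (nat \<Rightarrow> real) measure" where
  "vec_space_borel d \<equiv> PiM {..<d} (\<lambda>_. borel)"

definition coords :: "nat \<Rightarrow> real vec \<Rightarrow> nat \<Rightarrow> real" where
  "coords d v = (\<lambda>j\<in>{..<d}. v $ j)"

definition law :: "'a measure \<Rightarrow> nat \<Rightarrow> ('a \<Rightarrow> real vec) \<Rightarrow> (nat \<Rightarrow> real) measure" where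
  "law M d Z = distr M (vec_space_borel d) (\<lambda>\<omega>. coords d (Z \<omega>))"

definition iid_copies ::
  "'a measure \<Rightarrow> nat \<Rightarrow> nat \<Rightarrow> (nat \<Rightarrow> 'a \<Rightarrow> real vec) \<Rightarrow> ('a \<Rightarrow> real vec) \<Rightarrow> bool" where
  "iid_copies M d n Zs Z \<longleftrightarrow>
     random_vec M d Z \<and> (\<forall>i<n. random_vec M d (Zs i)) \<and>
     prob_space.indep_vars M (\<lambda>_. vec_space_borel d) (\<lambda>i \<omega>. coords d (Zs i \<omega>)) {..<n} \<and>
     (\<forall>i<n. law M d (Zs i) = law M d Z)"

definition centered :: "'a measure \<Rightarrow> nat \<Rightarrow> ('a \<Rightarrow> real vec) \<Rightarrow> bool" where
  "centered M d Z \<longleftrightarrow>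
     (\<forall>j<d. integrable M (\<lambda>\<omega>. Z \<omega> $ j) \<and> (\<integral>\<omega>. Z \<omega> $ j \<partial>M) = 0)"

(* The psi_2 (Orlicz) norm of a random variable, infinite if no t qualifies, and of a random
   vector as the supremum over all one-dimensional marginals. *)
definition subgauss_norm :: "'a measure \<Rightarrow> ('a \<Rightarrow> real) \<Rightarrow> ennreal" where
  "subgauss_norm M f =
     (INF t\<in>{t::real. t > 0 \<and> (\<integral>\<^sup>+\<omega>. ennreal (exp ((f \<omega> / t)\<^sup>2)) \<partial>M) \<le> 2}. ennreal t)"

definition subgauss_vec_norm :: "'a measure \<Rightarrow> nat \<Rightarrow> ('a \<Rightarrow> real vec) \<Rightarrow> ennreal" where
  "subgauss_vec_norm M d Z =
     (SUP u\<in>{u \<in> carrier_vec d. l2_norm u = 1}. subgauss_norm M (\<lambda>\<omega>. scalar_prod u (Z \<omega>)))"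

definition cross_cov ::
  "'a measure \<Rightarrow> nat \<Rightarrow> nat \<Rightarrow> ('a \<Rightarrow> real vec) \<Rightarrow> ('a \<Rightarrow> real vec) \<Rightarrow> real mat" where
  "cross_cov M d e X Y = mat d e (\<lambda>(i, j).
     \<integral>\<omega>. (X \<omega> $ i - (\<integral>\<omega>'. X \<omega>' $ i \<partial>M)) * (Y \<omega> $ j - (\<integral>\<omega>'. Y \<omega>' $ j \<partial>M)) \<partial>M)"

definition emp_cov ::
  "nat \<Rightarrow> nat \<Rightarrow> nat \<Rightarrow> (nat \<Rightarrow> real vec) \<Rightarrow> (nat \<Rightarrow> real vec) \<Rightarrow> real mat" where
  "emp_cov n d e xs ys = mat d e (\<lambda>(j, k). (\<Sum>i<n. xs i $ j * ys i $ k) / real n)"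

(* Stochastic boundedness Z n = O_p(a n) along a sequence of probability spaces. It is only
   meaningful for measurable Z n: the measure of a non-measurable set is 0. *)
definition bigOp :: "(nat \<Rightarrow> 'a measure) \<Rightarrow> (nat \<Rightarrow> 'a \<Rightarrow> real) \<Rightarrow> (nat \<Rightarrow> real) \<Rightarrow> bool" where
  "bigOp M Z a \<longleftrightarrow>
     (\<forall>\<delta>>0. \<exists>C>0. \<forall>\<^sub>F n in sequentially.
        measure (M n) {\<omega> \<in> space (M n). \<bar>Z n \<omega>\<bar> > C * \<bar>a n\<bar>} \<le> \<delta>)"

definition canon_corr ::
  "real mat \<Rightarrow> real mat \<Rightarrow> real mat \<Rightarrow> real vec \<Rightarrow> real vec \<Rightarrow> real" where
  "canon_corr Sx Sy Sxy a b =
     scalar_prod a (Sxy *\<^sub>v b) /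
       (sqrt (scalar_prod a (Sx *\<^sub>v a)) * sqrt (scalar_prod b (Sy *\<^sub>v b)))"

(* H^0, the Hessian of (x^T Sx x)^2 / 2 + (y^T Sy y)^2 / 2 - 2 x^T Sxy y at
   (x, y) = (sqrt rho a, sqrt rho b). *)
definition hessian ::
  "real mat \<Rightarrow> real mat \<Rightarrow> real mat \<Rightarrow> real \<Rightarrow> real vec \<Rightarrow> real vec \<Rightarrow> real mat" where
  "hessian Sx Sy Sxy \<rho> a b =
     (2 * \<rho>) \<cdot>\<^sub>m four_block_mat
       (Sx + 2 \<cdot>\<^sub>m (Sx * outer_prod a a * Sx)) ((- 1 / \<rho>) \<cdot>\<^sub>m Sxy)
       ((- 1 / \<rho>) \<cdot>\<^sub>m transpose_mat Sxy) (Sy + 2 \<cdot>\<^sub>m (Sy * outer_prod b b * Sy))"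

definition gradient ::
  "real mat \<Rightarrow> real mat \<Rightarrow> real mat \<Rightarrow> real vec \<Rightarrow> real vec \<Rightarrow> real vec" where
  "gradient Sx Sy Sxy x y =
     ((2 * scalar_prod x (Sx *\<^sub>v x)) \<cdot>\<^sub>v (Sx *\<^sub>v x) - 2 \<cdot>\<^sub>v (Sxy *\<^sub>v y)) @\<^sub>v
     ((2 * scalar_prod y (Sy *\<^sub>v y)) \<cdot>\<^sub>v (Sy *\<^sub>v y) - 2 \<cdot>\<^sub>v (transpose_mat Sxy *\<^sub>v x))"

definition debiased ::
  "real mat \<Rightarrow> real mat \<Rightarrow> real mat \<Rightarrow> real mat \<Rightarrow> real vec \<Rightarrow> real vec \<Rightarrow> real vec" where
  "debiased Phi Sx Sy Sxy x y = (x @\<^sub>v y) - transpose_mat Phi *\<^sub>v gradient Sx Sy Sxy x y"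

(* The vector L, for the empirical matrices Tx, Ty, Txy. The pair (x^0, y^0) is determined by
   the model only up to a simultaneous change of sign, so it is an argument. The expression
   is odd in it: replacing (x, y) by (-x, -y) changes L into -L. *)
definition leading_term ::
  "real mat \<Rightarrow> real \<Rightarrow> real mat \<Rightarrow> real mat \<Rightarrow> real mat \<Rightarrow> real mat \<Rightarrow> real mat \<Rightarrow> real mat \<Rightarrow>
   real vec \<Rightarrow> real vec \<Rightarrow> real vec" where
  "leading_term Phi \<rho> Sx Sy Sxy Tx Ty Txy x y =
     2 \<cdot>\<^sub>v (Phi *\<^sub>v
      ((\<rho> \<cdot>\<^sub>v ((Tx - Sx) *\<^sub>v x) - (Txy - Sxy) *\<^sub>v y
          + scalar_prod x ((Tx - Sx) *\<^sub>v x) \<cdot>\<^sub>v (Sx *\<^sub>v x)) @\<^sub>v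
       (\<rho> \<cdot>\<^sub>v ((Ty - Sy) *\<^sub>v y) - transpose_mat (Txy - Sxy) *\<^sub>v x
          + scalar_prod y ((Ty - Sy) *\<^sub>v y) \<cdot>\<^sub>v (Sy *\<^sub>v y))))"

end

theory Submission
  imports Defs
begin

text \<open>
  Write \<open>G\<close> for the sample gradient, \<open>z0\<close> for the true pair with the sign of the estimator, \<open>h\<close> for the
  estimation error, \<open>\<phi>\<^sub>j\<close> for a column of \<open>Phi0\<close> and \<open>d\<close> for the same column of \<open>Phih - Phi0\<close>.
  As \<open>Phi0\<close> inverts the population Hessian \<open>H\<close>, the remainder in coordinate \<open>j\<close> equals, up to sign,
  \<open>\<phi>\<^sub>j \<bullet> (G(z0 + h) - H h) + d \<bullet> G(z0 + h)\<close> minus the part of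
  \<open>\<phi>\<^sub>j \<bullet> G(z0)\<close> that is linear in the covariance errors. It is a sum of products of values
  of the bilinear forms \<open>S\<close> (population) and \<open>D = T - S\<close> (sampling error). The forms \<open>S\<close> are bounded in
  \<open>l2\<close>; the forms \<open>D\<close> are \<open>O(lam)\<close> simultaneously on the finite family of unit vectors, columns of
  \<open>Phi0\<close> and canonical directions (a Bernstein bound and a union bound), and they extend to the
  estimation errors by \<open>l1\<close> duality, so no \<open>l1\<close> bound on \<open>Phi0\<close> is needed. The columns of \<open>Phi0\<close> are
  bounded in \<open>l2\<close> because the eigengap makes \<open>H\<close> uniformly positive definite. With
  \<open>del = s^kappa lam\<close> and \<open>eta = s^(kappa + 1/2) lam\<close>, \<open>kappa \<ge> 1/2\<close> gives \<open>lam eta \<le> del\<^sup>2\<close>, and the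
  sparsity condition gives \<open>eta \<rightarrow> 0\<close> and thereby \<open>lam eta\<^sup>2 \<le> del\<^sup>2\<close>, so every product is \<open>O(del\<^sup>2)\<close>.
\<close>

section \<open>Bilinear forms and the remainder on a fixed sample\<close>

text \<open>The sign is the obstacle. Each preliminary estimator is close to its target only up to
  its own sign. If the two signs differed, the estimated pair would sit near
  \<open>(x0, - y0)\<close>, where the population gradient does not vanish, and no remainder of
  second order could be expected. A nonnegative sample correlation excludes this on the good event;
  this is how \<open>orientation\<close> enters. The common sign that is left is random, while a
  union bound needs nonrandom vectors, so the finite family holds every canonical direction with
  both signs. At \<open>z0\<close> the population gradient vanishes because
  \<open>Sxy y0 = rho Sx x0\<close>, and likewise with x and y exchanged. Hence
  \<open>G(z0 + h)\<close> is of first order and its product with \<open>d\<close> of second. The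
  population constants depend on three numbers only, never on \<open>n\<close>: the sub-Gaussian
  bound, the lower eigenvalue bound and the eigengap. Sparsity acts twice: as \<open>sU\<close> is
  at least 1, \<open>sU = o(p)\<close> also forces \<open>p\<close> to infinity, which makes the
  failure probability of the union bound vanish and gives \<open>lam\<^sup>2 \<ge> 1 / n\<close>
  eventually.\<close>

definition bil :: "nat \<Rightarrow> nat \<Rightarrow> (nat \<Rightarrow> nat \<Rightarrow> real) \<Rightarrow> (nat \<Rightarrow> real) \<Rightarrow> (nat \<Rightarrow> real) \<Rightarrow> real" where
  "bil d e A u v = (\<Sum>i<d. \<Sum>j<e. u i * A i j * v j)"

text \<open>Vectors are plain functions here, so sums, scalings and slices carry no dimension side
  conditions; a form reads only the values below its own bounds.\<close>

definition unit_fun :: "nat \<Rightarrow> nat \<Rightarrow> real" where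
  "unit_fun i = (\<lambda>j. of_bool (j = i))"

lemma bil_add_left: "bil d e A (\<lambda>i. u i + v i) w = bil d e A u w + bil d e A v w"
  by (simp add: bil_def algebra_simps sum.distrib)

lemma bil_add_right: "bil d e A w (\<lambda>i. u i + v i) = bil d e A w u + bil d e A w v"
  by (simp add: bil_def algebra_simps sum.distrib)

lemma bil_scale_left: "bil d e A (\<lambda>i. c * u i) w = c * bil d e A u w"
  by (simp add: bil_def sum_distrib_left mult_ac)

lemma bil_scale_right: "bil d e A w (\<lambda>i. c * u i) = c * bil d e A w u"
  by (simp add: bil_def sum_distrib_left mult_ac)

lemma bil_diff_left: "bil d e A (\<lambda>i. u i - v i) w = bil d e A u w - bil d e A v w"
  by (simp add: bil_def algebra_simps sum_subtractf)

lemma bil_diff_right: "bil d e A w (\<lambda>i. u i - v i) = bil d e A w u - bil d e A w v"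
  by (simp add: bil_def algebra_simps sum_subtractf)

lemma bil_diff_mat: "bil d e (\<lambda>i j. A i j - B i j) u v = bil d e A u v - bil d e B u v"
  by (simp add: bil_def algebra_simps sum_subtractf)

lemma bil_swap: "bil e d (\<lambda>i j. A j i) v u = bil d e A u v"
  unfolding bil_def by (subst sum.swap) (simp add: mult_ac)

lemma bil_sym:
  assumes "\<And>i j. i < d \<Longrightarrow> j < d \<Longrightarrow> A i j = A j i"
  shows "bil d d A u v = bil d d A v u"
proof -
  have "bil d d A u v = bil d d (\<lambda>i j. A j i) u v"
    unfolding bil_def using assms by (intro sum.cong refl) auto
  also have "\<dots> = bil d d A v u" by (rule bil_swap)
  finally show ?thesis .
qed

lemma bil_cong:
  assumes "\<And>i j. i < d \<Longrightarrow> j < e \<Longrightarrow> A i j = A' i j"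
    and "\<And>i. i < d \<Longrightarrow> u i = u' i" and "\<And>j. j < e \<Longrightarrow> v j = v' j"
  shows "bil d e A u v = bil d e A' u' v'"
  unfolding bil_def using assms by (intro sum.cong refl) auto

lemma bil_unit_left: "i < d \<Longrightarrow> bil d e A (unit_fun i) v = (\<Sum>j<e. A i j * v j)"
  unfolding bil_def unit_fun_def
  by (subst sum.remove[of _ i]) (auto intro!: sum.neutral)

lemma bil_expand_left: "bil d e A u v = (\<Sum>i<d. u i * bil d e A (unit_fun i) v)"
proof -
  have "bil d e A u v = (\<Sum>i<d. u i * (\<Sum>j<e. A i j * v j))"
    unfolding bil_def by (simp add: sum_distrib_left mult_ac)
  then show ?thesis by (simp add: bil_unit_left)
qed

text \<open>Only the values at unit vectors enter, so \<open>u\<close> may be random although the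
  union bound knows nothing of it.\<close>

lemma bil_bound_left:
  assumes "\<And>i. i < d \<Longrightarrow> \<bar>bil d e A (unit_fun i) v\<bar> \<le> m"
  shows "\<bar>bil d e A u v\<bar> \<le> (\<Sum>i<d. \<bar>u i\<bar>) * m"
proof -
  have "\<bar>bil d e A u v\<bar> \<le> (\<Sum>i<d. \<bar>u i * bil d e A (unit_fun i) v\<bar>)"
    unfolding bil_expand_left[of d e A u v] by (rule sum_abs)
  also have "\<dots> \<le> (\<Sum>i<d. \<bar>u i\<bar> * m)"
    using assms by (intro sum_mono) (auto simp: abs_mult intro!: mult_left_mono)
  finally show ?thesis by (simp add: sum_distrib_right)
qed

lemma bil_bound_right:
  assumes "\<And>j. j < e \<Longrightarrow> \<bar>bil d e A u (unit_fun j)\<bar> \<le> m"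
  shows "\<bar>bil d e A u v\<bar> \<le> (\<Sum>j<e. \<bar>v j\<bar>) * m"
  using bil_bound_left[of e d "\<lambda>i j. A j i" u m v] assms by (simp only: bil_swap[of e d A])

section \<open>Orders of magnitude of the population and sampling-error forms\<close>

locale rates =
  fixes K lam del eta :: real
  assumes K: "1 \<le> K" and lam: "0 < lam" "lam \<le> del" and del: "del \<le> 1" and eta: "0 < eta"
    and lam_eta: "lam * eta \<le> del\<^sup>2" and lam_eta2: "lam * eta\<^sup>2 \<le> del\<^sup>2"
begin

lemma del_pos: "0 < del" using lam by linarith

lemma del2_le: "del\<^sup>2 \<le> del"
  using del del_pos by (simp add: power2_eq_square mult_le_cancel_left1)

lemma K_le: "K \<le> K ^ 3"
  using K power_increasing[of 1 3 K] by simp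

lemma K2_le: "K ^ 2 \<le> K ^ 3"
  using K power_increasing[of 2 3 K] by simp

lemma K3: "1 \<le> K ^ 3"
  using K K_le by linarith

text \<open>The admissible size of an error vector. The l2 part pays for the population forms, the
  l1 part for the sampling errors.\<close>

definition near :: "nat \<Rightarrow> (nat \<Rightarrow> real) \<Rightarrow> bool" where
  "near d h \<longleftrightarrow> L2_set h {..<d} \<le> K * del \<and> (\<Sum>i<d. \<bar>h i\<bar>) \<le> K * eta"

end

text \<open>One block of the joint covariance, with \<open>S\<close> its population and
  \<open>T\<close> its empirical version. \<open>F\<close> and \<open>G\<close> stand for the
  nonrandom vectors on which the sampling error is already controlled; they contain the unit vectors
  so that duality can start from them.\<close>

locale cov_pair = rates +
  fixes d e :: nat and S T :: "nat \<Rightarrow> nat \<Rightarrow> real" and F G :: "(nat \<Rightarrow> real) set"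
  assumes S_bound: "\<And>u v a b. 0 < a \<Longrightarrow> 0 < b \<Longrightarrow> L2_set u {..<d} \<le> a \<Longrightarrow> L2_set v {..<e} \<le> b \<Longrightarrow>
      \<bar>bil d e S u v\<bar> \<le> K * a * b"
    and D_bound: "\<And>u v. u \<in> F \<Longrightarrow> v \<in> G \<Longrightarrow> \<bar>bil d e (\<lambda>i j. T i j - S i j) u v\<bar> \<le> K * lam"
    and F: "\<And>i. i < d \<Longrightarrow> unit_fun i \<in> F" "\<And>u. u \<in> F \<Longrightarrow> L2_set u {..<d} \<le> K"
    and G: "\<And>j. j < e \<Longrightarrow> unit_fun j \<in> G" "\<And>v. v \<in> G \<Longrightarrow> L2_set v {..<e} \<le> K"
begin

abbreviation D :: "nat \<Rightarrow> nat \<Rightarrow> real" where "D \<equiv> \<lambda>i j. T i j - S i j"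

lemma T_eq: "bil d e T u v = bil d e S u v + bil d e D u v"
  by (simp add: bil_diff_mat)

text \<open>The common factor \<open>K ^ 3\<close> of this and the next bounds counts one
  \<open>K\<close> for the form and one for each argument. Lower powers are rounded up so that a
  single constant serves everywhere.\<close>

lemma S_FG: "u \<in> F \<Longrightarrow> v \<in> G \<Longrightarrow> \<bar>bil d e S u v\<bar> \<le> K ^ 3"
  using S_bound[of K K u v] F(2)[of u] G(2)[of v] K by (simp add: power3_eq_cube)

lemma S_Fn: "u \<in> F \<Longrightarrow> near e v \<Longrightarrow> \<bar>bil d e S u v\<bar> \<le> K ^ 3 * del"
  using S_bound[of K "K * del" u v] F(2)[of u] K del_pos
  by (simp add: near_def power3_eq_cube mult.assoc)

lemma S_nG: "near d u \<Longrightarrow> v \<in> G \<Longrightarrow> \<bar>bil d e S u v\<bar> \<le> K ^ 3 * del"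
  using S_bound[of "K * del" K u v] G(2)[of v] K del_pos
  by (simp add: near_def power3_eq_cube mult_ac)

lemma S_nn: "near d u \<Longrightarrow> near e v \<Longrightarrow> \<bar>bil d e S u v\<bar> \<le> K ^ 3 * del\<^sup>2"
  using S_bound[of "K * del" "K * del" u v] K del_pos
  by (simp add: near_def power3_eq_cube power2_eq_square mult_ac)

lemma D_FG: "u \<in> F \<Longrightarrow> v \<in> G \<Longrightarrow> \<bar>bil d e D u v\<bar> \<le> K ^ 3 * del"
proof -
  assume "u \<in> F" "v \<in> G"
  then have "\<bar>bil d e D u v\<bar> \<le> K * lam" by (rule D_bound)
  also have "\<dots> \<le> K ^ 3 * del"
    using K_le K lam by (intro mult_mono) auto
  finally show ?thesis .
qed

lemma D_nG:
  assumes "near d u" "v \<in> G" shows "\<bar>bil d e D u v\<bar> \<le> K ^ 3 * del\<^sup>2"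
proof -
  have "\<bar>bil d e D u v\<bar> \<le> (\<Sum>i<d. \<bar>u i\<bar>) * (K * lam)"
    using assms(2) by (intro bil_bound_left D_bound F)
  also have "\<dots> \<le> (K * eta) * (K * lam)"
    using assms(1) K lam by (intro mult_right_mono) (auto simp: near_def)
  also have "\<dots> = K ^ 2 * (lam * eta)" by (simp add: power2_eq_square)
  also have "\<dots> \<le> K ^ 3 * del\<^sup>2"
    using K2_le lam_eta K lam eta by (intro mult_mono) auto
  finally show ?thesis .
qed

lemma D_Fn:
  assumes "u \<in> F" "near e v" shows "\<bar>bil d e D u v\<bar> \<le> K ^ 3 * del\<^sup>2"
proof -
  have "\<bar>bil d e D u v\<bar> \<le> (\<Sum>i<e. \<bar>v i\<bar>) * (K * lam)"
    using assms(1) by (intro bil_bound_right D_bound G)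
  also have "\<dots> \<le> (K * eta) * (K * lam)"
    using assms(2) K lam by (intro mult_right_mono) (auto simp: near_def)
  also have "\<dots> = K ^ 2 * (lam * eta)" by (simp add: power2_eq_square)
  also have "\<dots> \<le> K ^ 3 * del\<^sup>2"
    using K2_le lam_eta K lam eta by (intro mult_mono) auto
  finally show ?thesis .
qed

text \<open>Duality is applied once in each argument, which costs \<open>eta\<close> twice; this is
  where \<open>lam * eta\<^sup>2 \<le> del\<^sup>2\<close> is spent.\<close>

lemma D_nn:
  assumes "near d u" "near e v" shows "\<bar>bil d e D u v\<bar> \<le> K ^ 3 * del\<^sup>2"
proof -
  have "\<bar>bil d e D (unit_fun i) v\<bar> \<le> (K * eta) * (K * lam)" if "i < d" for i
  proof -
    have "\<bar>bil d e D (unit_fun i) v\<bar> \<le> (\<Sum>i<e. \<bar>v i\<bar>) * (K * lam)"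
      using that by (intro bil_bound_right D_bound G F)
    also have "\<dots> \<le> (K * eta) * (K * lam)"
      using assms(2) K lam by (intro mult_right_mono) (auto simp: near_def)
    finally show ?thesis .
  qed
  then have "\<bar>bil d e D u v\<bar> \<le> (\<Sum>i<d. \<bar>u i\<bar>) * ((K * eta) * (K * lam))"
    by (intro bil_bound_left)
  also have "\<dots> \<le> (K * eta) * ((K * eta) * (K * lam))"
    using assms(1) K lam eta by (intro mult_right_mono) (auto simp: near_def)
  also have "\<dots> = K ^ 3 * (lam * eta\<^sup>2)" by (simp add: power2_eq_square power3_eq_cube)
  also have "\<dots> \<le> K ^ 3 * del\<^sup>2"
    using lam_eta2 K by (intro mult_left_mono) auto
  finally show ?thesis .
qed

text \<open>Expanding both arguments leaves seven terms besides \<open>bil d e S u v\<close>: three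
  of the population form and four of the sampling error. Each is at most \<open>K ^ 3 * del\<close>,
  as \<open>del\<^sup>2 \<le> del\<close>.\<close>

lemma perturbed_form:
  assumes "u \<in> F" "v \<in> G" "near d h" "near e k"
  shows "\<bar>bil d e T (\<lambda>i. u i + h i) (\<lambda>i. v i + k i) - bil d e S u v\<bar> \<le> 7 * K ^ 3 * del"
proof -
  have "K ^ 3 * del\<^sup>2 \<le> K ^ 3 * del"
    using del2_le K by (intro mult_left_mono) auto
  note le = this
  note b = S_Fn[OF assms(1,4)] S_nG[OF assms(3,2)] S_nn[OF assms(3,4)]
    D_FG[OF assms(1,2)] D_Fn[OF assms(1,4)] D_nG[OF assms(3,2)] D_nn[OF assms(3,4)]
  note le b[THEN abs_le_D1] b[THEN abs_le_D2]
  then show ?thesis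
    unfolding T_eq bil_add_left bil_add_right by (intro abs_leI) linarith+
qed

end

section \<open>Expansion of one de-biased coordinate\<close>

lemma abs_mult_le: "\<bar>x * y\<bar> \<le> a * b" if "\<bar>x\<bar> \<le> a" "\<bar>y\<bar> \<le> b" for x y a b :: real
  unfolding abs_mult using that by (intro mult_mono) auto

lemma abs_combination_le:
  fixes e :: real
  assumes "e = 2 * t1 + 2 * t2 + 2 * t3 - 2 * t4"
    and "\<bar>t1\<bar> \<le> b1" "\<bar>t2\<bar> \<le> b2" "\<bar>t3\<bar> \<le> b3" "\<bar>t4\<bar> \<le> b4"
  shows "\<bar>e\<bar> \<le> 2 * b1 + 2 * b2 + 2 * b3 + 2 * b4"
  using assms by linarith

lemma abs_halves_le:
  fixes x' :: real
  assumes "\<bar>Ax - lx - hx\<bar> \<le> m" "\<bar>Ay - ly - hy\<bar> \<le> m" "x' - x0 = hx + hy" "l = lx + ly"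
  shows "\<bar>x' - Ax - Ay - x0 + l\<bar> \<le> 2 * m"
  using assms by linarith

context rates begin

text \<open>By \<open>eig\<close> the population gradient vanishes at the canonical pair, so all
  terms without an error factor cancel, for \<open>f\<close> and for the column error
  \<open>d\<close>. The two subtracted groups are the first-order terms left for \<open>f\<close>:
  the sampling error at \<open>(x0, y0)\<close> and the population derivative in direction
  \<open>(h, k)\<close>. Every surviving product contains two factors of order \<open>del\<close> or
  one of order \<open>del\<^sup>2\<close>.\<close>

lemma half_remainder:
  fixes F G
  assumes xx: "cov_pair K lam del eta p p Sx Tx F F"
    and xy: "cov_pair K lam del eta p q Sxy Txy F G"
    and sym: "\<And>u v. bil p p Sx u v = bil p p Sx v u" "\<And>u v. bil p p Tx u v = bil p p Tx v u"
    and mem: "f \<in> F" "x0 \<in> F" "y0 \<in> G"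
    and near: "near p d" "near p h" "near q k"
    and rho: "\<bar>\<rho>\<bar> \<le> K" and norm: "bil p p Sx x0 x0 = \<rho>"
    and eig: "\<And>u. bil p q Sxy u y0 = \<rho> * bil p p Sx u x0"
  defines "Dx \<equiv> \<lambda>i j. Tx i j - Sx i j" and "Dxy \<equiv> \<lambda>i j. Txy i j - Sxy i j"
    and "f' \<equiv> \<lambda>i. f i + d i" and "x' \<equiv> \<lambda>i. x0 i + h i" and "y' \<equiv> \<lambda>i. y0 i + k i"
  shows "\<bar>2 * bil p p Tx x' x' * bil p p Tx f' x' - 2 * bil p q Txy f' y'
    - (2 * \<rho> * bil p p Dx f x0 - 2 * bil p q Dxy f y0 + 2 * bil p p Dx x0 x0 * bil p p Sx f x0)
    - (2 * \<rho> * bil p p Sx f h + 4 * bil p p Sx f x0 * bil p p Sx x0 h - 2 * bil p q Sxy f k)\<bar>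
    \<le> 122 * (K ^ 3)\<^sup>2 * del\<^sup>2"
proof -
  interpret xx: cov_pair K lam del eta p p Sx Tx F F by (rule xx)
  interpret xy: cov_pair K lam del eta p q Sxy Txy F G by (rule xy)
  define L where "L = K ^ 3"
  note b = xx.S_FG xx.S_Fn xx.S_nG xx.S_nn xx.D_FG xx.D_Fn xx.D_nG xx.D_nn
    xy.S_nn xy.D_Fn xy.D_nG xy.D_nn
  \<comment> \<open>Capitals are values of \<open>Sx\<close>, small letters of \<open>Dx\<close>; P
    and p have \<open>f\<close> on the left, Q and q have \<open>d\<close>; index 0 means
    \<open>x0\<close> on the right, index 1 means \<open>h\<close>.\<close>
  define P0 P1 Q0 Q1 where "P0 = bil p p Sx f x0" and "P1 = bil p p Sx f h"
    and "Q0 = bil p p Sx d x0" and "Q1 = bil p p Sx d h"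
  define p0 p1 q0 q1 where "p0 = bil p p Dx f x0" and "p1 = bil p p Dx f h"
    and "q0 = bil p p Dx d x0" and "q1 = bil p p Dx d h"
  define S0h Shh D00 D0h Dhh where "S0h = bil p p Sx x0 h" and "Shh = bil p p Sx h h"
    and "D00 = bil p p Dx x0 x0" and "D0h = bil p p Dx x0 h" and "Dhh = bil p p Dx h h"
  define X1 X2 y1 y2 y3 y4 where "X1 = bil p q Sxy f k" and "X2 = bil p q Sxy d k"
    and "y1 = bil p q Dxy f y0" and "y2 = bil p q Dxy f k"
    and "y3 = bil p q Dxy d y0" and "y4 = bil p q Dxy d k"
  note defs = P0_def P1_def Q0_def Q1_def p0_def p1_def q0_def q1_def S0h_def Shh_def D00_def
    D0h_def Dhh_def X1_def X2_def y1_def y2_def y3_def y4_def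
  have bounds: "\<bar>P0\<bar> \<le> L" "\<bar>P1\<bar> \<le> L * del" "\<bar>Q0\<bar> \<le> L * del" "\<bar>Q1\<bar> \<le> L * del\<^sup>2" "\<bar>p0\<bar> \<le> L * del"
    "\<bar>p1\<bar> \<le> L * del\<^sup>2" "\<bar>q0\<bar> \<le> L * del\<^sup>2" "\<bar>q1\<bar> \<le> L * del\<^sup>2" "\<bar>S0h\<bar> \<le> L * del"
    "\<bar>Shh\<bar> \<le> L * del\<^sup>2" "\<bar>D00\<bar> \<le> L * del" "\<bar>D0h\<bar> \<le> L * del\<^sup>2" "\<bar>Dhh\<bar> \<le> L * del\<^sup>2"
    "\<bar>X2\<bar> \<le> L * del\<^sup>2" "\<bar>y2\<bar> \<le> L * del\<^sup>2" "\<bar>y3\<bar> \<le> L * del\<^sup>2" "\<bar>y4\<bar> \<le> L * del\<^sup>2"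
    unfolding defs L_def Dx_def Dxy_def using mem near by (blast intro: b)+
  note B = bounds[THEN abs_le_D1] bounds[THEN abs_le_D2]
  define a where "a = bil p p Tx x' x'"
  have a: "a = \<rho> + 2 * S0h + Shh + D00 + 2 * D0h + Dhh"
    unfolding a_def x'_def bil_add_left bil_add_right xx.T_eq
    using sym(1)[of h x0] sym(2)[of h x0] norm xx.T_eq[of h x0] xx.T_eq[of x0 h]
    by (simp add: defs Dx_def)
  have L: "1 \<le> L" "\<bar>\<rho>\<bar> \<le> L" using K3 rho K_le by (auto simp: L_def)
  have d2: "L * del\<^sup>2 \<le> L * del" using del2_le L by (intro mult_left_mono) auto
  have ar: "\<bar>a - \<rho>\<bar> \<le> 7 * L * del"
    unfolding a using B d2 by (intro abs_leI) linarith+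
  have "L * del \<le> L" using del L by simp
  with ar L have aa: "\<bar>a\<bar> \<le> 8 * L" by linarith
  \<comment> \<open>In the factor of \<open>P0\<close>, the difference \<open>a - \<rho>\<close> has
    lost its linear part \<open>2 * S0h + D00\<close> to the subtracted groups. \<open>P1\<close>,
    \<open>p0\<close> and \<open>Q0\<close> are of order \<open>del\<close> and meet
    \<open>a - \<rho>\<close>, again of order \<open>del\<close>. What is multiplied by the full
    \<open>a\<close>, and the cross terms that remain, are already of order
    \<open>del\<^sup>2\<close>.\<close>
  have split: "2 * a * bil p p Tx f' x' - 2 * bil p q Txy f' y'
      - (2 * \<rho> * p0 - 2 * y1 + 2 * D00 * P0) - (2 * \<rho> * P1 + 4 * P0 * S0h - 2 * X1)
    = 2 * ((Shh + 2 * D0h + Dhh) * P0) + 2 * ((a - \<rho>) * (P1 + p0 + Q0))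
      + 2 * (a * (Q1 + p1 + q0 + q1)) - 2 * (X2 + y2 + y3 + y4)"
  proof -
    have "bil p p Tx f' x' = P0 + P1 + Q0 + Q1 + p0 + p1 + q0 + q1"
      unfolding f'_def x'_def bil_add_left bil_add_right xx.T_eq by (simp add: defs Dx_def)
    moreover have "bil p q Txy f' y' = \<rho> * P0 + X1 + \<rho> * Q0 + X2 + y1 + y2 + y3 + y4"
      unfolding f'_def y'_def bil_add_left bil_add_right xy.T_eq eig by (simp add: defs Dxy_def)
    ultimately show ?thesis unfolding a by (simp add: algebra_simps)
  qed
  have t1: "\<bar>(Shh + 2 * D0h + Dhh) * P0\<bar> \<le> (4 * (L * del\<^sup>2)) * L"
    using B by (intro abs_mult_le abs_leI) linarith+
  have t2: "\<bar>(a - \<rho>) * (P1 + p0 + Q0)\<bar> \<le> (7 * L * del) * (3 * (L * del))"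
    using B by (intro abs_mult_le[OF ar] abs_leI) linarith+
  have t3: "\<bar>a * (Q1 + p1 + q0 + q1)\<bar> \<le> (8 * L) * (4 * (L * del\<^sup>2))"
    using B by (intro abs_mult_le[OF aa] abs_leI) linarith+
  have "L * del\<^sup>2 \<le> L\<^sup>2 * del\<^sup>2"
    using L by (intro mult_right_mono) (auto simp: power2_eq_square)
  then have t4: "\<bar>X2 + y2 + y3 + y4\<bar> \<le> 4 * (L\<^sup>2 * del\<^sup>2)"
    using B by (intro abs_leI) linarith+
  note abs_combination_le[OF split t1 t2 t3 t4]
  also have "2 * ((4 * (L * del\<^sup>2)) * L) + 2 * ((7 * L * del) * (3 * (L * del)))
        + 2 * ((8 * L) * (4 * (L * del\<^sup>2))) + 2 * (4 * (L\<^sup>2 * del\<^sup>2)) = 122 * L\<^sup>2 * del\<^sup>2"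
    by (simp add: power2_eq_square algebra_simps)
  finally show ?thesis by (simp only: defs a_def L_def)
qed

text \<open>\<open>hess\<close> says that the population derivative of the gradient, tested against
  the unperturbed inverse column, returns \<open>h j\<close>. The correction therefore removes
  exactly the error \<open>x' j - x0 j\<close>, and what is left is twice the bound for one
  half.\<close>

lemma debias_remainder:
  fixes F G
  assumes xx: "cov_pair K lam del eta p p Sx Tx F F"
    and yy: "cov_pair K lam del eta q q Sy Ty G G"
    and xy: "cov_pair K lam del eta p q Sxy Txy F G"
    and symS: "\<And>u v. bil p p Sx u v = bil p p Sx v u" "\<And>u v. bil q q Sy u v = bil q q Sy v u"
    and symT: "\<And>u v. bil p p Tx u v = bil p p Tx v u" "\<And>u v. bil q q Ty u v = bil q q Ty v u"
    and mem: "f \<in> F" "x0 \<in> F" "g \<in> G" "y0 \<in> G"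
    and near: "near p f1" "near q g1" "near p h" "near q k"
    and rho: "\<bar>\<rho>\<bar> \<le> K" and norm: "bil p p Sx x0 x0 = \<rho>" "bil q q Sy y0 y0 = \<rho>"
    and eig: "\<And>u. bil p q Sxy u y0 = \<rho> * bil p p Sx u x0"
      "\<And>v. bil p q Sxy x0 v = \<rho> * bil q q Sy v y0"
    and hess: "2 * \<rho> * bil p p Sx f h + 4 * bil p p Sx f x0 * bil p p Sx x0 h - 2 * bil p q Sxy f k
      + 2 * \<rho> * bil q q Sy g k + 4 * bil q q Sy g y0 * bil q q Sy y0 k - 2 * bil p q Sxy h g = h j"
  defines "Dx \<equiv> \<lambda>i j. Tx i j - Sx i j" and "Dy \<equiv> \<lambda>i j. Ty i j - Sy i j"
    and "Dxy \<equiv> \<lambda>i j. Txy i j - Sxy i j"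
    and "f' \<equiv> \<lambda>i. f i + f1 i" and "g' \<equiv> \<lambda>i. g i + g1 i"
    and "x' \<equiv> \<lambda>i. x0 i + h i" and "y' \<equiv> \<lambda>i. y0 i + k i"
  shows "\<bar>x' j
      - (2 * bil p p Tx x' x' * bil p p Tx f' x' - 2 * bil p q Txy f' y')
      - (2 * bil q q Ty y' y' * bil q q Ty g' y' - 2 * bil p q Txy x' g')
      - x0 j
      + 2 * (\<rho> * bil p p Dx f x0 - bil p q Dxy f y0 + bil p p Dx x0 x0 * bil p p Sx f x0
           + (\<rho> * bil q q Dy g y0 - bil p q Dxy x0 g + bil q q Dy y0 y0 * bil q q Sy g y0))\<bar>
    \<le> 244 * (K ^ 3)\<^sup>2 * del\<^sup>2"
proof -
  interpret xx: cov_pair K lam del eta p p Sx Tx F F by (rule xx)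
  interpret yy: cov_pair K lam del eta q q Sy Ty G G by (rule yy)
  interpret xy: cov_pair K lam del eta p q Sxy Txy F G by (rule xy)
  \<comment> \<open>The y half is the same statement with the cross form transposed and
    \<open>F\<close>, \<open>G\<close> exchanged.\<close>
  have yx: "cov_pair K lam del eta q p (\<lambda>i j. Sxy j i) (\<lambda>i j. Txy j i) G F"
  proof unfold_locales
    fix u v and a b :: real
    assume *: "0 < a" "0 < b" "L2_set u {..<q} \<le> a" "L2_set v {..<p} \<le> b"
    show "\<bar>bil q p (\<lambda>i j. Sxy j i) u v\<bar> \<le> K * a * b"
      unfolding bil_swap[of q p Sxy] using xy.S_bound[OF *(2,1,4,3)] by (simp add: mult_ac)
  next
    fix u v assume *: "u \<in> G" "v \<in> F"
    show "\<bar>bil q p (\<lambda>i j. Txy j i - Sxy j i) u v\<bar> \<le> K * lam"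
      using xy.D_bound[OF *(2,1)] unfolding bil_swap[of q p "\<lambda>i j. Txy i j - Sxy i j" u v] .
  qed (use xx.F yy.F in auto)
  have swapD: "bil q p (\<lambda>i j. Txy j i - Sxy j i) v u = bil p q Dxy u v" for u v
    unfolding Dxy_def by (rule bil_swap)
  note X = half_remainder[OF xx xy symS(1) symT(1) mem(1,2,4) near(1,3,4) rho norm(1) eig(1)]
  have Y: "\<bar>2 * bil q q Ty y' y' * bil q q Ty g' y' - 2 * bil p q Txy x' g'
    - (2 * \<rho> * bil q q Dy g y0 - 2 * bil p q Dxy x0 g + 2 * bil q q Dy y0 y0 * bil q q Sy g y0)
    - (2 * \<rho> * bil q q Sy g k + 4 * bil q q Sy g y0 * bil q q Sy y0 k - 2 * bil p q Sxy h g)\<bar>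
    \<le> 122 * (K ^ 3)\<^sup>2 * del\<^sup>2"
    using half_remainder[OF yy yx symS(2) symT(2) mem(3,4,2) near(2,4,3) rho norm(2)] eig(2)
    unfolding bil_swap[of q p Sxy] bil_swap[of q p Txy] swapD Dy_def g'_def y'_def x'_def by blast
  have h: "x' j - x0 j = (2 * \<rho> * bil p p Sx f h + 4 * bil p p Sx f x0 * bil p p Sx x0 h
      - 2 * bil p q Sxy f k)
      + (2 * \<rho> * bil q q Sy g k + 4 * bil q q Sy g y0 * bil q q Sy y0 k - 2 * bil p q Sxy h g)"
    unfolding x'_def using hess by simp
  show ?thesis
    by (rule order_trans[OF abs_halves_le[OF X[folded Dx_def Dxy_def f'_def x'_def y'_def] Y h]])
      (simp_all add: algebra_simps)
qed

end

text \<open>Rescaling the estimated directions by the root of the correlation enlarges the constant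
  in \<open>near\<close>. That constant is shared with the forms, which have to follow.\<close>

lemma cov_pair_mono:
  assumes "cov_pair K lam del eta d e S T F G" and "K \<le> K'"
  shows "cov_pair K' lam del eta d e S T F G"
proof -
  interpret cov_pair K lam del eta d e S T F G by (rule assms(1))
  show ?thesis
  proof unfold_locales
    show "1 \<le> K'" using K assms(2) by linarith
    show "\<bar>bil d e S u v\<bar> \<le> K' * a * b"
      if "0 < a" "0 < b" "L2_set u {..<d} \<le> a" "L2_set v {..<e} \<le> b" for u v a b
      using S_bound[OF that] assms(2) that(1,2)
      by (smt (verit, best) mult_right_mono)
    show "\<bar>bil d e D u v\<bar> \<le> K' * lam" if "u \<in> F" "v \<in> G" for u v
      using D_bound[OF that] assms(2) lam by (smt (verit, best) mult_right_mono)
    show "L2_set u {..<d} \<le> K'" if "u \<in> F" for u using F(2)[OF that] assms(2) by linarith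
    show "L2_set u {..<e} \<le> K'" if "u \<in> G" for u using G(2)[OF that] assms(2) by linarith
  qed (use lam del eta lam_eta lam_eta2 F(1) G(1) in auto)
qed

section \<open>Sign and size of the estimated canonical correlation\<close>

lemma ratio_estimate:
  fixes A B N \<rho> \<epsilon> :: real
  assumes A: "\<bar>A - 1\<bar> \<le> \<epsilon>" and B: "\<bar>B - 1\<bar> \<le> \<epsilon>" and e: "\<epsilon> \<le> 1 / 2"
    and N: "\<bar>N - \<rho>\<bar> \<le> \<epsilon>" and rho: "0 \<le> \<rho>"
  shows "\<bar>N / (sqrt A * sqrt B) - \<rho>\<bar> \<le> 2 * (1 + \<rho>) * \<epsilon>"
proof -
  define D where "D = sqrt A * sqrt B"
  have AB: "1 - \<epsilon> \<le> A" "A \<le> 1 + \<epsilon>" "1 - \<epsilon> \<le> B" "B \<le> 1 + \<epsilon>" using A B by linarith+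
  have e0: "0 \<le> \<epsilon>" using A by linarith
  \<comment> \<open>Bounding both roots by the same root makes their product rational again, so the
    denominator stays within \<epsilon> of 1 and above \<open>1 / 2\<close>. The latter is the
    factor 2 of the conclusion.\<close>
  have "sqrt (1 - \<epsilon>) * sqrt (1 - \<epsilon>) \<le> D" unfolding D_def
    using AB e e0 by (intro mult_mono) auto
  moreover have "D \<le> sqrt (1 + \<epsilon>) * sqrt (1 + \<epsilon>)" unfolding D_def
    using AB e e0 by (intro mult_mono) auto
  ultimately have D: "1 - \<epsilon> \<le> D" "D \<le> 1 + \<epsilon>" using e e0 by auto
  have D2: "1 / 2 \<le> D" using D e by linarith
  have "\<bar>N - \<rho> * D\<bar> \<le> \<bar>N - \<rho>\<bar> + \<rho> * \<bar>1 - D\<bar>"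
  proof -
    have "N - \<rho> * D = (N - \<rho>) + \<rho> * (1 - D)" by (simp add: algebra_simps)
    then show ?thesis using rho abs_triangle_ineq[of "N - \<rho>" "\<rho> * (1 - D)"]
      by (simp add: abs_mult)
  qed
  also have "\<dots> \<le> \<epsilon> + \<rho> * \<epsilon>"
    using N D rho by (intro add_mono mult_left_mono) auto
  finally have "\<bar>N - \<rho> * D\<bar> \<le> (1 + \<rho>) * \<epsilon>" by (simp add: algebra_simps)
  then have 1: "\<bar>N - \<rho> * D\<bar> / D \<le> (1 + \<rho>) * \<epsilon> / D"
    using D2 by (intro divide_right_mono) auto
  have "\<bar>N / D - \<rho>\<bar> = \<bar>N - \<rho> * D\<bar> / D"
    using D2 by (simp add: field_simps abs_divide)
  also note 1
  also have "(1 + \<rho>) * \<epsilon> / D \<le> (1 + \<rho>) * \<epsilon> / (1 / 2)"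
    using D2 rho e0 by (intro divide_left_mono) auto
  also have "\<dots> = 2 * (1 + \<rho>) * \<epsilon>" by simp
  finally show ?thesis unfolding D_def .
qed

text \<open>Difference of squares; only \<rho> has to stay away from 0, while \<open>r\<close> may
  vanish.\<close>

lemma sqrt_diff_le:
  assumes "0 \<le> r" "0 < \<rho>" shows "\<bar>sqrt r - sqrt \<rho>\<bar> \<le> \<bar>r - \<rho>\<bar> / sqrt \<rho>"
proof -
  have "\<bar>sqrt r - sqrt \<rho>\<bar> * sqrt \<rho> \<le> \<bar>sqrt r - sqrt \<rho>\<bar> * (sqrt r + sqrt \<rho>)"
    using assms by (intro mult_left_mono) auto
  also have "\<dots> = \<bar>(sqrt r - sqrt \<rho>) * (sqrt r + sqrt \<rho>)\<bar>"
    using assms by (simp add: abs_mult)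
  also have "(sqrt r - sqrt \<rho>) * (sqrt r + sqrt \<rho>) = r - \<rho>"
    using assms by (simp add: algebra_simps)
  finally show ?thesis using assms by (simp add: field_simps)
qed

context rates begin

text \<open>If the two directions carried opposite signs, the numerator would lie within
  \<open>7 * K ^ 3 * del < e\<close> of \<open>- \<rho>\<close> and be negative, against
  \<open>nonneg\<close>. The second claim is then \<open>ratio_estimate\<close> with the error of
  \<open>perturbed_form\<close>.\<close>

lemma oriented_correlation:
  fixes F G
  assumes xx: "cov_pair K lam del eta p p Sx Tx F F"
    and yy: "cov_pair K lam del eta q q Sy Ty G G"
    and xy: "cov_pair K lam del eta p q Sxy Txy F G"
    and mem: "a \<in> F" "b \<in> G" and near: "near p g" "near q h"
    and norm: "bil p p Sx a a = 1" "bil q q Sy b b = 1"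
    and cross: "bil p q Sxy a b = \<sigma> * \<rho>" "\<sigma> = 1 \<or> \<sigma> = - 1"
    and rho: "e \<le> \<rho>" "0 < e" and small: "7 * K ^ 3 * del \<le> 1 / 2" "7 * K ^ 3 * del < e"
  defines "a' \<equiv> \<lambda>i. a i + g i" and "b' \<equiv> \<lambda>i. b i + h i"
  defines "r \<equiv> bil p q Txy a' b' / (sqrt (bil p p Tx a' a') * sqrt (bil q q Ty b' b'))"
  assumes nonneg: "0 \<le> r"
  shows "\<sigma> = 1" and "\<bar>r - \<rho>\<bar> \<le> 2 * (1 + \<rho>) * (7 * K ^ 3 * del)"
proof -
  have A: "\<bar>bil p p Tx a' a' - 1\<bar> \<le> 7 * K ^ 3 * del"
    using cov_pair.perturbed_form[OF xx mem(1) mem(1) near(1) near(1)] norm by (simp add: a'_def)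
  have B: "\<bar>bil q q Ty b' b' - 1\<bar> \<le> 7 * K ^ 3 * del"
    using cov_pair.perturbed_form[OF yy mem(2) mem(2) near(2) near(2)] norm by (simp add: b'_def)
  have N: "\<bar>bil p q Txy a' b' - \<sigma> * \<rho>\<bar> \<le> 7 * K ^ 3 * del"
    using cov_pair.perturbed_form[OF xy mem near] cross by (simp add: a'_def b'_def)
  have pos: "0 < sqrt (bil p p Tx a' a') * sqrt (bil q q Ty b' b')"
    using A B small(1) by (intro mult_pos_pos) auto
  show s: "\<sigma> = 1"
  proof (rule ccontr)
    assume "\<sigma> \<noteq> 1"
    then have "bil p q Txy a' b' < 0" using N cross(2) rho small by auto
    then have "r < 0" unfolding r_def using pos by (simp add: divide_neg_pos)
    then show False using nonneg by simp
  qed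
  show "\<bar>r - \<rho>\<bar> \<le> 2 * (1 + \<rho>) * (7 * K ^ 3 * del)"
    unfolding r_def using ratio_estimate[OF A B small(1), of "bil p q Txy a' b'" \<rho>] N s rho by simp
qed

text \<open>The error is \<open>sqrt r * g + t * a\<close> with
  \<open>t = sqrt r - sqrt \<rho>\<close>. The second summand is a multiple of the true direction:
  \<open>t\<close> is of order \<open>del\<close>, but the l1 norm of \<open>a\<close> grows with
  the sparsity. The second part of hypothesis \<open>a\<close> says that \<open>eta\<close> absorbs
  this growth.\<close>

lemma scaled_direction:
  fixes a g :: "nat \<Rightarrow> real"
  assumes g: "near d g" and a: "L2_set a {..<d} \<le> K" "(\<Sum>i<d. \<bar>a i\<bar>) * del \<le> K * eta"
    and r: "0 \<le> r" "\<bar>r - \<rho>\<bar> \<le> C * del" and rho: "e \<le> \<rho>" "0 < e" "\<rho> \<le> K" and C: "0 \<le> C"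
    and K': "K' = (K + C / sqrt e) * K + C / sqrt e * K"
  defines "h \<equiv> \<lambda>i. sqrt r * (a i + g i) - sqrt \<rho> * a i"
  shows "L2_set h {..<d} \<le> K' * del" and "(\<Sum>i<d. \<bar>h i\<bar>) \<le> K' * eta"
proof -
  define t where "t = sqrt r - sqrt \<rho>"
  define C1 where "C1 = C / sqrt e"
  have C1: "0 \<le> C1" using C rho by (simp add: C1_def)
  have "\<bar>t\<bar> \<le> \<bar>r - \<rho>\<bar> / sqrt \<rho>" unfolding t_def using r rho by (intro sqrt_diff_le) auto
  also have "\<dots> \<le> (C * del) / sqrt e" using r rho C del_pos by (intro frac_le) auto
  finally have t: "\<bar>t\<bar> \<le> C1 * del" by (simp add: C1_def)
  have "sqrt \<rho> \<le> K"
  proof (rule real_le_lsqrt)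
    have "K * 1 \<le> K * K" using K by (intro mult_left_mono) linarith+
    then show "\<rho> \<le> K\<^sup>2" using rho(3) unfolding power2_eq_square by linarith
  qed (use K in simp)
  moreover have "C1 * del \<le> C1" using C1 del by (simp add: mult_left_le)
  ultimately have sr: "sqrt r \<le> K + C1" using t unfolding t_def by linarith
  have h: "h = (\<lambda>i. sqrt r * g i + t * a i)" by (auto simp: h_def t_def algebra_simps)
  have "L2_set h {..<d} \<le> L2_set (\<lambda>i. sqrt r * g i) {..<d} + L2_set (\<lambda>i. t * a i) {..<d}"
    unfolding h by (rule L2_set_triangle_ineq)
  also have "\<dots> = sqrt r * L2_set g {..<d} + \<bar>t\<bar> * L2_set a {..<d}"
    using L2_set_right_distrib[of "sqrt r" g "{..<d}"] L2_set_right_distrib[of "\<bar>t\<bar>" a "{..<d}"] r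
    by (simp add: L2_set_def power_mult_distrib)
  also have "\<dots> \<le> (K + C1) * (K * del) + (C1 * del) * K"
    using g a r sr t K C1 del_pos by (intro add_mono mult_mono) (auto simp: near_def)
  finally show "L2_set h {..<d} \<le> K' * del" by (simp add: K' C1_def algebra_simps)
  have "(\<Sum>i<d. \<bar>h i\<bar>) \<le> (\<Sum>i<d. sqrt r * \<bar>g i\<bar> + \<bar>t\<bar> * \<bar>a i\<bar>)"
  proof (rule sum_mono)
    fix i show "\<bar>h i\<bar> \<le> sqrt r * \<bar>g i\<bar> + \<bar>t\<bar> * \<bar>a i\<bar>"
      unfolding h using r abs_triangle_ineq[of "sqrt r * g i" "t * a i"] by (simp add: abs_mult)
  qed
  also have "\<dots> = sqrt r * (\<Sum>i<d. \<bar>g i\<bar>) + \<bar>t\<bar> * (\<Sum>i<d. \<bar>a i\<bar>)"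
    by (simp add: sum.distrib sum_distrib_left)
  also have "\<dots> \<le> (K + C1) * (K * eta) + (C1 * del) * (\<Sum>i<d. \<bar>a i\<bar>)"
    using g a r sr t K C1 del_pos eta
    by (intro add_mono mult_mono) (auto simp: near_def intro!: sum_nonneg)
  also have "(C1 * del) * (\<Sum>i<d. \<bar>a i\<bar>) \<le> C1 * (K * eta)"
    using mult_left_mono[OF a(2) C1] by (simp add: mult_ac)
  also have "(K + C1) * (K * eta) + C1 * (K * eta) = K' * eta"
    unfolding K' C1_def[symmetric] by (simp add: algebra_simps)
  finally show "(\<Sum>i<d. \<bar>h i\<bar>) \<le> K' * eta" by simp
qed

end

section \<open>The population Hessian\<close>

lemma bil_sum_left: "bil d e A (\<lambda>i. \<Sum>k\<in>I. c k * u k i) v = (\<Sum>k\<in>I. c k * bil d e A (u k) v)"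
proof (cases "finite I")
  case True
  then show ?thesis
  proof induction
    case (insert k I)
    then show ?case by (simp add: bil_add_left bil_scale_left)
  qed (simp add: bil_def)
qed (simp add: bil_def)

lemma bil_sum_right: "bil d e A v (\<lambda>i. \<Sum>k\<in>I. c k * u k i) = (\<Sum>k\<in>I. c k * bil d e A v (u k))"
  using bil_sum_left[of e d "\<lambda>i j. A j i" c u I v]
  by (simp only: bil_swap[of e d A])

lemma L2_set_square: "(L2_set u I)\<^sup>2 = (\<Sum>i\<in>I. (u i)\<^sup>2)"
  by (simp add: L2_set_def sum_nonneg)

lemma bil_identity: "bil d d (\<lambda>i j. of_bool (i = j)) u v = (\<Sum>i<d. u i * v i)"
  unfolding bil_def by (intro sum.cong refl) (subst sum.remove, auto intro!: sum.neutral)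

text \<open>A nonnegative form is minimal at \<open>v\<close>, so its derivative there vanishes in
  every direction \<open>w\<close>.\<close>

lemma form_zero_imp_kernel:
  assumes sym: "\<And>u v. bil d d A u v = bil d d A v u"
    and psd: "\<And>u. 0 \<le> bil d d A u u" and zero: "bil d d A v v = 0"
  shows "bil d d A w v = 0"
proof (rule ccontr)
  define x where "x = bil d d A w v"
  define y where "y = bil d d A w w"
  assume "bil d d A w v \<noteq> 0"
  then have x: "x \<noteq> 0" by (simp add: x_def)
  have y: "0 \<le> y" using psd by (simp add: y_def)
  have "0 \<le> 2 * t * x + t\<^sup>2 * y" for t
    using psd[of "\<lambda>i. v i + t * w i"] zero sym[of v w]
    by (simp add: bil_add_left bil_add_right bil_scale_left bil_scale_right x_def y_def
        power2_eq_square algebra_simps)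
  \<comment> \<open>The best \<open>t\<close> would be \<open>- x / y\<close>; the denominator
    \<open>1 + y\<close> still gives a negative value and covers \<open>y = 0\<close> as
    well.\<close>
  from this[of "- x / (1 + y)"] have "0 \<le> 2 * (- x / (1 + y)) * x + (- x / (1 + y))\<^sup>2 * y" .
  also have "\<dots> = x\<^sup>2 * (y - 2 * (1 + y)) / (1 + y)\<^sup>2"
  proof -
    have "1 + y \<noteq> 0" using y by simp
    then have "2 * (- x / (1 + y)) * x = x\<^sup>2 * (- 2 * (1 + y)) / (1 + y)\<^sup>2"
      by (simp add: divide_simps power2_eq_square) (simp add: algebra_simps)
    moreover have "(- x / (1 + y))\<^sup>2 * y = x\<^sup>2 * y / (1 + y)\<^sup>2"
      by (simp add: power_divide)
    ultimately show ?thesis by (simp add: add_divide_distrib[symmetric] algebra_simps)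
  qed
  finally have "0 \<le> x\<^sup>2 * (y - 2 * (1 + y)) / (1 + y)\<^sup>2" .
  moreover have "x\<^sup>2 * (y - 2 * (1 + y)) < 0" using x y by (intro mult_pos_neg) auto
  ultimately show False using y by (simp add: zero_le_divide_iff)
qed

text \<open>Pinning the coordinates from \<open>d\<close> on to 0 places this sphere as a closed set
  inside a product of compact sets, so Tychonoff's theorem applies in the function space.\<close>

lemma compact_sphere: "compact {u::nat \<Rightarrow> real. (\<forall>i. i \<ge> d \<longrightarrow> u i = 0) \<and> (\<Sum>i<d. (u i)\<^sup>2) = 1}"
proof -
  define S where "S = {u::nat \<Rightarrow> real. (\<forall>i. i \<ge> d \<longrightarrow> u i = 0) \<and> (\<Sum>i<d. (u i)\<^sup>2) = 1}"
  define B where "B = PiE (UNIV::nat set) (\<lambda>i. if i < d then {- 1..1::real} else {0})"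
  have "compactin (product_topology (\<lambda>i. euclidean) UNIV) B"
    unfolding B_def compactin_PiE by auto
  then have B: "compact B" by (simp add: euclidean_product_topology)
  have "S = (\<Inter>i\<in>{d..}. {u. u i = 0}) \<inter> {u. (\<Sum>i<d. (u i)\<^sup>2) = 1}" by (auto simp: S_def)
  moreover have "closed \<dots>"
    by (intro closed_Int closed_INT ballI closed_Collect_eq continuous_intros
        continuous_on_product_coordinates continuous_on_const continuous_on_power continuous_on_sum)
  ultimately have "closed S" by simp
  moreover have "S \<subseteq> B"
  proof
    fix u assume u: "u \<in> S"
    have "u i \<in> {- 1..1}" if "i < d" for i
    proof -
      have "(u i)\<^sup>2 \<le> (\<Sum>i<d. (u i)\<^sup>2)" using that by (intro member_le_sum) auto
      then have "(u i)\<^sup>2 \<le> 1" using u by (simp add: S_def)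
      then show ?thesis using abs_square_le_1[of "u i"] by (auto simp: abs_le_iff)
    qed
    then show "u \<in> B" using u by (auto simp: B_def S_def)
  qed
  ultimately show ?thesis unfolding S_def[symmetric] using B
    by (metis compact_Int_closed inf.absorb_iff2)
qed

text \<open>The Rayleigh quotient attains its minimum \<open>m\<close> on the sphere. The form of
  \<open>A - m I\<close> is then nonnegative and vanishes at the minimiser, which therefore lies in
  its kernel: it is an eigenvector for \<open>m\<close>, and the hypothesis on eigenvalues gives
  \<open>c \<le> m\<close>.\<close>

lemma form_lower_bound:
  fixes A :: "real mat"
  assumes A: "A \<in> carrier_mat d d"
    and sym: "\<And>i j. i < d \<Longrightarrow> j < d \<Longrightarrow> A $$ (i, j) = A $$ (j, i)"
    and ev: "\<And>e. eigenvalue A e \<Longrightarrow> c \<le> e"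
  shows "c * (L2_set u {..<d})\<^sup>2 \<le> bil d d (\<lambda>i j. A $$ (i, j)) u u"
proof (cases "(\<Sum>i<d. (u i)\<^sup>2) = 0")
  case True
  then have "\<And>i. i < d \<Longrightarrow> u i = 0" by (subst (asm) sum_nonneg_eq_0_iff) auto
  then have "bil d d (\<lambda>i j. A $$ (i, j)) u u = 0" by (simp add: bil_def)
  then show ?thesis using True by (simp add: L2_set_square)
next
  case False
  define a where "a = (\<lambda>i j. A $$ (i, j))"
  define S where "S = {u::nat \<Rightarrow> real. (\<forall>i. i \<ge> d \<longrightarrow> u i = 0) \<and> (\<Sum>i<d. (u i)\<^sup>2) = 1}"
  define nrm where "nrm = (\<lambda>u i. if i < d then u i / L2_set u {..<d} else (0::real))"
  have nS: "nrm w \<in> S" and nb: "bil d d a w w = bil d d a (nrm w) (nrm w) * (L2_set w {..<d})\<^sup>2"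
    if "(\<Sum>i<d. (w i)\<^sup>2) \<noteq> 0" for w
  proof -
    have pos: "L2_set w {..<d} \<noteq> 0" using that by (simp add: L2_set_def)
    have "(\<Sum>i<d. (nrm w i)\<^sup>2) = (\<Sum>i<d. (w i)\<^sup>2 / (L2_set w {..<d})\<^sup>2)"
      by (intro sum.cong) (auto simp: nrm_def power_divide)
    also have "\<dots> = 1" using pos that
      by (simp add: sum_divide_distrib[symmetric] L2_set_square)
    finally show "nrm w \<in> S" by (simp add: S_def nrm_def)
    have "bil d d a w w = bil d d a (\<lambda>i. L2_set w {..<d} * nrm w i) (\<lambda>i. L2_set w {..<d} * nrm w i)"
      using pos by (intro bil_cong) (auto simp: nrm_def)
    then show "bil d d a w w = bil d d a (nrm w) (nrm w) * (L2_set w {..<d})\<^sup>2"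
      by (simp add: bil_scale_left bil_scale_right power2_eq_square)
  qed
  have "continuous_on S (\<lambda>u. bil d d a u u)" unfolding bil_def
    by (intro continuous_intros continuous_on_sum continuous_on_mult continuous_on_const
        continuous_on_product_then_coordinatewise continuous_on_id)
  moreover have "S \<noteq> {}" using nS[OF False] by auto
  ultimately obtain v where v: "v \<in> S" "\<And>w. w \<in> S \<Longrightarrow> bil d d a v v \<le> bil d d a w w"
    using continuous_attains_inf[of S "\<lambda>u. bil d d a u u"] compact_sphere[of d] unfolding S_def by blast
  define m where "m = bil d d a v v"
  define Q where "Q = (\<lambda>i j. a i j - m * of_bool (i = j))"
  have Q: "bil d d Q w w' = bil d d a w w' - m * (\<Sum>i<d. w i * w' i)" for w w'
  proof -
    have "bil d d (\<lambda>i j. m * of_bool (i = j)) w w' = m * bil d d (\<lambda>i j. of_bool (i = j)) w w'"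
      unfolding bil_def by (simp add: sum_distrib_left mult_ac)
    then show ?thesis unfolding Q_def bil_diff_mat by (simp only: bil_identity)
  qed
  have lower: "m * (\<Sum>i<d. (w i)\<^sup>2) \<le> bil d d a w w" for w
  proof (cases "(\<Sum>i<d. (w i)\<^sup>2) = 0")
    case True
    then have "\<And>i. i < d \<Longrightarrow> w i = 0" by (subst (asm) sum_nonneg_eq_0_iff) auto
    then show ?thesis by (simp add: bil_def)
  next
    case False
    then show ?thesis using nb[OF False] v(2)[OF nS[OF False]]
      by (simp add: m_def L2_set_square mult_right_mono sum_nonneg)
  qed
  have "bil d d Q w v = 0" for w
  proof (rule form_zero_imp_kernel)
    show "bil d d Q u v = bil d d Q v u" for u v
      by (rule bil_sym) (auto simp: Q_def a_def sym)
    show "0 \<le> bil d d Q u u" for u using lower[of u] by (simp add: Q power2_eq_square)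
    show "bil d d Q v v = 0" using v(1) by (simp add: Q m_def S_def power2_eq_square)
  qed
  then have k: "(\<Sum>j<d. a i j * v j) = m * v i" if "i < d" for i
  proof -
    have "bil d d a (unit_fun i) v - m * (\<Sum>j<d. unit_fun i j * v j) = 0"
      using \<open>\<And>w. bil d d Q w v = 0\<close>[of "unit_fun i"] unfolding Q .
    moreover have "(\<Sum>j<d. unit_fun i j * v j) = v i" using that unfolding unit_fun_def
      by (subst sum.remove[of _ i]) (auto intro!: sum.neutral)
    ultimately show ?thesis using that by (simp add: bil_unit_left)
  qed
  have "eigenvector A (vec d v) m"
  proof -
    have "A *\<^sub>v vec d v = m \<cdot>\<^sub>v vec d v"
    proof (rule eq_vecI)
      fix i assume "i < dim_vec (m \<cdot>\<^sub>v vec d v)"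
      then have i: "i < d" by simp
      then have "(A *\<^sub>v vec d v) $ i = (\<Sum>j<d. a i j * v j)"
        using A by (simp add: scalar_prod_def a_def lessThan_atLeast0)
      then show "(A *\<^sub>v vec d v) $ i = (m \<cdot>\<^sub>v vec d v) $ i" using k[OF i] i by simp
    qed (use A in simp)
    moreover have "vec d v \<noteq> 0\<^sub>v d"
    proof
      assume "vec d v = 0\<^sub>v d"
      then have "\<And>i. i < d \<Longrightarrow> v i = 0" by (metis index_vec index_zero_vec(1))
      then show False using v(1) by (simp add: S_def)
    qed
    ultimately show ?thesis using A by (simp add: eigenvector_def)
  qed
  then have "c \<le> m" using ev by (auto simp: eigenvalue_def)
  then have "c * (\<Sum>i<d. (u i)\<^sup>2) \<le> m * (\<Sum>i<d. (u i)\<^sup>2)" by (intro mult_right_mono sum_nonneg) auto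
  also have "\<dots> \<le> bil d d a u u" by (rule lower)
  finally show ?thesis by (simp add: a_def L2_set_square)
qed

text \<open>Nonnegativity of the form at \<open>u - p\<close>, where \<open>p\<close> is the
  projection of \<open>u\<close> to the span of the \<open>U k\<close>, orthogonal for
  \<open>S\<close>.\<close>

lemma bessel:
  fixes U :: "nat \<Rightarrow> nat \<Rightarrow> real" and r :: nat
  assumes sym: "\<And>u v. bil d d S u v = bil d d S v u" and psd: "\<And>u. 0 \<le> bil d d S u u"
    and ortho: "\<And>k l. k < r \<Longrightarrow> l < r \<Longrightarrow> bil d d S (U k) (U l) = of_bool (k = l)"
  shows "(\<Sum>k<r. (bil d d S u (U k))\<^sup>2) \<le> bil d d S u u"
proof -
  define a where "a k = bil d d S u (U k)" for k
  define p where "p = (\<lambda>i. \<Sum>k<r. a k * U k i)"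
  have up: "bil d d S u p = (\<Sum>k<r. (a k)\<^sup>2)"
    unfolding p_def bil_sum_right by (simp add: a_def power2_eq_square)
  have "bil d d S (U k) p = a k" if "k < r" for k
  proof -
    have "bil d d S (U k) p = (\<Sum>l<r. a l * of_bool (k = l))"
      unfolding p_def bil_sum_right using ortho that by (intro sum.cong) auto
    also have "\<dots> = a k" using that by (subst sum.remove[of _ k]) (auto intro!: sum.neutral)
    finally show ?thesis .
  qed
  then have pp: "bil d d S p p = (\<Sum>k<r. (a k)\<^sup>2)"
    unfolding bil_sum_left[of d d S a U "{..<r}" p, folded p_def] by (simp add: power2_eq_square)
  have "0 \<le> bil d d S (\<lambda>i. u i - p i) (\<lambda>i. u i - p i)" by (rule psd)
  then show ?thesis unfolding bil_diff_left bil_diff_right using up pp sym[of p u] by (simp add: a_def)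
qed

text \<open>On the leading canonical pair the two rank-one corrections of the Hessian outweigh the
  cross term; on the remaining pairs the cross term is at most \<^term>\<open>\<Lambda>2\<close>.\<close>

lemma hessian_form_lower_bound:
  fixes U V :: "nat \<Rightarrow> nat \<Rightarrow> real" and r :: nat
  assumes symx: "\<And>u v. bil p p Sx u v = bil p p Sx v u" and psdx: "\<And>u. 0 \<le> bil p p Sx u u"
    and symy: "\<And>u v. bil q q Sy u v = bil q q Sy v u" and psdy: "\<And>u. 0 \<le> bil q q Sy u u"
    and orthox: "\<And>k l. k < r \<Longrightarrow> l < r \<Longrightarrow> bil p p Sx (U k) (U l) = of_bool (k = l)"
    and orthoy: "\<And>k l. k < r \<Longrightarrow> l < r \<Longrightarrow> bil q q Sy (V k) (V l) = of_bool (k = l)"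
    and cross: "\<And>u v. bil p q Sxy u v = (\<Sum>k<r. \<Lambda> k * bil p p Sx u (U k) * bil q q Sy v (V k))"
    and r: "0 < r" and pos: "\<And>k. k < r \<Longrightarrow> 0 \<le> \<Lambda> k" and L2: "0 \<le> \<Lambda>2" "\<Lambda>2 \<le> \<Lambda> 0"
    and gap: "\<And>k. 0 < k \<Longrightarrow> k < r \<Longrightarrow> \<Lambda> k \<le> \<Lambda>2"
  shows "2 * (\<Lambda> 0 - \<Lambda>2) * (bil p p Sx u u + bil q q Sy v v)
    \<le> 2 * \<Lambda> 0 * bil p p Sx u u + 4 * \<Lambda> 0 * (bil p p Sx u (U 0))\<^sup>2 - 4 * bil p q Sxy u v
      + 2 * \<Lambda> 0 * bil q q Sy v v + 4 * \<Lambda> 0 * (bil q q Sy v (V 0))\<^sup>2"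
proof -
  define a b where "a k = bil p p Sx u (U k)" and "b k = bil q q Sy v (V k)" for k
  define I where "I = {..<r} - {0}"
  have split: "(\<Sum>k<r. f k) = f 0 + (\<Sum>k\<in>I. f k)" for f :: "nat \<Rightarrow> real"
    unfolding I_def using r by (intro sum.remove) auto
  have P: "(\<Sum>k\<in>I. (a k)\<^sup>2) \<le> bil p p Sx u u"
    using bessel[OF symx psdx orthox, of r u] unfolding a_def[symmetric] split
    using zero_le_power2[of "a 0"] by linarith
  have Q: "(\<Sum>k\<in>I. (b k)\<^sup>2) \<le> bil q q Sy v v"
    using bessel[OF symy psdy orthoy, of r v] unfolding b_def[symmetric] split
    using zero_le_power2[of "b 0"] by linarith
  have "2 * (\<Sum>k\<in>I. \<Lambda> k * a k * b k) \<le> (\<Sum>k\<in>I. \<Lambda>2 * ((a k)\<^sup>2 + (b k)\<^sup>2))"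
    unfolding sum_distrib_left
  proof (rule sum_mono)
    fix k assume k: "k \<in> I"
    have ab: "2 * (a k * b k) \<le> (a k)\<^sup>2 + (b k)\<^sup>2" using sum_squares_bound[of "a k" "b k"] by simp
    have "2 * (\<Lambda> k * a k * b k) = \<Lambda> k * (2 * (a k * b k))" by simp
    also have "\<dots> \<le> \<Lambda> k * ((a k)\<^sup>2 + (b k)\<^sup>2)"
      using k pos ab by (intro mult_left_mono) (auto simp: I_def)
    also have "\<dots> \<le> \<Lambda>2 * ((a k)\<^sup>2 + (b k)\<^sup>2)"
      using k gap by (intro mult_right_mono) (auto simp: I_def)
    finally show "2 * (\<Lambda> k * a k * b k) \<le> \<Lambda>2 * ((a k)\<^sup>2 + (b k)\<^sup>2)" .
  qed
  also have "\<dots> = \<Lambda>2 * ((\<Sum>k\<in>I. (a k)\<^sup>2) + (\<Sum>k\<in>I. (b k)\<^sup>2))"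
    by (simp only: sum_distrib_left[symmetric] sum.distrib)
  also have "\<dots> \<le> \<Lambda>2 * (bil p p Sx u u + bil q q Sy v v)"
    using P Q L2 by (intro mult_left_mono add_mono) auto
  finally have rest: "2 * (\<Sum>k\<in>I. \<Lambda> k * a k * b k) \<le> \<Lambda>2 * (bil p p Sx u u + bil q q Sy v v)" .
  have "4 * (a 0 * b 0) \<le> 2 * ((a 0)\<^sup>2 + (b 0)\<^sup>2)"
    using sum_squares_bound[of "a 0" "b 0"] by simp
  also have "\<dots> \<le> 4 * ((a 0)\<^sup>2 + (b 0)\<^sup>2)" by simp
  finally have "4 * (a 0 * b 0) \<le> 4 * ((a 0)\<^sup>2 + (b 0)\<^sup>2)" .
  then have lead: "\<Lambda> 0 * (4 * (a 0 * b 0)) \<le> \<Lambda> 0 * (4 * ((a 0)\<^sup>2 + (b 0)\<^sup>2))"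
    using L2 by (intro mult_left_mono) auto
  have "bil p q Sxy u v = \<Lambda> 0 * a 0 * b 0 + (\<Sum>k\<in>I. \<Lambda> k * a k * b k)"
    unfolding cross split by (simp add: a_def b_def)
  then show ?thesis using rest lead unfolding a_def[symmetric] b_def[symmetric]
    by (simp add: algebra_simps)
qed

text \<open>A column of an inverse matrix, tested against itself, yields its diagonal entry
  \<open>f j\<close>, which its norm dominates. The quadratic bound thus becomes
  \<open>c * x\<^sup>2 \<le> x\<close>, and the other block is bounded through
  \<open>c * y\<^sup>2 \<le> x\<close>.\<close>

lemma inverse_column_bound:
  fixes f g :: "nat \<Rightarrow> real"
  assumes "c * ((L2_set f {..<p})\<^sup>2 + (L2_set g {..<q})\<^sup>2) \<le> f j" and "0 < c" "j < p"
  shows "L2_set f {..<p} \<le> 1 / c" and "L2_set g {..<q} \<le> 1 / c"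
proof -
  define x y where "x = L2_set f {..<p}" and "y = L2_set g {..<q}"
  have xy: "0 \<le> x" "0 \<le> y" by (auto simp: x_def y_def)
  have "f j \<le> x" unfolding x_def using assms(3) by (intro member_le_L2_set) auto
  then have *: "c * x\<^sup>2 + c * y\<^sup>2 \<le> x" using assms(1) by (simp add: x_def y_def algebra_simps)
  have "c * x\<^sup>2 \<le> x" using * assms(2) by (smt (verit) zero_le_mult_iff zero_le_power2)
  then have x: "x \<le> 1 / c"
    using assms(2) xy by (cases "x = 0") (auto simp: power2_eq_square field_simps)
  have "c * y\<^sup>2 \<le> x" using * assms(2) by (smt (verit) zero_le_mult_iff zero_le_power2)
  then have "c * (c * y\<^sup>2) \<le> c * x" using assms(2) by (intro mult_left_mono) auto
  also have "\<dots> \<le> 1" using x assms(2) by (simp add: field_simps)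
  finally have "y\<^sup>2 \<le> (1 / c)\<^sup>2" using assms(2) by (simp add: power2_eq_square field_simps)
  then have "y \<le> 1 / c" by (rule power2_le_imp_le) (use assms(2) in simp)
  then show "L2_set g {..<q} \<le> 1 / c" by (simp only: y_def)
  show "L2_set f {..<p} \<le> 1 / c" using x by (simp only: x_def)
qed

section \<open>Matrix expressions as bilinear forms\<close>

abbreviation mf :: "real mat \<Rightarrow> nat \<Rightarrow> nat \<Rightarrow> real" where "mf A \<equiv> \<lambda>i j. A $$ (i, j)"
abbreviation vf :: "real vec \<Rightarrow> nat \<Rightarrow> real" where "vf v \<equiv> \<lambda>i. v $ i"

lemma sum_append: "(\<Sum>i<p + q. f i) = (\<Sum>i<p. f i) + (\<Sum>i<q. f (p + i))" for f :: "nat \<Rightarrow> real"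
  by (induction q) (auto simp: add.assoc)

lemma mult_mat_vec_index:
  "A \<in> carrier_mat d e \<Longrightarrow> v \<in> carrier_vec e \<Longrightarrow> i < d \<Longrightarrow> (A *\<^sub>v v) $ i = (\<Sum>j<e. A $$ (i, j) * v $ j)" for A :: "real mat"
  by (simp add: scalar_prod_def lessThan_atLeast0)

lemma scalar_prod_bil:
  assumes "A \<in> carrier_mat d e" "u \<in> carrier_vec d" "v \<in> carrier_vec e"
  shows "scalar_prod u (A *\<^sub>v v) = bil d e (mf A) (vf u) (vf v)"
proof -
  have "scalar_prod u (A *\<^sub>v v) = (\<Sum>i<d. u $ i * (A *\<^sub>v v) $ i)"
    using assms by (simp add: scalar_prod_def lessThan_atLeast0)
  also have "\<dots> = (\<Sum>i<d. u $ i * (\<Sum>j<e. A $$ (i, j) * v $ j))"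
    using assms by (simp del: index_mult_mat_vec add: mult_mat_vec_index)
  finally show ?thesis by (simp add: bil_def sum_distrib_left mult_ac)
qed

lemma sum_sum_bil: "(\<Sum>i<d. u i * (\<Sum>j<e. A i j * v j)) = bil d e A u v"
  by (simp add: bil_def sum_distrib_left mult_ac)

lemma bil_mult_mat:
  assumes "A \<in> carrier_mat d m" "B \<in> carrier_mat m e"
  shows "bil d e (mf (A * B)) u v = (\<Sum>k<m. (\<Sum>i<d. u i * A $$ (i, k)) * (\<Sum>j<e. B $$ (k, j) * v j))"
proof -
  have "bil d e (mf (A * B)) u v = (\<Sum>i<d. \<Sum>j<e. \<Sum>k<m. u i * A $$ (i, k) * (B $$ (k, j) * v j))"
    unfolding bil_def using assms
    by (intro sum.cong refl)
      (simp add: scalar_prod_def lessThan_atLeast0 sum_distrib_left sum_distrib_right mult_ac)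
  also have "\<dots> = (\<Sum>i<d. \<Sum>k<m. \<Sum>j<e. u i * A $$ (i, k) * (B $$ (k, j) * v j))"
    by (intro sum.cong refl sum.swap)
  also have "\<dots> = (\<Sum>k<m. \<Sum>i<d. \<Sum>j<e. u i * A $$ (i, k) * (B $$ (k, j) * v j))"
    by (rule sum.swap)
  also have "\<dots> = (\<Sum>k<m. (\<Sum>i<d. u i * A $$ (i, k)) * (\<Sum>j<e. B $$ (k, j) * v j))"
    by (simp add: sum_product)
  finally show ?thesis .
qed

lemma bil_mult_rank_one:
  fixes a :: "real vec"
  assumes S: "S \<in> carrier_mat d d" and a: "a \<in> carrier_vec d"
  shows "bil d d (mf (S * outer_prod a a * S)) u v = bil d d (mf S) u (vf a) * bil d d (mf S) (vf a) v"
proof -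
  have o: "outer_prod a a \<in> carrier_mat d d" using a by (simp add: outer_prod_def)
  have "bil d d (mf (S * outer_prod a a * S)) u v
      = (\<Sum>k<d. (\<Sum>i<d. u i * (S * outer_prod a a) $$ (i, k)) * (\<Sum>j<d. S $$ (k, j) * v j))"
    using S o by (intro bil_mult_mat) auto
  also have "\<dots> = (\<Sum>k<d. (bil d d (mf S) u (vf a) * a $ k) * (\<Sum>j<d. S $$ (k, j) * v j))"
  proof (intro sum.cong refl arg_cong2[where f = "(*)"])
    fix k assume k: "k \<in> {..<d}"
    have "(S * outer_prod a a) $$ (i, k) = (\<Sum>l<d. S $$ (i, l) * a $ l) * a $ k" if "i < d" for i
      using S a o k that
      by (simp add: scalar_prod_def lessThan_atLeast0 outer_prod_def sum_distrib_left sum_distrib_right mult_ac)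
    then show "(\<Sum>i<d. u i * (S * outer_prod a a) $$ (i, k)) = bil d d (mf S) u (vf a) * a $ k"
      by (simp add: sum_sum_bil[symmetric] sum_distrib_left sum_distrib_right mult_ac)
  qed
  also have "\<dots> = bil d d (mf S) u (vf a) * (\<Sum>k<d. a $ k * (\<Sum>j<d. S $$ (k, j) * v j))"
    by (simp add: sum_distrib_left[of "bil d d (mf S) u (vf a)"] mult.assoc)
  finally show ?thesis by (simp only: sum_sum_bil)
qed

text \<open>This turns the cross covariance into a sum over canonical pairs, in which orthonormality
  leaves a single term. Symmetry of \<open>Sy\<close> is what lets row \<open>k\<close> of
  \<open>transpose_mat V * Sy\<close> be read as \<open>Sy\<close> applied to column
  \<open>k\<close> of \<open>V\<close>.\<close>

lemma canonical_decomposition_bil: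
  assumes Sx: "Sx \<in> carrier_mat p p" and Sy: "Sy \<in> carrier_mat q q"
    and U: "U \<in> carrier_mat p r" and V: "V \<in> carrier_mat q r"
    and symy: "\<And>i j. i < q \<Longrightarrow> j < q \<Longrightarrow> Sy $$ (i, j) = Sy $$ (j, i)"
    and Sxy: "Sxy = Sx * U * mat_diag r L * transpose_mat V * Sy"
  shows "bil p q (mf Sxy) u v
    = (\<Sum>k<r. L k * bil p p (mf Sx) u (vf (col U k)) * bil q q (mf Sy) v (vf (col V k)))"
proof -
  have c: "Sx * U * mat_diag r L \<in> carrier_mat p r" "transpose_mat V * Sy \<in> carrier_mat r q"
    using Sx Sy U V by (auto intro: mult_carrier_mat[OF mult_carrier_mat[OF Sx U]])
  moreover have "Sxy = (Sx * U * mat_diag r L) * (transpose_mat V * Sy)"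
    unfolding Sxy using V by (intro assoc_mult_mat[OF c(1) _ Sy]) auto
  ultimately have "bil p q (mf Sxy) u v = (\<Sum>k<r. (\<Sum>i<p. u i * (Sx * U * mat_diag r L) $$ (i, k))
      * (\<Sum>j<q. (transpose_mat V * Sy) $$ (k, j) * v j))"
    using bil_mult_mat by simp
  also have "\<dots> = (\<Sum>k<r. L k * bil p p (mf Sx) u (vf (col U k)) * bil q q (mf Sy) v (vf (col V k)))"
  proof (intro sum.cong refl arg_cong2[where f = "(*)"])
    fix k assume "k \<in> {..<r}"
    then have k: "k < r" by simp
    have "(Sx * U * mat_diag r L) $$ (i, k) = L k * (\<Sum>l<p. Sx $$ (i, l) * U $$ (l, k))" if "i < p" for i
      using Sx U k that mat_diag_mult_right[of "Sx * U" p r L]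
      by (simp add: scalar_prod_def lessThan_atLeast0)
    then have "(\<Sum>i<p. u i * (Sx * U * mat_diag r L) $$ (i, k))
        = L k * (\<Sum>i<p. u i * (\<Sum>l<p. Sx $$ (i, l) * U $$ (l, k)))"
      by (simp add: sum_distrib_left mult_ac)
    also have "\<dots> = L k * bil p p (mf Sx) u (\<lambda>l. U $$ (l, k))" by (simp only: sum_sum_bil)
    also have "bil p p (mf Sx) u (\<lambda>l. U $$ (l, k)) = bil p p (mf Sx) u (vf (col U k))"
      using U k by (intro bil_cong) auto
    finally show "(\<Sum>i<p. u i * (Sx * U * mat_diag r L) $$ (i, k)) = L k * bil p p (mf Sx) u (vf (col U k))" .
    have "(transpose_mat V * Sy) $$ (k, j) = (\<Sum>l<q. Sy $$ (j, l) * V $$ (l, k))" if "j < q" for j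
      using Sy V k that symy by (simp add: scalar_prod_def lessThan_atLeast0 mult.commute)
    then have "(\<Sum>j<q. (transpose_mat V * Sy) $$ (k, j) * v j)
        = (\<Sum>j<q. v j * (\<Sum>l<q. Sy $$ (j, l) * V $$ (l, k)))"
      by (simp add: mult.commute)
    also have "\<dots> = bil q q (mf Sy) v (\<lambda>l. V $$ (l, k))" by (simp only: sum_sum_bil)
    also have "\<dots> = bil q q (mf Sy) v (vf (col V k))"
      using V k by (intro bil_cong) auto
    finally show "(\<Sum>j<q. (transpose_mat V * Sy) $$ (k, j) * v j) = bil q q (mf Sy) v (vf (col V k))" .
  qed
  finally show ?thesis .
qed

lemma orthonormal_bil:
  assumes S: "S \<in> carrier_mat p p" and U: "U \<in> carrier_mat p r"
    and o: "transpose_mat U * S * U = 1\<^sub>m r" and k: "k < r" "l < r"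
  shows "bil p p (mf S) (vf (col U k)) (vf (col U l)) = of_bool (k = l)"
proof -
  have "transpose_mat U * S * U = transpose_mat U * (S * U)"
    using S U by (intro assoc_mult_mat) auto
  moreover have "(transpose_mat U * (S * U)) $$ (k, l) = scalar_prod (col U k) (S *\<^sub>v col U l)"
    using S U k by (simp add: mult_mat_vec_def)
  moreover have "scalar_prod (col U k) (S *\<^sub>v col U l) = bil p p (mf S) (vf (col U k)) (vf (col U l))"
    using S U k by (intro scalar_prod_bil) auto
  ultimately have "bil p p (mf S) (vf (col U k)) (vf (col U l)) = (transpose_mat U * S * U) $$ (k, l)"
    by (simp only:)
  then show ?thesis unfolding o using k by simp
qed

lemma hessian_carrier:
  assumes "Sx \<in> carrier_mat p p" "Sy \<in> carrier_mat q q" "Sxy \<in> carrier_mat p q"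
    "a \<in> carrier_vec p" "b \<in> carrier_vec q"
  shows "hessian Sx Sy Sxy \<rho> a b \<in> carrier_mat (p + q) (p + q)"
  using assms unfolding hessian_def
  by (intro smult_carrier_mat four_block_carrier_mat) (auto simp: outer_prod_def)

lemma hessian_bil:
  assumes Sx: "Sx \<in> carrier_mat p p" and Sy: "Sy \<in> carrier_mat q q" and Sxy: "Sxy \<in> carrier_mat p q"
    and a: "a \<in> carrier_vec p" and b: "b \<in> carrier_vec q" and rho: "\<rho> \<noteq> 0"
  defines "H \<equiv> hessian Sx Sy Sxy \<rho> a b"
  shows "bil (p + q) (p + q) (mf H) z w
    = 2 * \<rho> * bil p p (mf Sx) z w + 4 * \<rho> * (bil p p (mf Sx) z (vf a) * bil p p (mf Sx) (vf a) w)
      - 2 * bil p q (mf Sxy) z (\<lambda>i. w (p + i)) - 2 * bil p q (mf Sxy) w (\<lambda>i. z (p + i))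
      + 2 * \<rho> * bil q q (mf Sy) (\<lambda>i. z (p + i)) (\<lambda>i. w (p + i))
      + 4 * \<rho> * (bil q q (mf Sy) (\<lambda>i. z (p + i)) (vf b) * bil q q (mf Sy) (vf b) (\<lambda>i. w (p + i)))"
proof -
  define R1 where "R1 = Sx * outer_prod a a * Sx"
  define R2 where "R2 = Sy * outer_prod b b * Sy"
  have R: "R1 \<in> carrier_mat p p" "R2 \<in> carrier_mat q q"
    using Sx Sy a b by (auto simp: R1_def R2_def outer_prod_def)
  have H1: "H $$ (i, j) = 2 * \<rho> * Sx $$ (i, j) + 4 * \<rho> * R1 $$ (i, j)" if "i < p" "j < p" for i j
    unfolding H_def hessian_def R1_def[symmetric] R2_def[symmetric]
    using that Sx Sy Sxy R by (simp add: algebra_simps)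
  have H2: "H $$ (i, p + j) = - 2 * Sxy $$ (i, j)" if "i < p" "j < q" for i j
    unfolding H_def hessian_def R1_def[symmetric] R2_def[symmetric]
    using that Sx Sy Sxy R rho by simp
  have H3: "H $$ (p + i, j) = - 2 * Sxy $$ (j, i)" if "i < q" "j < p" for i j
    unfolding H_def hessian_def R1_def[symmetric] R2_def[symmetric]
    using that Sx Sy Sxy R rho by simp
  have H4: "H $$ (p + i, p + j) = 2 * \<rho> * Sy $$ (i, j) + 4 * \<rho> * R2 $$ (i, j)" if "i < q" "j < q" for i j
    unfolding H_def hessian_def R1_def[symmetric] R2_def[symmetric]
    using that Sx Sy Sxy R by (simp add: algebra_simps)
  have split: "bil (p + q) (p + q) (mf H) z w
      = bil p p (mf H) z w + bil p q (\<lambda>i j. H $$ (i, p + j)) z (\<lambda>i. w (p + i))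
        + (bil q p (\<lambda>i j. H $$ (p + i, j)) (\<lambda>i. z (p + i)) w
          + bil q q (\<lambda>i j. H $$ (p + i, p + j)) (\<lambda>i. z (p + i)) (\<lambda>i. w (p + i)))"
    unfolding bil_def sum_append by (simp add: sum.distrib)
  have E1: "bil p p (mf H) z w = 2 * \<rho> * bil p p (mf Sx) z w + 4 * \<rho> * bil p p (mf R1) z w"
    unfolding bil_def sum_distrib_left by (simp add: H1 algebra_simps sum.distrib)
  have E2: "bil p q (\<lambda>i j. H $$ (i, p + j)) z (\<lambda>i. w (p + i)) = - 2 * bil p q (mf Sxy) z (\<lambda>i. w (p + i))"
    unfolding bil_def sum_distrib_left by (simp add: H2 mult_ac sum_negf)
  have "bil q p (\<lambda>i j. H $$ (p + i, j)) (\<lambda>i. z (p + i)) w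
      = - 2 * bil q p (\<lambda>i j. Sxy $$ (j, i)) (\<lambda>i. z (p + i)) w"
    unfolding bil_def sum_distrib_left by (simp add: H3 mult_ac sum_negf)
  then have E3: "bil q p (\<lambda>i j. H $$ (p + i, j)) (\<lambda>i. z (p + i)) w
      = - 2 * bil p q (mf Sxy) w (\<lambda>i. z (p + i))"
    by (simp only: bil_swap[of q p "mf Sxy"])
  have E4: "bil q q (\<lambda>i j. H $$ (p + i, p + j)) (\<lambda>i. z (p + i)) (\<lambda>i. w (p + i))
      = 2 * \<rho> * bil q q (mf Sy) (\<lambda>i. z (p + i)) (\<lambda>i. w (p + i))
        + 4 * \<rho> * bil q q (mf R2) (\<lambda>i. z (p + i)) (\<lambda>i. w (p + i))"
    unfolding bil_def sum_distrib_left by (simp add: H4 distrib_left distrib_right mult_ac sum.distrib)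
  show ?thesis unfolding split E1 E2 E3 E4 R1_def R2_def bil_mult_rank_one[OF Sx a] bil_mult_rank_one[OF Sy b]
    by simp
qed

lemma inverse_bil:
  assumes H: "H \<in> carrier_mat d d" and P: "P \<in> carrier_mat d d" and HP: "inverts_mat H P" and j: "j < d"
  shows "bil d d (mf H) z (\<lambda>i. P $$ (i, j)) = z j"
proof -
  have *: "(\<Sum>l<d. H $$ (i, l) * P $$ (l, j)) = of_bool (i = j)" if "i < d" for i
  proof -
    have "(H * P) $$ (i, j) = (\<Sum>l<d. H $$ (i, l) * P $$ (l, j))"
      using H P j that by (simp add: scalar_prod_def lessThan_atLeast0)
    moreover have "(H * P) $$ (i, j) = of_bool (i = j)"
      using HP H j that by (simp add: inverts_mat_def)
    ultimately show ?thesis by simp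
  qed
  have "bil d d (mf H) z (\<lambda>i. P $$ (i, j)) = (\<Sum>i<d. z i * of_bool (i = j))"
    unfolding sum_sum_bil[symmetric] using * by simp
  also have "\<dots> = z j" using j by (subst sum.remove[of _ j]) (auto intro!: sum.neutral)
  finally show ?thesis .
qed

lemma debiased_index:
  fixes Phi Tx Ty Txy :: "real mat"
  assumes Phi: "Phi \<in> carrier_mat (p + q) (p + q)" and Tx: "Tx \<in> carrier_mat p p"
    and Ty: "Ty \<in> carrier_mat q q" and Txy: "Txy \<in> carrier_mat p q"
    and x: "x \<in> carrier_vec p" and y: "y \<in> carrier_vec q" and j: "j < p"
  defines "f \<equiv> \<lambda>i. Phi $$ (i, j)" and "g \<equiv> \<lambda>i. Phi $$ (p + i, j)"
  shows "vec_first (debiased Phi Tx Ty Txy x y) p $ j = x $ j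
    - (2 * bil p p (mf Tx) (vf x) (vf x) * bil p p (mf Tx) f (vf x) - 2 * bil p q (mf Txy) f (vf y))
    - (2 * bil q q (mf Ty) (vf y) (vf y) * bil q q (mf Ty) g (vf y) - 2 * bil p q (mf Txy) (vf x) g)"
proof -
  define G where "G = gradient Tx Ty Txy x y"
  have G: "G \<in> carrier_vec (p + q)"
    unfolding G_def gradient_def using Tx Ty Txy x y by (intro append_carrier_vec) auto
  have G1: "G $ i = 2 * bil p p (mf Tx) (vf x) (vf x) * (\<Sum>l<p. Tx $$ (i, l) * x $ l)
      - 2 * (\<Sum>l<q. Txy $$ (i, l) * y $ l)" if "i < p" for i
    unfolding G_def gradient_def using that Tx Ty Txy x y
    by (simp add: append_vec_def mult_mat_vec_index scalar_prod_bil[of Tx p p] del: index_mult_mat_vec)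
  have G2: "G $ (p + i) = 2 * bil q q (mf Ty) (vf y) (vf y) * (\<Sum>l<q. Ty $$ (i, l) * y $ l)
      - 2 * (\<Sum>l<p. Txy $$ (l, i) * x $ l)" if "i < q" for i
    unfolding G_def gradient_def using that Tx Ty Txy x y
    by (simp add: append_vec_def mult_mat_vec_index[of "transpose_mat Txy" q p]
        mult_mat_vec_index[of Ty q q] scalar_prod_bil[of Ty q q] del: index_mult_mat_vec)
  have "vec_first (debiased Phi Tx Ty Txy x y) p $ j = x $ j - (transpose_mat Phi *\<^sub>v G) $ j"
    unfolding vec_first_def debiased_def G_def[symmetric] using j x y Phi by simp
  also have "(transpose_mat Phi *\<^sub>v G) $ j = (\<Sum>i<p + q. Phi $$ (i, j) * G $ i)"
    using j Phi G by (simp add: mult_mat_vec_index[of "transpose_mat Phi" "p + q" "p + q"] del: index_mult_mat_vec)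
  also have "\<dots> = (\<Sum>i<p. f i * G $ i) + (\<Sum>i<q. g i * G $ (p + i))"
    unfolding f_def g_def by (rule sum_append)
  also have "(\<Sum>i<p. f i * G $ i) = 2 * bil p p (mf Tx) (vf x) (vf x) * bil p p (mf Tx) f (vf x)
      - 2 * bil p q (mf Txy) f (vf y)"
    unfolding sum_sum_bil[where u = f and d = p, symmetric] sum_distrib_left sum_subtractf[symmetric]
    by (intro sum.cong refl) (simp add: G1 right_diff_distrib sum_distrib_left sum_distrib_right mult_ac)
  also have "(\<Sum>i<q. g i * G $ (p + i)) = 2 * bil q q (mf Ty) (vf y) (vf y) * bil q q (mf Ty) g (vf y)
      - 2 * bil q p (\<lambda>i j. mf Txy j i) g (vf x)"
    unfolding sum_sum_bil[where u = g and d = q, symmetric] sum_distrib_left sum_subtractf[symmetric]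
    by (intro sum.cong refl) (simp add: G2 right_diff_distrib sum_distrib_left sum_distrib_right mult_ac)
  also have "bil q p (\<lambda>i j. mf Txy j i) g (vf x) = bil p q (mf Txy) (vf x) g" by (rule bil_swap)
  finally show ?thesis by simp
qed

text \<open>Here \<open>f\<close> and \<open>g\<close> are the blocks of a row, whereas the
  transposition in \<open>debiased\<close> produces a column in \<open>debiased_index\<close>.
  \<open>Phi_sym\<close> will identify the two for the population inverse.\<close>

lemma leading_term_index:
  fixes Phi Tx Ty Txy :: "real mat"
  assumes Phi: "Phi \<in> carrier_mat (p + q) (p + q)" and Tx: "Tx \<in> carrier_mat p p"
    and Ty: "Ty \<in> carrier_mat q q" and Txy: "Txy \<in> carrier_mat p q"
    and Sx: "Sx \<in> carrier_mat p p" and Sy: "Sy \<in> carrier_mat q q" and Sxy: "Sxy \<in> carrier_mat p q"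
    and x: "x \<in> carrier_vec p" and y: "y \<in> carrier_vec q" and j: "j < p"
  defines "f \<equiv> \<lambda>i. Phi $$ (j, i)" and "g \<equiv> \<lambda>i. Phi $$ (j, p + i)"
    and "Dx \<equiv> \<lambda>i j. Tx $$ (i, j) - Sx $$ (i, j)" and "Dy \<equiv> \<lambda>i j. Ty $$ (i, j) - Sy $$ (i, j)"
    and "Dxy \<equiv> \<lambda>i j. Txy $$ (i, j) - Sxy $$ (i, j)"
  shows "vec_first (leading_term Phi \<rho> Sx Sy Sxy Tx Ty Txy x y) p $ j
    = 2 * (\<rho> * bil p p Dx f (vf x) - bil p q Dxy f (vf y) + bil p p Dx (vf x) (vf x) * bil p p (mf Sx) f (vf x)
      + (\<rho> * bil q q Dy g (vf y) - bil p q Dxy (vf x) g + bil q q Dy (vf y) (vf y) * bil q q (mf Sy) g (vf y)))"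
proof -
  define G where "G = (\<rho> \<cdot>\<^sub>v ((Tx - Sx) *\<^sub>v x) - (Txy - Sxy) *\<^sub>v y
          + scalar_prod x ((Tx - Sx) *\<^sub>v x) \<cdot>\<^sub>v (Sx *\<^sub>v x)) @\<^sub>v
       (\<rho> \<cdot>\<^sub>v ((Ty - Sy) *\<^sub>v y) - transpose_mat (Txy - Sxy) *\<^sub>v x
          + scalar_prod y ((Ty - Sy) *\<^sub>v y) \<cdot>\<^sub>v (Sy *\<^sub>v y))"
  have D: "Tx - Sx \<in> carrier_mat p p" "Ty - Sy \<in> carrier_mat q q" "Txy - Sxy \<in> carrier_mat p q"
    using Sx Sy Sxy by (auto intro!: minus_carrier_mat)
  have bx: "scalar_prod x ((Tx - Sx) *\<^sub>v x) = bil p p Dx (vf x) (vf x)"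
    unfolding scalar_prod_bil[OF D(1) x x] Dx_def using Sx Tx by (intro bil_cong) auto
  have "by": "scalar_prod y ((Ty - Sy) *\<^sub>v y) = bil q q Dy (vf y) (vf y)"
    unfolding scalar_prod_bil[OF D(2) y y] Dy_def using Sy Ty by (intro bil_cong) auto
  have G: "G \<in> carrier_vec (p + q)"
    unfolding G_def using D Sx Sy x y by (intro append_carrier_vec add_carrier_vec minus_carrier_vec) auto
  have mx: "((Tx - Sx) *\<^sub>v x) $ i = (\<Sum>l<p. Dx i l * x $ l)" if "i < p" for i
    unfolding mult_mat_vec_index[OF D(1) x that] Dx_def using Sx Tx that by (intro sum.cong) auto
  have my: "((Ty - Sy) *\<^sub>v y) $ i = (\<Sum>l<q. Dy i l * y $ l)" if "i < q" for i
    unfolding mult_mat_vec_index[OF D(2) y that] Dy_def using Sy Ty that by (intro sum.cong) auto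
  have mxy: "((Txy - Sxy) *\<^sub>v y) $ i = (\<Sum>l<q. Dxy i l * y $ l)" if "i < p" for i
    unfolding mult_mat_vec_index[OF D(3) y that] Dxy_def using Sxy Txy that by (intro sum.cong) auto
  have myx: "(transpose_mat (Txy - Sxy) *\<^sub>v x) $ i = (\<Sum>l<p. Dxy l i * x $ l)" if "i < q" for i
  proof -
    have "transpose_mat (Txy - Sxy) \<in> carrier_mat q p" using D by simp
    from mult_mat_vec_index[OF this x that] show ?thesis
      unfolding Dxy_def using Sxy Txy that by simp
  qed
  have G1: "G $ i = \<rho> * (\<Sum>l<p. Dx i l * x $ l) - (\<Sum>l<q. Dxy i l * y $ l)
      + bil p p Dx (vf x) (vf x) * (\<Sum>l<p. Sx $$ (i, l) * x $ l)" if "i < p" for i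
    unfolding G_def bx "by" using that D Sx Sy Sxy x y mx[OF that] mxy[OF that] mult_mat_vec_index[OF Sx x that]
    by (simp add: append_vec_def del: index_mult_mat_vec)
  have G2: "G $ (p + i) = \<rho> * (\<Sum>l<q. Dy i l * y $ l) - (\<Sum>l<p. Dxy l i * x $ l)
      + bil q q Dy (vf y) (vf y) * (\<Sum>l<q. Sy $$ (i, l) * y $ l)" if "i < q" for i
    unfolding G_def bx "by" using that D Sx Sy Sxy x y my[OF that] myx[OF that] mult_mat_vec_index[OF Sy y that]
    by (simp add: append_vec_def del: index_mult_mat_vec)
  have "vec_first (leading_term Phi \<rho> Sx Sy Sxy Tx Ty Txy x y) p $ j = 2 * (Phi *\<^sub>v G) $ j"
    unfolding vec_first_def leading_term_def G_def[symmetric] using j Phi by simp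
  also have "(Phi *\<^sub>v G) $ j = (\<Sum>i<p + q. Phi $$ (j, i) * G $ i)"
    using j mult_mat_vec_index[OF Phi G, of j] by simp
  also have "\<dots> = (\<Sum>i<p. f i * G $ i) + (\<Sum>i<q. g i * G $ (p + i))"
    unfolding f_def g_def by (rule sum_append)
  also have "(\<Sum>i<p. f i * G $ i) = \<rho> * bil p p Dx f (vf x) - bil p q Dxy f (vf y)
      + bil p p Dx (vf x) (vf x) * bil p p (mf Sx) f (vf x)"
    unfolding sum_sum_bil[where u = f and d = p, symmetric] sum_distrib_left sum_subtractf[symmetric] sum.distrib[symmetric]
    by (intro sum.cong refl) (simp add: G1 distrib_left right_diff_distrib sum_distrib_left sum_distrib_right mult_ac)
  also have "(\<Sum>i<q. g i * G $ (p + i)) = \<rho> * bil q q Dy g (vf y) - bil q p (\<lambda>i j. Dxy j i) g (vf x)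
      + bil q q Dy (vf y) (vf y) * bil q q (mf Sy) g (vf y)"
    unfolding sum_sum_bil[where u = g and d = q, symmetric] sum_distrib_left sum_subtractf[symmetric] sum.distrib[symmetric]
    by (intro sum.cong refl) (simp add: G2 distrib_left right_diff_distrib sum_distrib_left sum_distrib_right mult_ac)
  also have "bil q p (\<lambda>i j. Dxy j i) g (vf x) = bil p q Dxy (vf x) g" by (rule bil_swap)
  finally show ?thesis by simp
qed

section \<open>Concentration of empirical covariances\<close>

lemma exp_le_quadratic: "exp x \<le> 1 + x + x\<^sup>2 / 2 * exp \<bar>x\<bar>" for x :: real
proof -
  obtain t where t: "\<bar>t\<bar> \<le> \<bar>x\<bar>" "exp x = (\<Sum>m<2. x ^ m / fact m) + exp t / fact 2 * x ^ 2"
    using Maclaurin_exp_le[of x 2] by blast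
  have "exp t * x\<^sup>2 \<le> exp \<bar>x\<bar> * x\<^sup>2" using t(1) by (intro mult_right_mono) auto
  moreover have "exp x = 1 + x + exp t * x\<^sup>2 / 2"
    using t(2) by (simp add: numeral_2_eq_2 lessThan_Suc)
  ultimately show ?thesis by (simp add: mult.commute)
qed

lemma square_le_exp_half: "y\<^sup>2 \<le> 8 * exp (y / 2)" if "0 \<le> y" for y :: real
  using exp_lower_Taylor_quadratic[of "y / 2"] that by (simp add: power_divide)

abbreviation exp_le2 :: "'a measure \<Rightarrow> ('a \<Rightarrow> real) \<Rightarrow> bool" where
  "exp_le2 M f \<equiv> (\<integral>\<^sup>+\<omega>. ennreal (exp (f \<omega>)) \<partial>M) \<le> 2"

context prob_space begin

text \<open>By \<open>1 + u \<le> exp u\<close>, \<open>\<bar>W \<omega>\<bar>\<close> is at most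
  \<tau> times \<open>exp (\<bar>W \<omega>\<bar> / \<tau>) - 1\<close>, and the mean of the latter
  is at most 1 because the exponential moment is at most 2.\<close>

lemma psi1_integrable:
  assumes W[measurable]: "W \<in> borel_measurable M" and tau: "0 < \<tau>"
    and psi: "exp_le2 M (\<lambda>\<omega>. \<bar>W \<omega>\<bar> / \<tau>)"
  shows "integrable M (\<lambda>\<omega>. exp (\<bar>W \<omega>\<bar> / \<tau>))" and "expectation (\<lambda>\<omega>. exp (\<bar>W \<omega>\<bar> / \<tau>)) \<le> 2"
    and "integrable M W" and "\<bar>expectation W\<bar> \<le> \<tau>"
proof -
  show E: "integrable M (\<lambda>\<omega>. exp (\<bar>W \<omega>\<bar> / \<tau>))"
    using psi by (intro integrableI_nonneg) (auto intro: le_less_trans)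
  have "ennreal (expectation (\<lambda>\<omega>. exp (\<bar>W \<omega>\<bar> / \<tau>))) \<le> ennreal 2"
    using psi by (subst nn_integral_eq_integral[symmetric, OF E]) auto
  then show E2: "expectation (\<lambda>\<omega>. exp (\<bar>W \<omega>\<bar> / \<tau>)) \<le> 2" by (subst (asm) ennreal_le_iff) auto
  have W_le: "\<bar>W \<omega>\<bar> \<le> \<tau> * exp (\<bar>W \<omega>\<bar> / \<tau>) - \<tau>" for \<omega>
  proof -
    have "1 + \<bar>W \<omega>\<bar> / \<tau> \<le> exp (\<bar>W \<omega>\<bar> / \<tau>)" by (rule exp_ge_add_one_self)
    then have "\<tau> * (1 + \<bar>W \<omega>\<bar> / \<tau>) \<le> \<tau> * exp (\<bar>W \<omega>\<bar> / \<tau>)" using tau by (intro mult_left_mono) auto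
    then show ?thesis using tau by (simp add: algebra_simps)
  qed
  show I: "integrable M W"
  proof (rule Bochner_Integration.integrable_bound)
    show "integrable M (\<lambda>\<omega>. \<tau> * exp (\<bar>W \<omega>\<bar> / \<tau>) - \<tau>)" using E by auto
    show "AE \<omega> in M. norm (W \<omega>) \<le> norm (\<tau> * exp (\<bar>W \<omega>\<bar> / \<tau>) - \<tau>)"
      using W_le by (intro AE_I2) (smt (verit) real_norm_def)
  qed simp
  have "\<bar>expectation W\<bar> \<le> expectation (\<lambda>\<omega>. \<bar>W \<omega>\<bar>)"
    using integral_norm_bound[of M W] by simp
  also have "\<dots> \<le> expectation (\<lambda>\<omega>. \<tau> * exp (\<bar>W \<omega>\<bar> / \<tau>) - \<tau>)"
    using W_le I E by (intro integral_mono) auto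
  also have "\<dots> = \<tau> * expectation (\<lambda>\<omega>. exp (\<bar>W \<omega>\<bar> / \<tau>)) - \<tau>"
    using E by (simp add: prob_space)
  also have "\<dots> \<le> \<tau> * 2 - \<tau>" using E2 tau by simp
  finally show "\<bar>expectation W\<bar> \<le> \<tau>" by simp
qed

text \<open>The Taylor remainder is a square times an exponential. Half of the available exponent
  absorbs the square, and \<open>\<theta> * \<tau> \<le> 1 / 2\<close> leaves the other half for the
  exponential. The mean is kept in the exponent, so \<open>W\<close> need not be centred
  first.\<close>

lemma psi1_mgf:
  assumes W[measurable]: "W \<in> borel_measurable M" and tau: "0 < \<tau>"
    and psi: "exp_le2 M (\<lambda>\<omega>. \<bar>W \<omega>\<bar> / \<tau>)"
    and theta: "0 \<le> \<theta>" "\<theta> * \<tau> \<le> 1 / 2"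
  shows "(\<integral>\<^sup>+\<omega>. ennreal (exp (\<theta> * W \<omega>)) \<partial>M) \<le> ennreal (exp (\<theta> * expectation W + 8 * (\<theta> * \<tau>)\<^sup>2))"
proof -
  note I = psi1_integrable[OF W tau psi]
  \<comment> \<open>Half of the 8 in \<open>square_le_exp_half\<close>; the moment bound 2 restores
    the 8 in the conclusion.\<close>
  define c where "c = 4 * (\<theta> * \<tau>)\<^sup>2"
  have pw: "exp (\<theta> * W \<omega>) \<le> 1 + \<theta> * W \<omega> + c * exp (\<bar>W \<omega>\<bar> / \<tau>)" for \<omega>
  proof -
    define y where "y = \<bar>W \<omega>\<bar> / \<tau>"
    have y: "0 \<le> y" "\<bar>W \<omega>\<bar> = \<tau> * y" using tau by (auto simp: y_def)
    have a: "\<bar>\<theta> * W \<omega>\<bar> = (\<theta> * \<tau>) * y" using theta y by (simp add: abs_mult)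
    also have "\<dots> \<le> (1 / 2) * y" using theta y by (intro mult_right_mono) auto
    finally have le: "\<bar>\<theta> * W \<omega>\<bar> \<le> y / 2" by simp
    have "(\<theta> * W \<omega>)\<^sup>2 = ((\<theta> * \<tau>) * y)\<^sup>2" using a by (metis power2_abs)
    also have "\<dots> = (\<theta> * \<tau>)\<^sup>2 * y\<^sup>2" by (simp add: power_mult_distrib)
    also have "\<dots> \<le> (\<theta> * \<tau>)\<^sup>2 * (8 * exp (y / 2))"
      using square_le_exp_half[OF y(1)] by (intro mult_left_mono) auto
    finally have "(\<theta> * W \<omega>)\<^sup>2 / 2 * exp \<bar>\<theta> * W \<omega>\<bar> \<le> (c * exp (y / 2)) * exp (y / 2)"
      using le by (intro mult_mono) (auto simp: c_def)
    also have "\<dots> = c * exp y" by (simp add: mult.assoc exp_add[symmetric])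
    finally show ?thesis using exp_le_quadratic[of "\<theta> * W \<omega>"] unfolding y_def by linarith
  qed
  have "(\<integral>\<^sup>+\<omega>. ennreal (exp (\<theta> * W \<omega>)) \<partial>M) \<le> (\<integral>\<^sup>+\<omega>. ennreal (1 + \<theta> * W \<omega> + c * exp (\<bar>W \<omega>\<bar> / \<tau>)) \<partial>M)"
    using pw by (intro nn_integral_mono ennreal_leI)
  also have "\<dots> = ennreal (expectation (\<lambda>\<omega>. 1 + \<theta> * W \<omega> + c * exp (\<bar>W \<omega>\<bar> / \<tau>)))"
    using I by (intro nn_integral_eq_integral AE_I2 order_trans[OF _ pw]) auto
  also have "expectation (\<lambda>\<omega>. 1 + \<theta> * W \<omega> + c * exp (\<bar>W \<omega>\<bar> / \<tau>))
      = 1 + \<theta> * expectation W + c * expectation (\<lambda>\<omega>. exp (\<bar>W \<omega>\<bar> / \<tau>))"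
    using I by (simp add: prob_space)
  also have "ennreal \<dots> \<le> ennreal (1 + (\<theta> * expectation W + 8 * (\<theta> * \<tau>)\<^sup>2))"
    using mult_left_mono[OF I(2), of c] by (intro ennreal_leI) (simp add: c_def)
  also have "\<dots> \<le> ennreal (exp (\<theta> * expectation W + 8 * (\<theta> * \<tau>)\<^sup>2))"
    by (intro ennreal_leI exp_ge_add_one_self)
  finally show ?thesis .
qed

text \<open>A product of two sub-Gaussian variables is sub-exponential: the inequality of arithmetic
  and geometric means is used once in the exponent and once for the two exponentials, so the
  threshold 2 is preserved.\<close>

lemma product_psi1:
  assumes [measurable]: "f \<in> borel_measurable M" "g \<in> borel_measurable M" and ab: "0 < a" "0 < b"
    and f: "exp_le2 M (\<lambda>\<omega>. (f \<omega> / a)\<^sup>2)"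
    and g: "exp_le2 M (\<lambda>\<omega>. (g \<omega> / b)\<^sup>2)"
  shows "exp_le2 M (\<lambda>\<omega>. \<bar>f \<omega> * g \<omega>\<bar> / (a * b))"
proof -
  have pw: "exp (\<bar>f \<omega> * g \<omega>\<bar> / (a * b)) \<le> exp ((f \<omega> / a)\<^sup>2) / 2 + exp ((g \<omega> / b)\<^sup>2) / 2" for \<omega>
  proof -
    define x y where "x = \<bar>f \<omega> / a\<bar>" and "y = \<bar>g \<omega> / b\<bar>"
    have "\<bar>f \<omega> * g \<omega>\<bar> / (a * b) = x * y" using ab by (simp add: x_def y_def abs_mult abs_divide)
    also have "\<dots> \<le> x\<^sup>2 / 2 + y\<^sup>2 / 2" using sum_squares_bound[of x y] by simp
    finally have "exp (\<bar>f \<omega> * g \<omega>\<bar> / (a * b)) \<le> exp (x\<^sup>2 / 2 + y\<^sup>2 / 2)" by simp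
    also have "\<dots> = exp (x\<^sup>2 / 2) * exp (y\<^sup>2 / 2)" by (rule exp_add)
    also have "\<dots> \<le> (exp (x\<^sup>2 / 2))\<^sup>2 / 2 + (exp (y\<^sup>2 / 2))\<^sup>2 / 2"
      using sum_squares_bound[of "exp (x\<^sup>2 / 2)" "exp (y\<^sup>2 / 2)"] by simp
    also have "\<dots> = exp (x\<^sup>2) / 2 + exp (y\<^sup>2) / 2"
      by (simp add: power2_eq_square[of "exp _"] exp_add[symmetric])
    finally show ?thesis unfolding x_def y_def power2_abs .
  qed
  have "(\<integral>\<^sup>+\<omega>. ennreal (exp (\<bar>f \<omega> * g \<omega>\<bar> / (a * b))) \<partial>M)
      \<le> (\<integral>\<^sup>+\<omega>. ennreal (1 / 2) * ennreal (exp ((f \<omega> / a)\<^sup>2)) + ennreal (1 / 2) * ennreal (exp ((g \<omega> / b)\<^sup>2)) \<partial>M)"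
  proof (rule nn_integral_mono)
    fix \<omega>
    have "ennreal (1 / 2) * ennreal (exp ((f \<omega> / a)\<^sup>2)) + ennreal (1 / 2) * ennreal (exp ((g \<omega> / b)\<^sup>2))
        = ennreal (1 / 2 * exp ((f \<omega> / a)\<^sup>2) + 1 / 2 * exp ((g \<omega> / b)\<^sup>2))"
      by (subst ennreal_plus, simp, simp) (simp only: ennreal_mult exp_ge_zero zero_le_divide_1_iff zero_le_numeral)
    then show "ennreal (exp (\<bar>f \<omega> * g \<omega>\<bar> / (a * b)))
      \<le> ennreal (1 / 2) * ennreal (exp ((f \<omega> / a)\<^sup>2)) + ennreal (1 / 2) * ennreal (exp ((g \<omega> / b)\<^sup>2))"
      using pw[of \<omega>] by (simp only: mult_1_left times_divide_eq_left ennreal_leI)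
  qed
  also have "\<dots> = ennreal (1 / 2) * (\<integral>\<^sup>+\<omega>. ennreal (exp ((f \<omega> / a)\<^sup>2)) \<partial>M)
      + ennreal (1 / 2) * (\<integral>\<^sup>+\<omega>. ennreal (exp ((g \<omega> / b)\<^sup>2)) \<partial>M)"
    by (subst nn_integral_add) (auto simp: nn_integral_cmult)
  also have "\<dots> \<le> ennreal (1 / 2) * 2 + ennreal (1 / 2) * 2"
    using f g by (intro add_mono mult_left_mono) auto
  also have "\<dots> = 2"
  proof -
    have "ennreal (1 / 2) * ennreal 2 = ennreal (1 / 2 * 2)" by (rule ennreal_mult[symmetric]) auto
    also have "1 / 2 * 2 = (1::real)" by simp
    finally have "ennreal (1 / 2) * 2 = 1" by (simp only: ennreal_numeral ennreal_1)
    then show ?thesis by (simp only: one_add_one)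
  qed
  finally show ?thesis .
qed

lemma empirical_mean_tail:
  fixes n :: nat and \<tau> \<epsilon> :: real
  assumes n: "0 < n" and indep: "indep_vars (\<lambda>_. N) Zs {..<n}" and Z: "Z \<in> measurable M N"
    and law: "\<And>i. i < n \<Longrightarrow> distr M N (Zs i) = distr M N Z"
    and g[measurable]: "g \<in> borel_measurable N" and tau: "0 < \<tau>"
    and psi: "exp_le2 M (\<lambda>\<omega>. \<bar>g (Z \<omega>)\<bar> / \<tau>)"
    and eps: "0 \<le> \<epsilon>" "\<epsilon> \<le> 8 * \<tau>"
  shows "prob {\<omega> \<in> space M. (\<Sum>i<n. g (Zs i \<omega>)) / n - expectation (\<lambda>\<omega>. g (Z \<omega>)) \<ge> \<epsilon>}
    \<le> exp (- (n * \<epsilon>\<^sup>2 / (32 * \<tau>\<^sup>2)))"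
proof -
  \<comment> \<open>The minimiser of
    \<open>8 * (\<theta> * \<tau>)\<^sup>2 - \<theta> * \<epsilon>\<close>, with minimum
    \<open>- (\<epsilon>\<^sup>2 / (32 * \<tau>\<^sup>2))\<close>. The hypothesis
    \<open>\<epsilon> \<le> 8 * \<tau>\<close> is exactly the admissibility condition
    \<open>\<theta> * \<tau> \<le> 1 / 2\<close>.\<close>
  define \<theta> where "\<theta> = \<epsilon> / (16 * \<tau>\<^sup>2)"
  define \<mu> where "\<mu> = expectation (\<lambda>\<omega>. g (Z \<omega>))"
  have Zs[measurable]: "Zs i \<in> measurable M N" if "i < n" for i
    using indep that by (auto simp: indep_vars_def)
  note Z[measurable]
  have theta: "0 \<le> \<theta>" "\<theta> * \<tau> \<le> 1 / 2"
    using eps tau by (auto simp: \<theta>_def power2_eq_square field_simps)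
  show ?thesis
  \<comment> \<open>The Chernoff bound needs a positive \<theta>; for \<open>\<epsilon> = 0\<close>
    the claimed bound is 1.\<close>
  proof (cases "\<epsilon> = 0")
    case False
    then have th: "0 < \<theta>" using eps tau by (simp add: \<theta>_def)
    have mgf: "(\<integral>\<^sup>+\<omega>. ennreal (exp (\<theta> * g (Zs i \<omega>))) \<partial>M) \<le> ennreal (exp (\<theta> * \<mu> + 8 * (\<theta> * \<tau>)\<^sup>2))"
      if i: "i < n" for i
    proof -
      have "(\<integral>\<^sup>+\<omega>. ennreal (exp (\<theta> * g (Zs i \<omega>))) \<partial>M) = (\<integral>\<^sup>+z. ennreal (exp (\<theta> * g z)) \<partial>distr M N (Zs i))"
        using i by (subst nn_integral_distr) auto
      also have "\<dots> = (\<integral>\<^sup>+\<omega>. ennreal (exp (\<theta> * g (Z \<omega>))) \<partial>M)"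
        unfolding law[OF i] by (subst nn_integral_distr) auto
      also have "\<dots> \<le> ennreal (exp (\<theta> * \<mu> + 8 * (\<theta> * \<tau>)\<^sup>2))"
        unfolding \<mu>_def by (intro psi1_mgf tau psi theta) auto
      finally show ?thesis .
    qed
    have ev: "{\<omega> \<in> space M. (\<Sum>i<n. g (Zs i \<omega>)) / n - \<mu> \<ge> \<epsilon>} = {\<omega> \<in> space M. (\<Sum>i<n. g (Zs i \<omega>)) \<ge> n * (\<mu> + \<epsilon>)}"
      using n by (auto simp: field_simps)
    have "ennreal (prob {\<omega> \<in> space M. (\<Sum>i<n. g (Zs i \<omega>)) \<ge> n * (\<mu> + \<epsilon>)})
        \<le> ennreal (exp (- \<theta> * (n * (\<mu> + \<epsilon>)))) * (\<integral>\<^sup>+\<omega>\<in>space M. ennreal (exp (\<theta> * (\<Sum>i<n. g (Zs i \<omega>)))) \<partial>M)"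
      unfolding emeasure_eq_measure[symmetric] using th by (intro Chernoff_ineq_nn_integral_ge) auto
    also have "(\<integral>\<^sup>+\<omega>\<in>space M. ennreal (exp (\<theta> * (\<Sum>i<n. g (Zs i \<omega>)))) \<partial>M)
        = (\<integral>\<^sup>+\<omega>. (\<Prod>i<n. ennreal (exp (\<theta> * g (Zs i \<omega>)))) \<partial>M)"
      by (intro nn_integral_cong) (simp add: sum_distrib_left exp_sum prod_ennreal)
    also have "\<dots> = (\<Prod>i<n. \<integral>\<^sup>+\<omega>. ennreal (exp (\<theta> * g (Zs i \<omega>))) \<partial>M)"
      by (intro indep_vars_nn_integral indep_vars_compose2[OF indep]) auto
    also have "\<dots> \<le> (\<Prod>i<n. ennreal (exp (\<theta> * \<mu> + 8 * (\<theta> * \<tau>)\<^sup>2)))"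
      using mgf by (intro prod_mono_ennreal) auto
    also have "\<dots> = ennreal (exp (n * (\<theta> * \<mu> + 8 * (\<theta> * \<tau>)\<^sup>2)))"
      by (simp add: ennreal_power exp_of_nat_mult)
    also have "ennreal (exp (- \<theta> * (n * (\<mu> + \<epsilon>)))) * \<dots>
        = ennreal (exp (- \<theta> * (n * (\<mu> + \<epsilon>)) + n * (\<theta> * \<mu> + 8 * (\<theta> * \<tau>)\<^sup>2)))"
      by (simp only: ennreal_mult[symmetric] exp_add[symmetric] exp_ge_zero)
    also have "- \<theta> * (n * (\<mu> + \<epsilon>)) + n * (\<theta> * \<mu> + 8 * (\<theta> * \<tau>)\<^sup>2) = n * (8 * (\<theta> * \<tau>)\<^sup>2 - \<theta> * \<epsilon>)"
      by (simp add: algebra_simps)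
    also have "8 * (\<theta> * \<tau>)\<^sup>2 - \<theta> * \<epsilon> = - (\<epsilon>\<^sup>2 / (32 * \<tau>\<^sup>2))"
      using tau by (simp add: \<theta>_def power2_eq_square field_simps)
    finally have "ennreal (prob {\<omega> \<in> space M. (\<Sum>i<n. g (Zs i \<omega>)) \<ge> n * (\<mu> + \<epsilon>)})
        \<le> ennreal (exp (- (n * \<epsilon>\<^sup>2 / (32 * \<tau>\<^sup>2))))"
      by (simp add: mult_left_mono)
    then show ?thesis unfolding \<mu>_def[symmetric] ev by (subst (asm) ennreal_le_iff) auto
  qed simp
qed

lemma empirical_mean_concentration:
  fixes n :: nat and \<tau> \<epsilon> :: real
  assumes n: "0 < n" and indep: "indep_vars (\<lambda>_. N) Zs {..<n}" and Z: "Z \<in> measurable M N"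
    and law: "\<And>i. i < n \<Longrightarrow> distr M N (Zs i) = distr M N Z"
    and g[measurable]: "g \<in> borel_measurable N" and tau: "0 < \<tau>"
    and psi: "exp_le2 M (\<lambda>\<omega>. \<bar>g (Z \<omega>)\<bar> / \<tau>)"
    and eps: "0 \<le> \<epsilon>" "\<epsilon> \<le> 8 * \<tau>"
  defines "E \<equiv> {\<omega> \<in> space M. \<bar>(\<Sum>i<n. g (Zs i \<omega>)) / n - expectation (\<lambda>\<omega>. g (Z \<omega>))\<bar> > \<epsilon>}"
  shows "E \<in> events"
    and "prob E
    \<le> 2 * exp (- (n * \<epsilon>\<^sup>2 / (32 * \<tau>\<^sup>2)))"
proof -
  have [measurable]: "Zs i \<in> measurable M N" if "i < n" for i
    using indep that by (auto simp: indep_vars_def)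
  let ?A = "{\<omega> \<in> space M. (\<Sum>i<n. g (Zs i \<omega>)) / n - expectation (\<lambda>\<omega>. g (Z \<omega>)) \<ge> \<epsilon>}"
  let ?B = "{\<omega> \<in> space M. (\<Sum>i<n. - g (Zs i \<omega>)) / n - expectation (\<lambda>\<omega>. - g (Z \<omega>)) \<ge> \<epsilon>}"
  show "E \<in> events"
    unfolding E_def by measurable
  have "prob E \<le> prob (?A \<union> ?B)"
  proof (rule finite_measure_mono)
    show "E \<subseteq> ?A \<union> ?B"
      by (auto simp: E_def sum_negf)
    show "?A \<union> ?B \<in> events" by measurable
  qed
  also have "\<dots> \<le> prob ?A + prob ?B" by (rule measure_Un_le) measurable
  also have "prob ?A \<le> exp (- (n * \<epsilon>\<^sup>2 / (32 * \<tau>\<^sup>2)))"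
    by (rule empirical_mean_tail[OF n indep Z law g tau psi eps])
  also have "prob ?B \<le> exp (- (n * \<epsilon>\<^sup>2 / (32 * \<tau>\<^sup>2)))"
    by (rule empirical_mean_tail[OF n indep Z law _ tau _ eps]) (use psi in auto)
  finally show "prob E
    \<le> 2 * exp (- (n * \<epsilon>\<^sup>2 / (32 * \<tau>\<^sup>2)))" by simp
qed

end

section \<open>From sub-Gaussian vectors to covariance forms\<close>

lemma subgauss_norm_bound:
  assumes K: "subgauss_norm M f \<le> ennreal K" and T: "K < T" "0 < T"
  shows "exp_le2 M (\<lambda>\<omega>. (f \<omega> / T)\<^sup>2)"
proof -
  \<comment> \<open>The infimum in the norm need not be attained; the gap between \<open>K\<close>
    and \<open>T\<close> provides an admissible \<open>t\<close> below \<open>T\<close>, and the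
    exponential moment only decreases from \<open>t\<close> to \<open>T\<close>.\<close>
  have "subgauss_norm M f < ennreal T" using K T by (simp add: ennreal_less_iff le_less_trans ennreal_lessI)
  then obtain t where t: "0 < t" "exp_le2 M (\<lambda>\<omega>. (f \<omega> / t)\<^sup>2)" "ennreal t < ennreal T"
    unfolding subgauss_norm_def by (auto simp: INF_less_iff)
  then have tT: "t \<le> T" by (simp add: ennreal_less_iff)
  have "(f \<omega> / T)\<^sup>2 \<le> (f \<omega> / t)\<^sup>2" for \<omega>
    using t(1) tT T by (simp add: power_divide frac_le power_mono)
  then have "(\<integral>\<^sup>+\<omega>. ennreal (exp ((f \<omega> / T)\<^sup>2)) \<partial>M) \<le> (\<integral>\<^sup>+\<omega>. ennreal (exp ((f \<omega> / t)\<^sup>2)) \<partial>M)"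
    by (intro nn_integral_mono ennreal_leI) simp
  with t(2) show ?thesis by simp
qed

lemma subgauss_vec_linear:
  assumes M: "prob_space M" and Z: "random_vec M d Z"
    and K: "subgauss_vec_norm M d Z \<le> ennreal K" and T: "K < T" "0 < T"
    and u: "L2_set u {..<d} \<le> R" "0 < R"
  shows "exp_le2 M (\<lambda>\<omega>. ((\<Sum>j<d. u j * Z \<omega> $ j) / (T * R))\<^sup>2)"
proof -
  interpret prob_space M by (rule M)
  define l where "l = L2_set u {..<d}"
  show ?thesis
  \<comment> \<open>The supremum in the vector norm runs over unit vectors, so a vector of norm 0
    cannot be normalised; its integrand is constantly 1.\<close>
  proof (cases "l = 0")
    case True
    then have "u j = 0" if "j < d" for j using that by (simp add: l_def L2_set_eq_0_iff)
    then show ?thesis by (simp add: emeasure_space_1)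
  next
    case False
    then have l: "0 < l" unfolding l_def by (simp add: less_le)
    define w where "w = vec d (\<lambda>j. u j / l)"
    have "l2_norm w = 1"
    proof -
      have "(\<Sum>j<d. (w $ j)\<^sup>2) = (\<Sum>j<d. (u j)\<^sup>2) / l\<^sup>2"
        by (simp add: w_def power_divide sum_divide_distrib)
      also have "(\<Sum>j<d. (u j)\<^sup>2) = l\<^sup>2" by (simp add: l_def L2_set_def sum_nonneg)
      finally show ?thesis using l by (simp add: l2_norm_def w_def)
    qed
    then have "subgauss_norm M (\<lambda>\<omega>. scalar_prod w (Z \<omega>)) \<le> subgauss_vec_norm M d Z"
      unfolding subgauss_vec_norm_def by (intro SUP_upper) (simp add: w_def)
    then have *: "exp_le2 M (\<lambda>\<omega>. (scalar_prod w (Z \<omega>) / T)\<^sup>2)"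
      using K by (intro subgauss_norm_bound[OF _ T]) auto
    have "(\<integral>\<^sup>+\<omega>. ennreal (exp (((\<Sum>j<d. u j * Z \<omega> $ j) / (T * R))\<^sup>2)) \<partial>M)
      \<le> (\<integral>\<^sup>+\<omega>. ennreal (exp ((scalar_prod w (Z \<omega>) / T)\<^sup>2)) \<partial>M)"
    proof (intro nn_integral_mono ennreal_leI)
      fix \<omega> assume "\<omega> \<in> space M"
      then have "dim_vec (Z \<omega>) = d" using Z by (auto simp: random_vec_def)
      then have "scalar_prod w (Z \<omega>) = (\<Sum>j<d. u j * Z \<omega> $ j) / l"
        by (simp add: scalar_prod_def w_def sum_divide_distrib lessThan_atLeast0)
      then have "((\<Sum>j<d. u j * Z \<omega> $ j) / (T * R))\<^sup>2 \<le> (scalar_prod w (Z \<omega>) / T)\<^sup>2"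
        using l u(1) T by (simp add: power_divide power_mult_distrib l_def[symmetric] frac_le power_mono mult_mono mult.commute)
      then show "exp (((\<Sum>j<d. u j * Z \<omega> $ j) / (T * R))\<^sup>2) \<le> exp ((scalar_prod w (Z \<omega>) / T)\<^sup>2)" by simp
    qed
    with * show ?thesis by simp
  qed
qed

abbreviation lin :: "nat \<Rightarrow> (nat \<Rightarrow> real) \<Rightarrow> real vec \<Rightarrow> real" where
  "lin d u x \<equiv> \<Sum>j<d. u j * x $ j"

lemma emp_cov_bil:
  "bil d e (\<lambda>i j. emp_cov n d e xs ys $$ (i, j)) u v
    = (\<Sum>i<n. (\<Sum>j<d. u j * xs i $ j) * (\<Sum>k<e. v k * ys i $ k)) / n"
proof -
  have "bil d e (\<lambda>i j. emp_cov n d e xs ys $$ (i, j)) u v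
      = (\<Sum>j<d. \<Sum>k<e. \<Sum>i<n. u j * (xs i $ j * ys i $ k) * v k / n)"
    unfolding bil_def
    by (intro sum.cong refl) (simp add: emp_cov_def sum_distrib_left sum_distrib_right sum_divide_distrib)
  also have "\<dots> = (\<Sum>j<d. \<Sum>i<n. \<Sum>k<e. u j * (xs i $ j * ys i $ k) * v k / n)"
    by (intro sum.cong refl sum.swap)
  also have "\<dots> = (\<Sum>i<n. \<Sum>j<d. \<Sum>k<e. u j * (xs i $ j * ys i $ k) * v k / n)"
    by (rule sum.swap)
  also have "\<dots> = (\<Sum>i<n. (\<Sum>j<d. u j * xs i $ j) * (\<Sum>k<e. v k * ys i $ k) / n)"
    by (intro sum.cong refl) (simp add: sum_product sum_divide_distrib mult_ac)
  finally show ?thesis by (simp add: sum_divide_distrib)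
qed

text \<open>Taking \<open>X\<close> and \<open>Y\<close> equal gives the marginal covariances, so
  the three blocks need one treatment only.\<close>

locale subgauss_pair = prob_space M for M :: "'a measure" +
  fixes d e :: nat and X Y :: "'a \<Rightarrow> real vec" and K T :: real
  assumes X: "random_vec M d X" and Y: "random_vec M e Y"
    and centX: "centered M d X" and centY: "centered M e Y"
    and subX: "subgauss_vec_norm M d X \<le> ennreal K"
    and subY: "subgauss_vec_norm M e Y \<le> ennreal K" and T: "K < T" "0 < T"
begin

lemma linX_measurable[measurable]: "(\<lambda>\<omega>. \<Sum>j<d. u j * X \<omega> $ j) \<in> borel_measurable M"
  using X unfolding random_vec_def by (intro borel_measurable_sum) auto

lemma linY_measurable[measurable]: "(\<lambda>\<omega>. \<Sum>j<e. u j * Y \<omega> $ j) \<in> borel_measurable M"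
  using Y unfolding random_vec_def by (intro borel_measurable_sum) auto

lemma product_psi:
  assumes "L2_set u {..<d} \<le> a" "0 < a" "L2_set v {..<e} \<le> b" "0 < b"
  shows "exp_le2 M (\<lambda>\<omega>. \<bar>lin d u (X \<omega>) * lin e v (Y \<omega>)\<bar> / (T\<^sup>2 * a * b))"
proof -
  have "exp_le2 M (\<lambda>\<omega>. \<bar>lin d u (X \<omega>) * lin e v (Y \<omega>)\<bar> / ((T * a) * (T * b)))"
    using assms T
    by (intro product_psi1 subgauss_vec_linear[OF _ X subX T] subgauss_vec_linear[OF _ Y subY T]) 
      (auto intro: prob_space_axioms)
  then show ?thesis by (simp add: power2_eq_square mult_ac)
qed

lemma product_integrable:
  "integrable M (\<lambda>\<omega>. lin d u (X \<omega>) * lin e v (Y \<omega>))"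
proof -
  \<comment> \<open>Adding 1 keeps the radius positive for the zero vector.\<close>
  have p: "0 < L2_set w I + 1" for w and I :: "nat set" by (smt (verit) L2_set_nonneg)
  show ?thesis
    using T by (intro psi1_integrable(3)[OF _ _ product_psi[of u "L2_set u {..<d} + 1" v "L2_set v {..<e} + 1"]])
      (auto simp: p)
qed

lemma coordinate_product_integrable:
  assumes "i < d" "j < e" shows "integrable M (\<lambda>\<omega>. X \<omega> $ i * Y \<omega> $ j)"
proof -
  have "(\<Sum>k<d. unit_fun i k * X \<omega> $ k) = X \<omega> $ i" "(\<Sum>k<e. unit_fun j k * Y \<omega> $ k) = Y \<omega> $ j" for \<omega>
    using assms unfolding unit_fun_def
    by (subst sum.remove[of _ i] sum.remove[of _ j]; auto intro!: sum.neutral)+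
  then show ?thesis using product_integrable[of "unit_fun i" "unit_fun j"] by simp
qed

lemma cross_cov_bil:
  "bil d e (\<lambda>i j. cross_cov M d e X Y $$ (i, j)) u v
    = expectation (\<lambda>\<omega>. lin d u (X \<omega>) * lin e v (Y \<omega>))"
proof -
  have "expectation (\<lambda>\<omega>. lin d u (X \<omega>) * lin e v (Y \<omega>))
      = expectation (\<lambda>\<omega>. \<Sum>j<d. \<Sum>k<e. u j * v k * (X \<omega> $ j * Y \<omega> $ k))"
    by (simp add: sum_product mult_ac)
  also have "\<dots> = (\<Sum>j<d. \<Sum>k<e. u j * v k * expectation (\<lambda>\<omega>. X \<omega> $ j * Y \<omega> $ k))"
  proof -
    have i: "integrable M (\<lambda>\<omega>. u j * v k * (X \<omega> $ j * Y \<omega> $ k))" if "j < d" "k < e" for j k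
      using that by (intro integrable_mult_right coordinate_product_integrable)
    have "expectation (\<lambda>\<omega>. \<Sum>j<d. \<Sum>k<e. u j * v k * (X \<omega> $ j * Y \<omega> $ k))
      = (\<Sum>j<d. expectation (\<lambda>\<omega>. \<Sum>k<e. u j * v k * (X \<omega> $ j * Y \<omega> $ k)))"
      by (intro Bochner_Integration.integral_sum Bochner_Integration.integrable_sum i; simp)
    also have "\<dots> = (\<Sum>j<d. \<Sum>k<e. expectation (\<lambda>\<omega>. u j * v k * (X \<omega> $ j * Y \<omega> $ k)))"
      by (intro sum.cong refl Bochner_Integration.integral_sum i; simp)
    finally show ?thesis by (simp only: integral_mult_right_zero)
  qed
  also have "\<dots> = bil d e (\<lambda>i j. cross_cov M d e X Y $$ (i, j)) u v"
    unfolding bil_def using centX centY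
    by (intro sum.cong refl) (simp add: cross_cov_def centered_def)
  finally show ?thesis by simp
qed

text \<open>A sub-exponential variable has mean at most its scale. This bounds every covariance form
  in l2 by \<open>T\<^sup>2\<close>, whatever the dimensions.\<close>

lemma cross_cov_bound:
  assumes "0 < a" "0 < b" "L2_set u {..<d} \<le> a" "L2_set v {..<e} \<le> b"
  shows "\<bar>bil d e (\<lambda>i j. cross_cov M d e X Y $$ (i, j)) u v\<bar> \<le> T\<^sup>2 * a * b"
  unfolding cross_cov_bil using assms T
  by (intro psi1_integrable(4)[OF _ _ product_psi]) auto

text \<open>Independence and equality of laws are given for the stacked vector only. The maps
  \<open>cx\<close> and \<open>cy\<close> locate the coordinates of the two factors in it, so that
  one statement covers all blocks.\<close>

lemma emp_cov_concentration:
  fixes n :: nat and \<epsilon> a b :: real and Zs :: "nat \<Rightarrow> 'a \<Rightarrow> real vec"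
  assumes n: "0 < n" and iid: "iid_copies M D n Zs Z"
    and cx: "\<And>j. j < d \<Longrightarrow> cx j < D" and cy: "\<And>j. j < e \<Longrightarrow> cy j < D"
    and Zx: "\<And>\<omega> j. \<omega> \<in> space M \<Longrightarrow> j < d \<Longrightarrow> X \<omega> $ j = Z \<omega> $ cx j"
      "\<And>\<omega> i j. \<omega> \<in> space M \<Longrightarrow> i < n \<Longrightarrow> j < d \<Longrightarrow> Xs i \<omega> $ j = Zs i \<omega> $ cx j"
    and Zy: "\<And>\<omega> j. \<omega> \<in> space M \<Longrightarrow> j < e \<Longrightarrow> Y \<omega> $ j = Z \<omega> $ cy j"
      "\<And>\<omega> i j. \<omega> \<in> space M \<Longrightarrow> i < n \<Longrightarrow> j < e \<Longrightarrow> Ys i \<omega> $ j = Zs i \<omega> $ cy j"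
    and u: "L2_set u {..<d} \<le> a" "0 < a" and v: "L2_set v {..<e} \<le> b" "0 < b"
    and eps: "0 \<le> \<epsilon>" "\<epsilon> \<le> 8 * (T\<^sup>2 * a * b)"
  defines "A \<equiv> {\<omega> \<in> space M. \<epsilon> < \<bar>bil d e (\<lambda>i j. emp_cov n d e (\<lambda>i. Xs i \<omega>) (\<lambda>i. Ys i \<omega>) $$ (i, j)
      - cross_cov M d e X Y $$ (i, j)) u v\<bar>}"
  shows "A \<in> events" and "prob A \<le> 2 * exp (- (n * \<epsilon>\<^sup>2 / (32 * (T\<^sup>2 * a * b)\<^sup>2)))"
proof -
  let ?N = "vec_space_borel D"
  define g where "g = (\<lambda>f::nat \<Rightarrow> real. (\<Sum>j<d. u j * f (cx j)) * (\<Sum>k<e. v k * f (cy k)))"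
  have g: "g \<in> borel_measurable ?N" unfolding g_def
    by (intro borel_measurable_times borel_measurable_sum borel_measurable_const measurable_component_singleton)
      (auto simp: cx cy)
  have gZ: "g (coords D (Z \<omega>)) = lin d u (X \<omega>) * lin e v (Y \<omega>)" if "\<omega> \<in> space M" for \<omega>
    using that by (simp add: g_def coords_def cx cy Zx Zy)
  have gZs: "g (coords D (Zs i \<omega>)) = lin d u (Xs i \<omega>) * lin e v (Ys i \<omega>)"
    if "\<omega> \<in> space M" "i < n" for \<omega> i
    using that by (simp add: g_def coords_def cx cy Zx Zy)
  have Z: "(\<lambda>\<omega>. coords D (Z \<omega>)) \<in> measurable M ?N"
    using iid unfolding iid_copies_def random_vec_def coords_def
    by (intro measurable_restrict) auto
  have ex: "expectation (\<lambda>\<omega>. g (coords D (Z \<omega>))) = bil d e (\<lambda>i j. cross_cov M d e X Y $$ (i, j)) u v"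
    unfolding cross_cov_bil by (intro Bochner_Integration.integral_cong refl gZ)
  have "(\<integral>\<^sup>+\<omega>. ennreal (exp (\<bar>g (coords D (Z \<omega>))\<bar> / (T\<^sup>2 * a * b))) \<partial>M)
      = (\<integral>\<^sup>+\<omega>. ennreal (exp (\<bar>lin d u (X \<omega>) * lin e v (Y \<omega>)\<bar> / (T\<^sup>2 * a * b))) \<partial>M)"
    by (intro nn_integral_cong) (simp add: gZ)
  then have psi: "exp_le2 M (\<lambda>\<omega>. \<bar>g (coords D (Z \<omega>))\<bar> / (T\<^sup>2 * a * b))"
    using product_psi[OF u v] by simp
  have A: "A = {\<omega> \<in> space M. \<bar>(\<Sum>i<n. g (coords D (Zs i \<omega>))) / n - expectation (\<lambda>\<omega>. g (coords D (Z \<omega>)))\<bar> > \<epsilon>}"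
    unfolding A_def ex bil_diff_mat emp_cov_bil by (intro Collect_cong conj_cong refl) (simp add: gZs)
  have ind: "indep_vars (\<lambda>_. ?N) (\<lambda>i \<omega>. coords D (Zs i \<omega>)) {..<n}"
    using iid by (auto simp: iid_copies_def)
  have law: "distr M ?N (\<lambda>\<omega>. coords D (Zs i \<omega>)) = distr M ?N (\<lambda>\<omega>. coords D (Z \<omega>))" if "i < n" for i
    using iid that by (auto simp: iid_copies_def law_def)
  have tau: "0 < T\<^sup>2 * a * b" using T u v by simp
  note C = empirical_mean_concentration[where g = g and Z = "\<lambda>\<omega>. coords D (Z \<omega>)"
      and Zs = "\<lambda>i \<omega>. coords D (Zs i \<omega>)", OF n ind Z law g tau psi eps]
  show "A \<in> events" unfolding A by (rule C(1))
  show "prob A \<le> 2 * exp (- (n * \<epsilon>\<^sup>2 / (32 * (T\<^sup>2 * a * b)\<^sup>2)))"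
    unfolding A by (rule C(2))
qed

end

lemma cross_cov_sym: "i < d \<Longrightarrow> j < d \<Longrightarrow> cross_cov M d d X X $$ (i, j) = cross_cov M d d X X $$ (j, i)"
  by (simp add: cross_cov_def mult.commute)

lemma emp_cov_sym: "i < d \<Longrightarrow> j < d \<Longrightarrow> emp_cov n d d xs xs $$ (i, j) = emp_cov n d d xs xs $$ (j, i)"
  by (simp add: emp_cov_def mult.commute)

section \<open>The canonical pair and the good event\<close>

lemma bil_smult_left: "x \<in> carrier_vec d \<Longrightarrow> bil d e A (vf (c \<cdot>\<^sub>v x)) v = c * bil d e A (vf x) v"
  unfolding bil_scale_left[symmetric] by (intro bil_cong) auto

lemma bil_smult_right: "x \<in> carrier_vec e \<Longrightarrow> bil d e A v (vf (c \<cdot>\<^sub>v x)) = c * bil d e A v (vf x)"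
  unfolding bil_scale_right[symmetric] by (intro bil_cong) auto

lemma L2_set_smult: "x \<in> carrier_vec d \<Longrightarrow> L2_set (vf (c \<cdot>\<^sub>v x)) {..<d} = \<bar>c\<bar> * L2_set (vf x) {..<d}"
  by (simp add: L2_set_def power_mult_distrib sum_distrib_left[symmetric] real_sqrt_mult)

lemma L2_set_minus: "L2_set (\<lambda>i. - u i) I = L2_set u I"
  by (simp add: L2_set_def)

text \<open>Triangle inequality for \<open>2 b = (a + b) - (a - b)\<close>: nothing is close to both
  \<open>b\<close> and \<open>- b\<close> unless \<open>b\<close> is small.\<close>

lemma signs_exclusive:
  assumes "L2_set (\<lambda>i. a i - b i) I \<le> m" "L2_set (\<lambda>i. a i + b i) I \<le> m'"
  shows "2 * L2_set b I \<le> m + m'"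
proof -
  have "2 * L2_set b I = L2_set (\<lambda>i. (a i + b i) + (- (a i - b i))) I"
    using L2_set_right_distrib[of 2 b I] by simp
  also have "\<dots> \<le> L2_set (\<lambda>i. a i + b i) I + L2_set (\<lambda>i. - (a i - b i)) I"
    by (rule L2_set_triangle_ineq)
  also have "L2_set (\<lambda>i. - (a i - b i)) I = L2_set (\<lambda>i. a i - b i) I" by (rule L2_set_minus)
  finally show ?thesis using assms by linarith
qed

lemma sign_dist_cases: "sign_dist N a b \<le> m \<Longrightarrow> N (1 \<cdot>\<^sub>v a - b) \<le> m \<or> N (- 1 \<cdot>\<^sub>v a - b) \<le> m"
  unfolding sign_dist_def by (auto simp: min_def split: if_splits)

text \<open>An explicit choice, by the l2 norm alone and with ties resolved to 1, so that it is a
  measurable function of the estimator.\<close>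

definition best_sign :: "real vec \<Rightarrow> real vec \<Rightarrow> real" where
  "best_sign a b = (if l2_norm (1 \<cdot>\<^sub>v a - b) \<le> l2_norm (- 1 \<cdot>\<^sub>v a - b) then 1 else - 1)"

lemma best_sign_cases: "best_sign a b = 1 \<or> best_sign a b = - 1"
  by (simp add: best_sign_def)

lemma norms_of_difference:
  assumes "a \<in> carrier_vec d" "b \<in> carrier_vec d"
  shows "l2_norm (1 \<cdot>\<^sub>v a - b) = L2_set (\<lambda>i. a $ i - b $ i) {..<d}"
    and "l2_norm (- 1 \<cdot>\<^sub>v a - b) = L2_set (\<lambda>i. a $ i + b $ i) {..<d}"
    and "l1_norm (1 \<cdot>\<^sub>v a - b) = (\<Sum>i<d. \<bar>a $ i - b $ i\<bar>)"
    and "l1_norm (- 1 \<cdot>\<^sub>v a - b) = (\<Sum>i<d. \<bar>a $ i + b $ i\<bar>)"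
proof -
  have "(- a $ i - b $ i)\<^sup>2 = (a $ i + b $ i)\<^sup>2" for i by (simp add: power2_eq_square algebra_simps)
  moreover have "\<bar>- a $ i - b $ i\<bar> = \<bar>a $ i + b $ i\<bar>" for i by simp
  ultimately show "l2_norm (1 \<cdot>\<^sub>v a - b) = L2_set (\<lambda>i. a $ i - b $ i) {..<d}"
    "l2_norm (- 1 \<cdot>\<^sub>v a - b) = L2_set (\<lambda>i. a $ i + b $ i) {..<d}"
    "l1_norm (1 \<cdot>\<^sub>v a - b) = (\<Sum>i<d. \<bar>a $ i - b $ i\<bar>)"
    "l1_norm (- 1 \<cdot>\<^sub>v a - b) = (\<Sum>i<d. \<bar>a $ i + b $ i\<bar>)"
    using assms by (auto simp: l2_norm_def l1_norm_def L2_set_def)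
qed

text \<open>Close to \<^term>\<open>b\<close>, the signs selected by the two norms coincide.\<close>

lemma best_sign_near:
  assumes a: "a \<in> carrier_vec d" and b: "b \<in> carrier_vec d"
    and l2: "sign_dist l2_norm a b \<le> m2" and l1: "sign_dist l1_norm a b \<le> m1"
    and small: "0 \<le> m1" "0 \<le> m2" "m1 + m2 < L2_set (vf b) {..<d}"
  defines "w \<equiv> best_sign a b"
  shows "L2_set (\<lambda>i. a $ i - (w \<cdot>\<^sub>v b) $ i) {..<d} \<le> m2"
    and "(\<Sum>i<d. \<bar>a $ i - (w \<cdot>\<^sub>v b) $ i\<bar>) \<le> m1"
proof -
  note n = norms_of_difference[OF a b]
  let ?P2 = "L2_set (\<lambda>i. a $ i - b $ i) {..<d}" and ?N2 = "L2_set (\<lambda>i. a $ i + b $ i) {..<d}"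
  let ?P1 = "\<Sum>i<d. \<bar>a $ i - b $ i\<bar>" and ?N1 = "\<Sum>i<d. \<bar>a $ i + b $ i\<bar>"
  have c2: "?P2 \<le> m2 \<or> ?N2 \<le> m2" and c1: "?P1 \<le> m1 \<or> ?N1 \<le> m1"
    using sign_dist_cases[OF l2] sign_dist_cases[OF l1] n by auto
  have P: "?P2 \<le> ?P1" and N: "?N2 \<le> ?N1" by (rule L2_set_le_sum_abs)+
  have ex: "2 * L2_set (vf b) {..<d} \<le> ?P2 + ?N2"
    by (rule signs_exclusive) auto
  have w: "w = (if ?P2 \<le> ?N2 then 1 else - 1)" unfolding w_def best_sign_def n ..
  \<comment> \<open>If the l1 bound held only for the other sign, then, l2 being below l1, both l2
    distances would be bounded by \<open>m1\<close> and \<open>m2\<close>, and \<open>ex\<close>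
    would make \<open>b\<close> too short.\<close>
  have "(w = 1 \<and> ?P2 \<le> m2 \<and> ?P1 \<le> m1) \<or> (w = - 1 \<and> ?N2 \<le> m2 \<and> ?N1 \<le> m1)"
    using c1 c2 P N ex small unfolding w by (cases "?P2 \<le> ?N2") (simp, argo)+
  moreover have "L2_set (\<lambda>i. a $ i - (w \<cdot>\<^sub>v b) $ i) {..<d} = L2_set (\<lambda>i. a $ i - w * b $ i) {..<d}"
    "(\<Sum>i<d. \<bar>a $ i - (w \<cdot>\<^sub>v b) $ i\<bar>) = (\<Sum>i<d. \<bar>a $ i - w * b $ i\<bar>)"
    using b by (auto intro!: L2_set_cong sum.cong)
  ultimately show "L2_set (\<lambda>i. a $ i - (w \<cdot>\<^sub>v b) $ i) {..<d} \<le> m2"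
    "(\<Sum>i<d. \<bar>a $ i - (w \<cdot>\<^sub>v b) $ i\<bar>) \<le> m1" by auto
qed

text \<open>The model at a single sample size. \<open>A\<close> bounds the three forms from above,
  \<open>1 / B\<close> the eigenvalues from below, and \<open>e0\<close> is the gap; these three
  will be common to all sample sizes, everything else may vary.\<close>

locale cca_population =
  fixes p q r :: nat and Sx Sy Sxy U V Phi :: "real mat" and Lam :: "nat \<Rightarrow> real"
    and Lam2 A B e0 :: real
  assumes carrier: "Sx \<in> carrier_mat p p" "Sy \<in> carrier_mat q q" "Sxy \<in> carrier_mat p q"
      "U \<in> carrier_mat p r" "V \<in> carrier_mat q r" "Phi \<in> carrier_mat (p + q) (p + q)"
    and symx: "\<And>i j. i < p \<Longrightarrow> j < p \<Longrightarrow> Sx $$ (i, j) = Sx $$ (j, i)"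
    and symy: "\<And>i j. i < q \<Longrightarrow> j < q \<Longrightarrow> Sy $$ (i, j) = Sy $$ (j, i)"
    and boundx: "\<And>u v a b. 0 < a \<Longrightarrow> 0 < b \<Longrightarrow> L2_set u {..<p} \<le> a \<Longrightarrow> L2_set v {..<p} \<le> b \<Longrightarrow>
      \<bar>bil p p (mf Sx) u v\<bar> \<le> A * a * b"
    and boundy: "\<And>u v a b. 0 < a \<Longrightarrow> 0 < b \<Longrightarrow> L2_set u {..<q} \<le> a \<Longrightarrow> L2_set v {..<q} \<le> b \<Longrightarrow>
      \<bar>bil q q (mf Sy) u v\<bar> \<le> A * a * b"
    and boundxy: "\<And>u v a b. 0 < a \<Longrightarrow> 0 < b \<Longrightarrow> L2_set u {..<p} \<le> a \<Longrightarrow> L2_set v {..<q} \<le> b \<Longrightarrow>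
      \<bar>bil p q (mf Sxy) u v\<bar> \<le> A * a * b"
    and A: "0 < A" and B: "0 < B" and e0: "0 < e0"
    and evx: "\<And>e. eigenvalue Sx e \<Longrightarrow> 1 / B \<le> e" and evy: "\<And>e. eigenvalue Sy e \<Longrightarrow> 1 / B \<le> e"
    and decomp: "Sxy = Sx * U * mat_diag r Lam * transpose_mat V * Sy"
    and ortho: "transpose_mat U * Sx * U = 1\<^sub>m r" "transpose_mat V * Sy * V = 1\<^sub>m r"
    and r: "1 \<le> r" and Lam_pos: "\<And>k. k < r \<Longrightarrow> 0 < Lam k"
    and Lam_decr: "\<And>k l. k \<le> l \<Longrightarrow> l < r \<Longrightarrow> Lam l \<le> Lam k"
    and Lam2: "Lam2 = (if r = 1 then 0 else Lam 1)" and gap: "e0 < Lam 0 - Lam2"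
    and inverse: "inverts_mat (hessian Sx Sy Sxy (Lam 0) (col U 0) (col V 0)) Phi"
begin

abbreviation Bx :: "(nat \<Rightarrow> real) \<Rightarrow> (nat \<Rightarrow> real) \<Rightarrow> real" where "Bx \<equiv> bil p p (mf Sx)"
abbreviation By :: "(nat \<Rightarrow> real) \<Rightarrow> (nat \<Rightarrow> real) \<Rightarrow> real" where "By \<equiv> bil q q (mf Sy)"
abbreviation Bxy :: "(nat \<Rightarrow> real) \<Rightarrow> (nat \<Rightarrow> real) \<Rightarrow> real" where "Bxy \<equiv> bil p q (mf Sxy)"

definition \<alpha> :: "real vec" where "\<alpha> = col U 0"
definition \<beta> :: "real vec" where "\<beta> = col V 0"
definition \<rho> :: real where "\<rho> = Lam 0"
definition x0 :: "real vec" where "x0 = sqrt \<rho> \<cdot>\<^sub>v \<alpha>"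
definition y0 :: "real vec" where "y0 = sqrt \<rho> \<cdot>\<^sub>v \<beta>"
definition \<phi> :: "nat \<Rightarrow> nat \<Rightarrow> real" where "\<phi> j = (\<lambda>i. Phi $$ (i, j))"
definition \<psi> :: "nat \<Rightarrow> nat \<Rightarrow> real" where "\<psi> j = (\<lambda>i. Phi $$ (p + i, j))"

text \<open>Unit vectors for duality, the x blocks of the columns of \<open>Phi\<close> that belong
  to coordinates of x, and the canonical directions before and after scaling. Both signs are present
  because the sign of the estimator is random; the factor \<open>1\<close> gives all of them the
  shape \<open>w \<cdot>\<^sub>v v\<close>.\<close>

definition F :: "(nat \<Rightarrow> real) set" where
  "F = unit_fun ` {..<p} \<union> \<phi> ` {..<p} \<union> {vf (1 \<cdot>\<^sub>v \<alpha>), vf (- 1 \<cdot>\<^sub>v \<alpha>), vf (1 \<cdot>\<^sub>v x0), vf (- 1 \<cdot>\<^sub>v x0)}"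

definition G :: "(nat \<Rightarrow> real) set" where
  "G = unit_fun ` {..<q} \<union> \<psi> ` {..<p} \<union> {vf (1 \<cdot>\<^sub>v \<beta>), vf (- 1 \<cdot>\<^sub>v \<beta>), vf (1 \<cdot>\<^sub>v y0), vf (- 1 \<cdot>\<^sub>v y0)}"

definition deviates :: "real mat \<Rightarrow> real mat \<Rightarrow> real mat \<Rightarrow> real \<Rightarrow> bool" where
  "deviates Tx Ty Txy c \<longleftrightarrow>
    (\<exists>u\<in>F. \<exists>v\<in>F. c < \<bar>bil p p (\<lambda>i j. Tx $$ (i, j) - Sx $$ (i, j)) u v\<bar>) \<or>
    (\<exists>u\<in>G. \<exists>v\<in>G. c < \<bar>bil q q (\<lambda>i j. Ty $$ (i, j) - Sy $$ (i, j)) u v\<bar>) \<or>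
    (\<exists>u\<in>F. \<exists>v\<in>G. c < \<bar>bil p q (\<lambda>i j. Txy $$ (i, j) - Sxy $$ (i, j)) u v\<bar>)"

text \<open>Built from \<open>A\<close>, \<open>B\<close> and \<open>e0\<close> alone, hence
  independent of the sample size. The summands dominate the norms of the family and the correlation,
  and summing them avoids nested maxima.\<close>

definition K0 :: real where
  "K0 = 1 + A + B + B / (2 * e0) + A * B + sqrt B + sqrt (A * B) * sqrt B"

lemma vecs: "\<alpha> \<in> carrier_vec p" "\<beta> \<in> carrier_vec q" "x0 \<in> carrier_vec p" "y0 \<in> carrier_vec q"
  using carrier by (auto simp: \<alpha>_def \<beta>_def x0_def y0_def)

lemma Lam2_bounds: "0 \<le> Lam2" "Lam2 \<le> Lam 0"
  using Lam_pos[of 1] r gap e0 by (auto simp: Lam2)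

lemma \<rho>_gt: "e0 < \<rho>"
  using gap Lam2_bounds by (simp add: \<rho>_def)

lemma form_sym: "Bx u v = Bx v u" "By w z = By z w"
  using symx symy by (auto intro!: bil_sym)

lemma lower: "(L2_set u {..<p})\<^sup>2 / B \<le> Bx u u" "(L2_set w {..<q})\<^sup>2 / B \<le> By w w"
  using form_lower_bound[OF carrier(1) symx evx] form_lower_bound[OF carrier(2) symy evy] by auto

lemma psd: "0 \<le> Bx u u" "0 \<le> By w w"
  using lower(1)[of u] lower(2)[of w] B by (auto intro: order_trans[rotated])

lemma cross: "Bxy u v
    = (\<Sum>k<r. Lam k * Bx u (vf (col U k)) * By v (vf (col V k)))"
  by (rule canonical_decomposition_bil[OF carrier(1,2,4,5) symy decomp])

lemma orthonormal:
  "k < r \<Longrightarrow> l < r \<Longrightarrow> Bx (vf (col U k)) (vf (col U l)) = of_bool (k = l)"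
  "k < r \<Longrightarrow> l < r \<Longrightarrow> By (vf (col V k)) (vf (col V l)) = of_bool (k = l)"
  using orthonormal_bil[OF carrier(1,4) ortho(1)] orthonormal_bil[OF carrier(2,5) ortho(2)] by auto

lemma norm_\<alpha>: "Bx (vf \<alpha>) (vf \<alpha>) = 1" and norm_\<beta>: "By (vf \<beta>) (vf \<beta>) = 1"
  unfolding \<alpha>_def \<beta>_def using orthonormal r by auto

lemma cross_\<beta>: "Bxy u (vf \<beta>) = \<rho> * Bx u (vf \<alpha>)"
proof -
  have "Bxy u (vf \<beta>) = (\<Sum>k<r. Lam k * Bx u (vf (col U k)) * of_bool (0 = k))"
    unfolding cross \<beta>_def using orthonormal(2) r by (intro sum.cong) auto
  also have "\<dots> = \<rho> * Bx u (vf \<alpha>)"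
    using r by (subst sum.remove[of _ 0]) (auto intro!: sum.neutral simp: \<rho>_def \<alpha>_def)
  finally show ?thesis .
qed

lemma cross_\<alpha>: "Bxy (vf \<alpha>) v = \<rho> * By v (vf \<beta>)"
proof -
  have "Bxy (vf \<alpha>) v = (\<Sum>k<r. Lam k * By v (vf (col V k)) * of_bool (0 = k))"
    unfolding cross \<alpha>_def using orthonormal(1) r by (intro sum.cong) auto
  also have "\<dots> = \<rho> * By v (vf \<beta>)"
    using r by (subst sum.remove[of _ 0]) (auto intro!: sum.neutral simp: \<rho>_def \<beta>_def)
  finally show ?thesis .
qed

lemma \<alpha>_le: "L2_set (vf \<alpha>) {..<p} \<le> sqrt B" and \<beta>_le: "L2_set (vf \<beta>) {..<q} \<le> sqrt B"
  using lower(1)[of "vf \<alpha>"] lower(2)[of "vf \<beta>"] norm_\<alpha> norm_\<beta> B by (auto intro!: real_le_rsqrt simp: field_simps)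

lemma \<rho>_le: "\<rho> \<le> A * B"
proof -
  have "\<rho> = Bxy (vf \<alpha>) (vf \<beta>)" using cross_\<beta>[of "vf \<alpha>"] norm_\<alpha> by simp
  also have "\<dots> \<le> A * sqrt B * sqrt B"
    using \<alpha>_le \<beta>_le B by (intro abs_le_D1[OF boundxy]) auto
  finally show ?thesis using B by (simp add: mult.assoc)
qed

text \<open>The normalisation gives \<open>1 \<le> A * n\<^sup>2\<close> for the l2 norm
  \<open>n\<close>. A lower bound is needed to tell a direction from its negative.\<close>

lemma \<alpha>_ge: "1 / sqrt A \<le> L2_set (vf \<alpha>) {..<p}" and \<beta>_ge: "1 / sqrt A \<le> L2_set (vf \<beta>) {..<q}"
proof -
  have *: "1 / sqrt A \<le> n" if "0 \<le> n" and "\<And>a. 0 < a \<Longrightarrow> n \<le> a \<Longrightarrow> 1 \<le> A * a * a" for n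
  proof (rule ccontr)
    assume n: "\<not> 1 / sqrt A \<le> n"
    \<comment> \<open>\<open>boundx\<close> and \<open>boundy\<close> ask for a positive radius, so
      the norm itself, possibly 0, is replaced by a point halfway to
      \<open>1 / sqrt A\<close>.\<close>
    define a where "a = (n + 1 / sqrt A) / 2"
    have a: "0 < a" "n \<le> a" "a < 1 / sqrt A" using n that(1) A by (auto simp: a_def)
    then have "a * a < 1 / sqrt A * (1 / sqrt A)" using A by (intro mult_strict_mono) auto
    then have "A * a * a < 1" using A by (simp add: field_simps)
    then show False using that(2)[OF a(1,2)] by simp
  qed
  show "1 / sqrt A \<le> L2_set (vf \<alpha>) {..<p}"
    using boundx[of _ _ "vf \<alpha>" "vf \<alpha>"] norm_\<alpha> by (intro *) auto
  show "1 / sqrt A \<le> L2_set (vf \<beta>) {..<q}"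
    using boundy[of _ _ "vf \<beta>" "vf \<beta>"] norm_\<beta> by (intro *) auto
qed

text \<open>The inversion of the Hessian, written blockwise. Symmetry and size of \<open>Phi\<close>
  and the cancellation of the linear error are all read off from this identity by choosing
  \<open>z\<close>.\<close>

lemma hessian_column:
  assumes "j < p + q"
  shows "2 * \<rho> * Bx z (\<phi> j) + 4 * \<rho> * (Bx z (vf \<alpha>) * Bx (vf \<alpha>) (\<phi> j))
      - 2 * Bxy z (\<psi> j) - 2 * Bxy (\<phi> j) (\<lambda>i. z (p + i))
      + 2 * \<rho> * By (\<lambda>i. z (p + i)) (\<psi> j)
      + 4 * \<rho> * (By (\<lambda>i. z (p + i)) (vf \<beta>) * By (vf \<beta>) (\<psi> j)) = z j"
proof -
  have H: "hessian Sx Sy Sxy \<rho> \<alpha> \<beta> \<in> carrier_mat (p + q) (p + q)"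
    using carrier vecs by (intro hessian_carrier)
  have "\<rho> \<noteq> 0" using \<rho>_gt e0 by simp
  from hessian_bil[OF carrier(1-3) vecs(1,2) this, of z "\<phi> j"] show ?thesis
    using inverse_bil[OF H carrier(6) inverse[folded \<alpha>_def \<beta>_def \<rho>_def] assms, of z]
    by (simp add: \<phi>_def \<psi>_def)
qed

text \<open>The Hessian form is symmetric; evaluated at columns \<open>i\<close> and
  \<open>j\<close> of its inverse it equals the entry at either order of the indices.\<close>

lemma Phi_sym: assumes "i < p + q" "j < p + q" shows "Phi $$ (i, j) = Phi $$ (j, i)"
proof -
  have a: "(\<lambda>i. \<phi> k (p + i)) = \<psi> k" for k by (simp add: \<phi>_def \<psi>_def)
  have "\<phi> i j = \<phi> j i"
    using hessian_column[OF assms(1), of "\<phi> j"] hessian_column[OF assms(2), of "\<phi> i"]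
    unfolding a using form_sym(1)[of "\<phi> i" "\<phi> j"] form_sym(1)[of "vf \<alpha>"]
      form_sym(2)[of "\<psi> i" "\<psi> j"] form_sym(2)[of "vf \<beta>"]
    by (simp add: mult.commute)
  then show ?thesis by (simp add: \<phi>_def)
qed

text \<open>The Hessian form of column \<open>j\<close> at itself is the entry
  \<open>\<phi> j j\<close>, and the eigengap bounds that form below by \<open>2 * e0 / B\<close>
  times the squared l2 norm.\<close>

lemma column_le:
  assumes "j < p" shows "L2_set (\<phi> j) {..<p} \<le> B / (2 * e0)" "L2_set (\<psi> j) {..<q} \<le> B / (2 * e0)"
proof -
  have a: "(\<lambda>i. \<phi> j (p + i)) = \<psi> j" by (simp add: \<phi>_def \<psi>_def)
  have "2 * e0 / B * ((L2_set (\<phi> j) {..<p})\<^sup>2 + (L2_set (\<psi> j) {..<q})\<^sup>2)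
      = 2 * e0 * ((L2_set (\<phi> j) {..<p})\<^sup>2 / B + (L2_set (\<psi> j) {..<q})\<^sup>2 / B)"
    using B by (simp add: field_simps)
  also have "\<dots> \<le> 2 * (Lam 0 - Lam2) * (Bx (\<phi> j) (\<phi> j) + By (\<psi> j) (\<psi> j))"
    using lower(1)[of "\<phi> j"] lower(2)[of "\<psi> j"] gap e0 B by (intro mult_mono add_mono) auto
  also have "\<dots> \<le> 2 * \<rho> * Bx (\<phi> j) (\<phi> j) + 4 * \<rho> * (Bx (\<phi> j) (vf \<alpha>))\<^sup>2
      - 4 * Bxy (\<phi> j) (\<psi> j)
      + 2 * \<rho> * By (\<psi> j) (\<psi> j) + 4 * \<rho> * (By (\<psi> j) (vf \<beta>))\<^sup>2"
    unfolding \<rho>_def \<alpha>_def \<beta>_def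
  proof (rule hessian_form_lower_bound[where r = r])
    show "Lam k \<le> Lam2" if "0 < k" "k < r" for k
      using that Lam_decr[of 1 k] by (auto simp: Lam2)
  qed (use form_sym psd orthonormal cross r Lam2_bounds Lam_pos in \<open>auto intro: less_imp_le\<close>)
  also have "\<dots> = \<phi> j j"
    using hessian_column[of j "\<phi> j"] assms unfolding a form_sym(1)[of "vf \<alpha>"] form_sym(2)[of "vf \<beta>"]
    by (simp add: power2_eq_square)
  finally have "2 * e0 / B * ((L2_set (\<phi> j) {..<p})\<^sup>2 + (L2_set (\<psi> j) {..<q})\<^sup>2) \<le> \<phi> j j" .
  from inverse_column_bound[OF this _ assms] show
    "L2_set (\<phi> j) {..<p} \<le> B / (2 * e0)" "L2_set (\<psi> j) {..<q} \<le> B / (2 * e0)"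
    using e0 B by auto
qed

lemma L2_set_unit_fun: "L2_set (unit_fun i) {..<d} \<le> 1"
proof -
  have "(\<Sum>k<d. (unit_fun i k)\<^sup>2) \<le> 1"
  proof -
    have "(\<Sum>k<d. (unit_fun i k)\<^sup>2) = (\<Sum>k<d. if k = i then 1 else 0)"
      by (intro sum.cong) (auto simp: unit_fun_def)
    then show ?thesis by simp
  qed
  then show ?thesis by (simp add: L2_set_def)
qed

lemma K0_ge: "1 \<le> K0" "A \<le> K0" "\<rho> \<le> K0" "sqrt B \<le> K0" "B / (2 * e0) \<le> K0" "sqrt \<rho> * sqrt B \<le> K0"
proof -
  have "sqrt \<rho> * sqrt B \<le> sqrt (A * B) * sqrt B"
    using \<rho>_le B by (intro mult_right_mono) auto
  moreover have "0 \<le> A * B" "0 \<le> B / (2 * e0)" "0 \<le> sqrt B" "0 \<le> sqrt (A * B) * sqrt B"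
    using A B e0 by auto
  ultimately show "1 \<le> K0" "A \<le> K0" "\<rho> \<le> K0" "sqrt B \<le> K0" "B / (2 * e0) \<le> K0" "sqrt \<rho> * sqrt B \<le> K0"
    using A B \<rho>_le unfolding K0_def by linarith+
qed

lemma F_le: "u \<in> F \<Longrightarrow> L2_set u {..<p} \<le> K0" and G_le: "v \<in> G \<Longrightarrow> L2_set v {..<q} \<le> K0"
proof -
  have \<rho>: "0 \<le> \<rho>" using \<rho>_gt e0 by simp
  have "L2_set (vf x0) {..<p} \<le> sqrt \<rho> * sqrt B" "L2_set (vf y0) {..<q} \<le> sqrt \<rho> * sqrt B"
    unfolding x0_def y0_def L2_set_smult[OF vecs(1)] L2_set_smult[OF vecs(2)]
    using \<alpha>_le \<beta>_le \<rho> by (auto intro: mult_left_mono)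
  then have v: "L2_set (vf x0) {..<p} \<le> K0" "L2_set (vf y0) {..<q} \<le> K0"
      "L2_set (vf \<alpha>) {..<p} \<le> K0" "L2_set (vf \<beta>) {..<q} \<le> K0"
    using K0_ge \<alpha>_le \<beta>_le by auto
  have c: "L2_set (\<phi> j) {..<p} \<le> K0" "L2_set (\<psi> j) {..<q} \<le> K0" if "j < p" for j
    using column_le[OF that] K0_ge by auto
  have un: "L2_set (unit_fun i) {..<d} \<le> K0" for i d using L2_set_unit_fun[of i d] K0_ge by auto
  show "L2_set u {..<p} \<le> K0" if "u \<in> F"
    using that v c un unfolding F_def by (auto simp: L2_set_smult[OF vecs(1)] L2_set_smult[OF vecs(3)] simp del: index_smult_vec)
  show "L2_set v {..<q} \<le> K0" if "v \<in> G"
    using that v c un unfolding G_def by (auto simp: L2_set_smult[OF vecs(2)] L2_set_smult[OF vecs(4)] simp del: index_smult_vec)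
qed

lemma finite_FG: "finite F" "finite G" and card_FG: "card F \<le> 2 * p + 4" "card G \<le> q + p + 4"
proof -
  show "finite F" "finite G" by (auto simp: F_def G_def)
  have c4: "card {a, b, c, d} \<le> 4" for a b c d :: "nat \<Rightarrow> real"
    by (simp add: card_insert_if)
  have "card F \<le> card (unit_fun ` {..<p}) + card (\<phi> ` {..<p}) + 4"
    unfolding F_def by (intro order_trans[OF card_Un_le] add_mono c4 order_refl)
  then show "card F \<le> 2 * p + 4"
    using card_image_le[of "{..<p}" unit_fun] card_image_le[of "{..<p}" \<phi>] by simp
  have "card G \<le> card (unit_fun ` {..<q}) + card (\<psi> ` {..<p}) + 4"
    unfolding G_def by (intro order_trans[OF card_Un_le] add_mono c4 order_refl)
  then show "card G \<le> q + p + 4"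
    using card_image_le[of "{..<q}" unit_fun] card_image_le[of "{..<p}" \<psi>] by simp
qed

end

lemma sign_dist_nonneg: "(\<And>v. 0 \<le> N v) \<Longrightarrow> 0 \<le> sign_dist N a b"
  by (simp add: sign_dist_def)

lemma l1_norm_nonneg: "0 \<le> l1_norm v" by (simp add: l1_norm_def sum_nonneg)
lemma l2_norm_nonneg: "0 \<le> l2_norm v" by (simp add: l2_norm_def sum_nonneg)

lemma canon_corr_bil:
  assumes "Tx \<in> carrier_mat p p" "Ty \<in> carrier_mat q q" "Txy \<in> carrier_mat p q"
    "a \<in> carrier_vec p" "b \<in> carrier_vec q"
  shows "canon_corr Tx Ty Txy a b = bil p q (mf Txy) (vf a) (vf b) /
    (sqrt (bil p p (mf Tx) (vf a) (vf a)) * sqrt (bil q q (mf Ty) (vf b) (vf b)))"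
  unfolding canon_corr_def using assms by (simp add: scalar_prod_bil)

text \<open>The \<open>K'\<close> of \<open>scaled_direction\<close> for
  \<open>C = 2 * (1 + K) * (7 * K ^ 3)\<close>, the constant of \<open>oriented_correlation\<close>
  with \<open>\<rho> \<le> K\<close> inserted.\<close>

definition direction_const :: "real \<Rightarrow> real \<Rightarrow> real" where
  "direction_const K e = (K + 2 * (1 + K) * (7 * K ^ 3) / sqrt e) * K + 2 * (1 + K) * (7 * K ^ 3) / sqrt e * K"

lemma direction_const_ge: assumes "1 \<le> K" "0 < e" shows "K \<le> direction_const K e"
proof -
  have "K * 1 \<le> K * K" using assms by (intro mult_left_mono) auto
  moreover define t where "t = 2 * (1 + K) * (7 * K ^ 3) / sqrt e * K"
  moreover have "0 \<le> t" using assms by (simp add: t_def)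
  moreover have "direction_const K e = K * K + t + t" by (simp only: direction_const_def t_def distrib_right)
  ultimately show ?thesis by linarith
qed

lemma block_near:
  assumes P: "P \<in> carrier_mat (p + q) (p + q)" "P' \<in> carrier_mat (p + q) (p + q)" and j: "j < p + q"
    and l2: "l2_norm (col P j - col P' j) \<le> a" and l1: "l1_norm (col P j - col P' j) \<le> b"
  shows "L2_set (\<lambda>i. P $$ (i, j) - P' $$ (i, j)) {..<p} \<le> a"
    and "L2_set (\<lambda>i. P $$ (p + i, j) - P' $$ (p + i, j)) {..<q} \<le> a"
    and "(\<Sum>i<p. \<bar>P $$ (i, j) - P' $$ (i, j)\<bar>) \<le> b"
    and "(\<Sum>i<q. \<bar>P $$ (p + i, j) - P' $$ (p + i, j)\<bar>) \<le> b"
proof -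
  have c: "l2_norm (col P j - col P' j) = sqrt (\<Sum>i<p + q. (P $$ (i, j) - P' $$ (i, j))\<^sup>2)"
    "l1_norm (col P j - col P' j) = (\<Sum>i<p + q. \<bar>P $$ (i, j) - P' $$ (i, j)\<bar>)"
    using P j by (auto simp: l2_norm_def l1_norm_def intro!: arg_cong[where f = sqrt] sum.cong)
  show "L2_set (\<lambda>i. P $$ (i, j) - P' $$ (i, j)) {..<p} \<le> a"
    "L2_set (\<lambda>i. P $$ (p + i, j) - P' $$ (p + i, j)) {..<q} \<le> a"
    using l2 unfolding c L2_set_def sum_append
    by (auto elim!: order_trans[rotated] intro!: sum_nonneg)
  have "0 \<le> (\<Sum>i<p. \<bar>P $$ (i, j) - P' $$ (i, j)\<bar>)" "0 \<le> (\<Sum>i<q. \<bar>P $$ (p + i, j) - P' $$ (p + i, j)\<bar>)"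
    by (simp_all add: sum_nonneg)
  then show "(\<Sum>i<p. \<bar>P $$ (i, j) - P' $$ (i, j)\<bar>) \<le> b"
    "(\<Sum>i<q. \<bar>P $$ (p + i, j) - P' $$ (p + i, j)\<bar>) \<le> b"
    using l1 unfolding c sum_append by linarith+
qed

lemma add_difference: "(\<lambda>i. f i + (g i - f i)) = g" for f g :: "nat \<Rightarrow> real"
  by auto

section \<open>Deterministic remainder bound on the good event\<close>

context cca_population begin

text \<open>A statement on one realisation, without probability. The three parts of
  \<open>small\<close> keep the normalising factors of the correlation away from 0, make the
  numerator's sign that of its limit, and make the sign of each direction unambiguous.\<close>

lemma good_event_bound:
  fixes K lam del eta :: real
  assumes T: "Tx \<in> carrier_mat p p" "Ty \<in> carrier_mat q q" "Txy \<in> carrier_mat p q"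
    and Ph: "Ph \<in> carrier_mat (p + q) (p + q)" and ah: "ah \<in> carrier_vec p" and bh: "bh \<in> carrier_vec q"
    and symT: "\<And>i j. i < p \<Longrightarrow> j < p \<Longrightarrow> Tx $$ (i, j) = Tx $$ (j, i)"
      "\<And>i j. i < q \<Longrightarrow> j < q \<Longrightarrow> Ty $$ (i, j) = Ty $$ (j, i)"
    and rates: "rates K lam del eta" and KK0: "K0 \<le> K"
    and dev: "\<not> deviates Tx Ty Txy (K * lam)"
    and l2: "sign_dist l2_norm ah \<alpha> + sign_dist l2_norm bh \<beta> \<le> K * del"
    and l1: "sign_dist l1_norm ah \<alpha> + sign_dist l1_norm bh \<beta> \<le> K * eta"
    and Ph2: "\<And>j. j < p \<Longrightarrow> l2_norm (col Ph j - col Phi j) \<le> K * del"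
    and Ph1: "\<And>j. j < p \<Longrightarrow> l1_norm (col Ph j - col Phi j) \<le> K * eta"
    and small: "7 * K ^ 3 * del \<le> 1 / 2" "7 * K ^ 3 * del < e0" "K * eta + K * del < 1 / sqrt A"
    and sparse: "(\<Sum>i<p. \<bar>\<alpha> $ i\<bar>) * del \<le> K * eta" "(\<Sum>i<q. \<bar>\<beta> $ i\<bar>) * del \<le> K * eta"
    and rh: "0 \<le> canon_corr Tx Ty Txy ah bh" and j: "j < p"
  defines "w \<equiv> best_sign ah \<alpha>" and "rh \<equiv> canon_corr Tx Ty Txy ah bh"
  defines "xh \<equiv> sqrt \<bar>rh\<bar> \<cdot>\<^sub>v ah" and "yh \<equiv> sqrt \<bar>rh\<bar> \<cdot>\<^sub>v bh"
  shows "\<bar>vec_first (debiased Ph Tx Ty Txy xh yh) p $ j - (w \<cdot>\<^sub>v x0) $ j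
      + vec_first (leading_term Phi \<rho> Sx Sy Sxy Tx Ty Txy (w \<cdot>\<^sub>v x0) (w \<cdot>\<^sub>v y0)) p $ j\<bar>
    \<le> 244 * (direction_const K e0 ^ 3)\<^sup>2 * del\<^sup>2"
proof -
  interpret rates K lam del eta by (rule rates)
  have D: "u \<in> F \<Longrightarrow> v \<in> F \<Longrightarrow> \<bar>bil p p (\<lambda>i j. Tx $$ (i, j) - Sx $$ (i, j)) u v\<bar> \<le> K * lam"
    "x \<in> G \<Longrightarrow> y \<in> G \<Longrightarrow> \<bar>bil q q (\<lambda>i j. Ty $$ (i, j) - Sy $$ (i, j)) x y\<bar> \<le> K * lam"
    "u \<in> F \<Longrightarrow> y \<in> G \<Longrightarrow> \<bar>bil p q (\<lambda>i j. Txy $$ (i, j) - Sxy $$ (i, j)) u y\<bar> \<le> K * lam" for u v x y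
    using dev unfolding deviates_def not_less[symmetric] by blast+
  have bound_mono: "A * a * b \<le> K * a * b" if "0 < a" "0 < b" for a b
    using K0_ge KK0 that by (intro mult_right_mono) auto
  have unit: "i < p \<Longrightarrow> unit_fun i \<in> F" "k < q \<Longrightarrow> unit_fun k \<in> G" for i k
    by (auto simp: F_def G_def)
  have FK: "u \<in> F \<Longrightarrow> L2_set u {..<p} \<le> K" "v \<in> G \<Longrightarrow> L2_set v {..<q} \<le> K" for u v
    using F_le G_le KK0 by (auto intro: order_trans)
  have xx: "cov_pair K lam del eta p p (mf Sx) (mf Tx) F F"
  proof unfold_locales
    show "\<bar>Bx u v\<bar> \<le> K * a * b"
      if "0 < a" "0 < b" "L2_set u {..<p} \<le> a" "L2_set v {..<p} \<le> b" for u v a b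
      using boundx[OF that] bound_mono[OF that(1,2)] by linarith
  qed (use D(1) unit FK in auto)
  have yy: "cov_pair K lam del eta q q (mf Sy) (mf Ty) G G"
  proof unfold_locales
    show "\<bar>By u v\<bar> \<le> K * a * b"
      if "0 < a" "0 < b" "L2_set u {..<q} \<le> a" "L2_set v {..<q} \<le> b" for u v a b
      using boundy[OF that] bound_mono[OF that(1,2)] by linarith
  qed (use D(2) unit FK in auto)
  have xy: "cov_pair K lam del eta p q (mf Sxy) (mf Txy) F G"
  proof unfold_locales
    show "\<bar>Bxy u v\<bar> \<le> K * a * b"
      if "0 < a" "0 < b" "L2_set u {..<p} \<le> a" "L2_set v {..<q} \<le> b" for u v a b
      using boundxy[OF that] bound_mono[OF that(1,2)] by linarith
  qed (use D(3) unit FK in auto)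
  define w' where "w' = best_sign bh \<beta>"
  have w: "w = 1 \<or> w = - 1" and w': "w' = 1 \<or> w' = - 1"
    unfolding w_def w'_def by (rule best_sign_cases)+
  note nn = sign_dist_nonneg[of l2_norm, OF l2_norm_nonneg] sign_dist_nonneg[of l1_norm, OF l1_norm_nonneg]
  have pos: "0 \<le> K * eta" "0 \<le> K * del" using rates.K[OF rates] eta del_pos by auto
  define a g where "a = vf (w \<cdot>\<^sub>v \<alpha>)" and "g = (\<lambda>i. vf ah i - a i)"
  define b h where "b = vf (w' \<cdot>\<^sub>v \<beta>)" and "h = (\<lambda>i. vf bh i - b i)"
  have g: "near p g" unfolding near_def g_def a_def w_def
    using best_sign_near[OF ah vecs(1), of "K * del" "K * eta"] l2 l1 nn[of ah \<alpha>] nn[of bh \<beta>] pos small(3) \<alpha>_ge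
    by auto
  have h: "near q h" unfolding near_def h_def b_def w'_def
    using best_sign_near[OF bh vecs(2), of "K * del" "K * eta"] l2 l1 nn[of ah \<alpha>] nn[of bh \<beta>] pos small(3) \<beta>_ge
    by auto
  have mem: "a \<in> F" "b \<in> G" using w w' by (auto simp: a_def b_def F_def G_def)
  have ag: "(\<lambda>i. a i + g i) = vf ah" and bh': "(\<lambda>i. b i + h i) = vf bh"
    unfolding g_def h_def by (rule add_difference)+
  have norm: "Bx a a = 1" "By b b = 1"
    unfolding a_def b_def bil_smult_left[OF vecs(1)] bil_smult_right[OF vecs(1)]
      bil_smult_left[OF vecs(2)] bil_smult_right[OF vecs(2)]
    using w w' norm_\<alpha> norm_\<beta> by auto
  have cr: "Bxy a b = (w * w') * \<rho>"
    unfolding a_def b_def bil_smult_left[OF vecs(1)] bil_smult_right[OF vecs(2)] cross_\<beta> norm_\<alpha> by simp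
  have sign: "w * w' = 1 \<or> w * w' = - 1" using w w' by auto
  have rh_eq: "rh = bil p q (mf Txy) (vf ah) (vf bh) /
    (sqrt (bil p p (mf Tx) (vf ah) (vf ah)) * sqrt (bil q q (mf Ty) (vf bh) (vf bh)))"
    unfolding rh_def by (rule canon_corr_bil[OF T ah bh])
  note oc = oriented_correlation[OF xx yy xy mem g h norm cr sign _ e0 small(1,2), unfolded ag bh', folded rh_eq]
  have "e0 \<le> \<rho>" using \<rho>_gt by simp
  note oc = oc[OF this rh[folded rh_def]]
  \<comment> \<open>From here on one sign serves both directions.\<close>
  have ww: "w' = w" using oc(1) w w' by auto
  have rho: "e0 \<le> \<rho>" "0 < e0" "\<rho> \<le> K" using \<rho>_gt e0 K0_ge KK0 by auto
  define C where "C = 2 * (1 + K) * (7 * K ^ 3)"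
  have C: "0 \<le> C" using rates.K[OF rates] by (simp add: C_def)
  have "2 * (1 + \<rho>) * (7 * K ^ 3 * del) \<le> 2 * (1 + K) * (7 * K ^ 3 * del)"
    using rho rates.K[OF rates] del_pos by (intro mult_right_mono) auto
  then have dr: "\<bar>rh - \<rho>\<bar> \<le> C * del" using oc(2) by (simp add: C_def)
  define K2 where "K2 = direction_const K e0"
  have K2: "K \<le> K2" unfolding K2_def using rates.K[OF rates] e0 by (rule direction_const_ge)
  have K2': "K2 = (K + C / sqrt e0) * K + C / sqrt e0 * K" by (simp add: K2_def direction_const_def C_def)
  interpret R2: rates K2 lam del eta
    using K2 rates.K[OF rates] lam del eta lam_eta lam_eta2 by unfold_locales auto
  have rh0: "0 \<le> rh" using rh by (simp add: rh_def)
  let ?x = "vf (w \<cdot>\<^sub>v x0)" and ?y = "vf (w \<cdot>\<^sub>v y0)"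
  define hx where "hx = (\<lambda>i. vf xh i - ?x i)"
  define hy where "hy = (\<lambda>i. vf yh i - ?y i)"
  have a_small: "L2_set a {..<p} \<le> K" "(\<Sum>i<p. \<bar>a i\<bar>) * del \<le> K * eta"
  proof -
    show "L2_set a {..<p} \<le> K" using F_le[OF mem(1)] KK0 by simp
    have "(\<Sum>i<p. \<bar>a i\<bar>) = (\<Sum>i<p. \<bar>\<alpha> $ i\<bar>)"
      using w vecs by (intro sum.cong) (auto simp: a_def)
    then show "(\<Sum>i<p. \<bar>a i\<bar>) * del \<le> K * eta" using sparse by simp
  qed
  have b_small: "L2_set b {..<q} \<le> K" "(\<Sum>i<q. \<bar>b i\<bar>) * del \<le> K * eta"
  proof -
    show "L2_set b {..<q} \<le> K" using G_le[OF mem(2)] KK0 by simp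
    have "(\<Sum>i<q. \<bar>b i\<bar>) = (\<Sum>i<q. \<bar>\<beta> $ i\<bar>)"
      using w' vecs by (intro sum.cong) (auto simp: b_def)
    then show "(\<Sum>i<q. \<bar>b i\<bar>) * del \<le> K * eta" using sparse by simp
  qed
  have hx: "R2.near p hx"
  proof -
    have "hx i = sqrt rh * (a i + g i) - sqrt \<rho> * a i" if "i < p" for i
      using that vecs ah rh0 by (simp add: hx_def xh_def a_def g_def x0_def)
    then have "L2_set hx {..<p} = L2_set (\<lambda>i. sqrt rh * (a i + g i) - sqrt \<rho> * a i) {..<p}"
      "(\<Sum>i<p. \<bar>hx i\<bar>) = (\<Sum>i<p. \<bar>sqrt rh * (a i + g i) - sqrt \<rho> * a i\<bar>)"
      by (auto intro!: L2_set_cong sum.cong)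
    then show ?thesis unfolding R2.near_def
      using scaled_direction[OF g a_small rh0 dr rho C K2'] by simp
  qed
  have hy: "R2.near q hy"
  proof -
    have "hy i = sqrt rh * (b i + h i) - sqrt \<rho> * b i" if "i < q" for i
      using that vecs bh rh0 by (simp add: hy_def yh_def b_def h_def y0_def ww)
    then have "L2_set hy {..<q} = L2_set (\<lambda>i. sqrt rh * (b i + h i) - sqrt \<rho> * b i) {..<q}"
      "(\<Sum>i<q. \<bar>hy i\<bar>) = (\<Sum>i<q. \<bar>sqrt rh * (b i + h i) - sqrt \<rho> * b i\<bar>)"
      by (auto intro!: L2_set_cong sum.cong)
    then show ?thesis unfolding R2.near_def
      using scaled_direction[OF h b_small rh0 dr rho C K2'] by simp
  qed
  define f1 where "f1 = (\<lambda>i. Ph $$ (i, j) - Phi $$ (i, j))"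
  define g1 where "g1 = (\<lambda>i. Ph $$ (p + i, j) - Phi $$ (p + i, j))"
  have KK: "K * del \<le> K2 * del" "K * eta \<le> K2 * eta" using K2 del_pos eta by (auto intro: mult_right_mono)
  have fg1: "R2.near p f1" "R2.near q g1"
    using block_near[OF Ph carrier(6) _ Ph2[OF j] Ph1[OF j]] j KK
    unfolding R2.near_def f1_def g1_def by auto
  have f': "(\<lambda>i. \<phi> j i + f1 i) = (\<lambda>i. Ph $$ (i, j))" and g': "(\<lambda>i. \<psi> j i + g1 i) = (\<lambda>i. Ph $$ (p + i, j))"
    by (auto simp: f1_def g1_def \<phi>_def \<psi>_def)
  have x': "(\<lambda>i. ?x i + hx i) = vf xh" and y': "(\<lambda>i. ?y i + hy i) = vf yh"
    unfolding hx_def hy_def by (rule add_difference)+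
  have mem2: "\<phi> j \<in> F" "?x \<in> F" "\<psi> j \<in> G" "?y \<in> G"
    using w j by (auto simp: F_def G_def)
  have sx: "bil d p Z u (?x) = w * (sqrt \<rho> * bil d p Z u (vf \<alpha>))"
    "bil p d Z (?x) u = w * (sqrt \<rho> * bil p d Z (vf \<alpha>) u)" for d Z u
    unfolding x0_def using vecs(1) by (simp_all add: bil_smult_left bil_smult_right)
  have sy: "bil d q Z u (?y) = w * (sqrt \<rho> * bil d q Z u (vf \<beta>))"
    "bil q d Z (?y) u = w * (sqrt \<rho> * bil q d Z (vf \<beta>) u)" for d Z u
    unfolding y0_def using vecs(2) by (simp_all add: bil_smult_left bil_smult_right)
  \<comment> \<open>The rank-one part of the Hessian is quadratic in the direction: the sign squares
    away, and the two roots supply the factor \<rho> that stands before the unscaled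
    direction.\<close>
  have sq: "4 * (w * (sqrt \<rho> * c)) * (w * (sqrt \<rho> * d)) = 4 * \<rho> * (c * d)" for c d
  proof -
    have "4 * (w * (sqrt \<rho> * c)) * (w * (sqrt \<rho> * d)) = 4 * (w * w) * (sqrt \<rho> * sqrt \<rho>) * (c * d)"
      by (simp only: mult_ac)
    also have "w * w = 1" using w by auto
    also have "sqrt \<rho> * sqrt \<rho> = \<rho>" using rho by simp
    finally show ?thesis by simp
  qed
  have rho_abs: "\<bar>\<rho>\<bar> \<le> K2" using rho K2 by simp
  have n2: "Bx (?x) (?x) = \<rho>"
    "By (?y) (?y) = \<rho>"
    unfolding sx(1) sx(2) sy(1) sy(2) norm_\<alpha> norm_\<beta> using w rho by auto
  have e2: "Bxy u (?y) = \<rho> * Bx u (?x)"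
    "Bxy (?x) v = \<rho> * By v (?y)" for u v
    unfolding sx sy cross_\<alpha> cross_\<beta> by simp_all
  have hess: "2 * \<rho> * Bx (\<phi> j) hx
      + 4 * Bx (\<phi> j) (?x) * Bx (?x) hx
      - 2 * Bxy (\<phi> j) hy + 2 * \<rho> * By (\<psi> j) hy
      + 4 * By (\<psi> j) (?y) * By (?y) hy
      - 2 * Bxy hx (\<psi> j) = hx j"
  proof -
    \<comment> \<open>The two error blocks stacked, so that the joint Hessian identity applies to
      them.\<close>
    define z where "z = (\<lambda>i. if i < p then hx i else hy (i - p))"
    have z: "bil p d Z z u = bil p d Z hx u" "bil d p Z u z = bil d p Z u hx" for d Z u
      by (auto simp: z_def intro!: bil_cong)
    have z': "(\<lambda>i. z (p + i)) = hy" by (auto simp: z_def)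
    have "4 * Bx (\<phi> j) (?x) * Bx (?x) hx
        = 4 * \<rho> * (Bx hx (vf \<alpha>) * Bx (vf \<alpha>) (\<phi> j))"
      unfolding sx sq form_sym(1)[of "\<phi> j"] form_sym(1)[of hx] by (simp add: mult_ac)
    moreover have "4 * By (\<psi> j) (?y) * By (?y) hy
        = 4 * \<rho> * (By hy (vf \<beta>) * By (vf \<beta>) (\<psi> j))"
      unfolding sy sq form_sym(2)[of "\<psi> j"] form_sym(2)[of hy] by (simp add: mult_ac)
    moreover have "z j = hx j" using j by (simp add: z_def)
    ultimately show ?thesis
      using hessian_column[of j z] j unfolding z z' form_sym(1)[of hx "\<phi> j"] form_sym(2)[of hy "\<psi> j"] by simp
  qed
  have symT': "bil p p (mf Tx) u v = bil p p (mf Tx) v u" "bil q q (mf Ty) u v = bil q q (mf Ty) v u" for u v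
    using symT by (auto intro!: bil_sym)
  note main = R2.debias_remainder[OF cov_pair_mono[OF xx K2] cov_pair_mono[OF yy K2] cov_pair_mono[OF xy K2]
      form_sym symT' mem2 fg1 hx hy rho_abs n2 e2 hess, unfolded f' g' x' y']
  have xy_c: "xh \<in> carrier_vec p" "yh \<in> carrier_vec q" using ah bh by (auto simp: xh_def yh_def)
  have wc: "w \<cdot>\<^sub>v x0 \<in> carrier_vec p" "w \<cdot>\<^sub>v y0 \<in> carrier_vec q" using vecs by auto
  \<comment> \<open>The leading term reads rows of \<open>Phi\<close>, the remainder bound
    columns.\<close>
  have row1: "bil p d Z (\<lambda>i. Phi $$ (j, i)) u = bil p d Z (\<phi> j) u" for d Z u
    using Phi_sym j by (intro bil_cong) (auto simp: \<phi>_def)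
  have row2: "bil q d Z (\<lambda>i. Phi $$ (j, p + i)) u = bil q d Z (\<psi> j) u"
    "bil d q Z u (\<lambda>i. Phi $$ (j, p + i)) = bil d q Z u (\<psi> j)" for d Z u
    using Phi_sym j by (auto intro!: bil_cong simp: \<psi>_def)
  show ?thesis
    unfolding debiased_index[OF Ph T xy_c j] leading_term_index[OF carrier(6) T carrier(1-3) wc j] row1 row2
    using main by (simp only: K2_def fun_cong[OF x'])
qed

end

section \<open>Measurability\<close>

text \<open>Stochastic boundedness and union bounds are meaningful for measurable events only. The
  coordinate formulas above reduce the correlation, the de-biased estimator and the leading term to
  such forms.\<close>

lemma measurable_bil:
  assumes "\<And>i j. i < d \<Longrightarrow> j < e \<Longrightarrow> (\<lambda>\<omega>. A \<omega> i j) \<in> borel_measurable M"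
    and "\<And>i. i < d \<Longrightarrow> (\<lambda>\<omega>. u \<omega> i) \<in> borel_measurable M"
    and "\<And>j. j < e \<Longrightarrow> (\<lambda>\<omega>. v \<omega> j) \<in> borel_measurable M"
  shows "(\<lambda>\<omega>. bil d e (A \<omega>) (u \<omega>) (v \<omega>)) \<in> borel_measurable M"
  unfolding bil_def using assms by (intro borel_measurable_sum borel_measurable_times) auto

lemma measurable_sqrt:
  "f \<in> borel_measurable M \<Longrightarrow> (\<lambda>\<omega>. sqrt (f \<omega>)) \<in> borel_measurable M" for f :: "'a \<Rightarrow> real"
  by measurable

lemma random_vec_measurable: "random_vec M d X \<Longrightarrow> i < d \<Longrightarrow> (\<lambda>\<omega>. X \<omega> $ i) \<in> borel_measurable M"
  by (simp add: random_vec_def)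

lemma random_mat_measurable:
  "random_mat M d e A \<Longrightarrow> i < d \<Longrightarrow> j < e \<Longrightarrow> (\<lambda>\<omega>. A \<omega> $$ (i, j)) \<in> borel_measurable M"
  by (simp add: random_mat_def)

lemma random_vec_const: "v \<in> carrier_vec d \<Longrightarrow> random_vec M d (\<lambda>_. v)"
  by (simp add: random_vec_def)

lemma random_vec_scale:
  assumes "c \<in> borel_measurable M" "random_vec M d X"
  shows "random_vec M d (\<lambda>\<omega>. c \<omega> \<cdot>\<^sub>v X \<omega>)"
  unfolding random_vec_def
proof (intro conjI ballI allI impI)
  fix j assume "j < d"
  then have "(\<lambda>\<omega>. (c \<omega> \<cdot>\<^sub>v X \<omega>) $ j) \<in> borel_measurable M \<longleftrightarrow> (\<lambda>\<omega>. c \<omega> * X \<omega> $ j) \<in> borel_measurable M"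
    using assms by (intro measurable_cong) (auto simp: random_vec_def)
  then show "(\<lambda>\<omega>. (c \<omega> \<cdot>\<^sub>v X \<omega>) $ j) \<in> borel_measurable M"
    using assms random_vec_measurable[OF assms(2) \<open>j < d\<close>] by simp
qed (use assms in \<open>auto simp: random_vec_def\<close>)

lemma random_mat_emp_cov:
  assumes "\<And>i. i < n \<Longrightarrow> random_vec M d (xs i)" "\<And>i. i < n \<Longrightarrow> random_vec M e (ys i)"
  shows "random_mat M d e (\<lambda>\<omega>. emp_cov n d e (\<lambda>i. xs i \<omega>) (\<lambda>i. ys i \<omega>))"
proof -
  have [measurable]: "(\<lambda>\<omega>. xs i \<omega> $ j) \<in> borel_measurable M" "(\<lambda>\<omega>. ys i \<omega> $ k) \<in> borel_measurable M"
    if "i < n" "j < d" "k < e" for i j k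
    using assms that by (auto intro: random_vec_measurable)
  show ?thesis
    unfolding random_mat_def by (auto simp: emp_cov_def intro!: borel_measurable_divide borel_measurable_sum borel_measurable_times)
qed

lemma measurable_canon_corr:
  assumes T: "random_mat M p p Tx" "random_mat M q q Ty" "random_mat M p q Txy"
    and x: "random_vec M p x" and y: "random_vec M q y"
  shows "(\<lambda>\<omega>. canon_corr (Tx \<omega>) (Ty \<omega>) (Txy \<omega>) (x \<omega>) (y \<omega>)) \<in> borel_measurable M"
proof -
  note m = T[THEN random_mat_measurable] random_vec_measurable[OF x] random_vec_measurable[OF y]
  show ?thesis
    apply (rule measurable_cong[THEN iffD2], rule canon_corr_bil[of _ p _ q])
         apply (use T x y in \<open>auto simp: random_mat_def random_vec_def\<close>)[5]
    apply (intro borel_measurable_divide borel_measurable_times measurable_sqrt measurable_bil m)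
               apply assumption+
    done
qed

lemma measurable_debiased:
  assumes Ph: "random_mat M (p + q) (p + q) Ph"
    and T: "random_mat M p p Tx" "random_mat M q q Ty" "random_mat M p q Txy"
    and x: "random_vec M p x" and y: "random_vec M q y" and j: "j < p"
  shows "(\<lambda>\<omega>. vec_first (debiased (Ph \<omega>) (Tx \<omega>) (Ty \<omega>) (Txy \<omega>) (x \<omega>) (y \<omega>)) p $ j) \<in> borel_measurable M"
proof -
  note m = T[THEN random_mat_measurable] random_mat_measurable[OF Ph]
    random_vec_measurable[OF x] random_vec_measurable[OF y]
  show ?thesis
    apply (rule measurable_cong[THEN iffD2], rule debiased_index[of _ p q])
           apply (use Ph T x y j in \<open>auto simp: random_mat_def random_vec_def\<close>)[7]
    using j apply (intro borel_measurable_diff borel_measurable_times borel_measurable_const measurable_bil m)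
           apply auto
    done
qed

lemma measurable_leading_term:
  assumes S: "Phi \<in> carrier_mat (p + q) (p + q)" "Sx \<in> carrier_mat p p" "Sy \<in> carrier_mat q q" "Sxy \<in> carrier_mat p q"
    and T: "random_mat M p p Tx" "random_mat M q q Ty" "random_mat M p q Txy"
    and x: "random_vec M p x" and y: "random_vec M q y" and j: "j < p"
  shows "(\<lambda>\<omega>. vec_first (leading_term Phi \<rho> Sx Sy Sxy (Tx \<omega>) (Ty \<omega>) (Txy \<omega>) (x \<omega>) (y \<omega>)) p $ j) \<in> borel_measurable M"
proof -
  note m = T[THEN random_mat_measurable] random_vec_measurable[OF x] random_vec_measurable[OF y]
  show ?thesis
    apply (rule measurable_cong[THEN iffD2], rule leading_term_index[of _ p q])
              apply (use S T x y j in \<open>auto simp: random_mat_def random_vec_def\<close>)[10]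
    apply (intro borel_measurable_diff borel_measurable_add borel_measurable_times borel_measurable_const
        measurable_bil m)
                        apply assumption+
    done
qed

lemma measurable_norms_of_difference:
  assumes a: "random_vec M d a" and b: "b \<in> carrier_vec d"
  shows "(\<lambda>\<omega>. l2_norm (1 \<cdot>\<^sub>v a \<omega> - b)) \<in> borel_measurable M"
    and "(\<lambda>\<omega>. l2_norm (- 1 \<cdot>\<^sub>v a \<omega> - b)) \<in> borel_measurable M"
    and "(\<lambda>\<omega>. l1_norm (1 \<cdot>\<^sub>v a \<omega> - b)) \<in> borel_measurable M"
    and "(\<lambda>\<omega>. l1_norm (- 1 \<cdot>\<^sub>v a \<omega> - b)) \<in> borel_measurable M"
proof -
  have c: "a \<omega> \<in> carrier_vec d" if "\<omega> \<in> space M" for \<omega> using a that by (simp add: random_vec_def)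
  note n = norms_of_difference[OF c b]
  note m = random_vec_measurable[OF a]
  show "(\<lambda>\<omega>. l2_norm (1 \<cdot>\<^sub>v a \<omega> - b)) \<in> borel_measurable M"
    by (subst measurable_cong[OF n(1)], assumption)
      (auto simp: L2_set_def intro!: measurable_sqrt borel_measurable_sum borel_measurable_power borel_measurable_diff m)
  show "(\<lambda>\<omega>. l2_norm (- 1 \<cdot>\<^sub>v a \<omega> - b)) \<in> borel_measurable M"
    by (subst measurable_cong[OF n(2)], assumption)
      (auto simp: L2_set_def intro!: measurable_sqrt borel_measurable_sum borel_measurable_power borel_measurable_add m)
  show "(\<lambda>\<omega>. l1_norm (1 \<cdot>\<^sub>v a \<omega> - b)) \<in> borel_measurable M"
    by (subst measurable_cong[OF n(3)], assumption)
      (auto intro!: borel_measurable_sum borel_measurable_abs borel_measurable_diff m)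
  show "(\<lambda>\<omega>. l1_norm (- 1 \<cdot>\<^sub>v a \<omega> - b)) \<in> borel_measurable M"
    by (subst measurable_cong[OF n(4)], assumption)
      (auto intro!: borel_measurable_sum borel_measurable_abs borel_measurable_add m)
qed

lemma sign_dist_min: "sign_dist N a b = min (N (1 \<cdot>\<^sub>v a - b)) (N (- 1 \<cdot>\<^sub>v a - b))"
  by (simp add: sign_dist_def)

lemma measurable_sign_dist:
  assumes "random_vec M d a" "b \<in> carrier_vec d"
  shows "(\<lambda>\<omega>. sign_dist l2_norm (a \<omega>) b) \<in> borel_measurable M"
    and "(\<lambda>\<omega>. sign_dist l1_norm (a \<omega>) b) \<in> borel_measurable M"
  unfolding sign_dist_min using measurable_norms_of_difference[OF assms]
  by (auto intro!: borel_measurable_min)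

lemma measurable_best_sign:
  assumes "random_vec M d a" "b \<in> carrier_vec d"
  shows "(\<lambda>\<omega>. best_sign (a \<omega>) b) \<in> borel_measurable M"
  unfolding best_sign_def using measurable_norms_of_difference[OF assms]
  by (intro measurable_If borel_measurable_le borel_measurable_const)

lemma measurable_max_column:
  assumes P: "random_mat M d d P" and P': "P' \<in> carrier_mat d d"
  shows "(\<lambda>\<omega>. MAX j\<in>{..<d}. l1_norm (col (P \<omega>) j - col P' j)) \<in> borel_measurable M"
    and "(\<lambda>\<omega>. MAX j\<in>{..<d}. l2_norm (col (P \<omega>) j - col P' j)) \<in> borel_measurable M"
proof -
  have c: "P \<omega> \<in> carrier_mat d d" if "\<omega> \<in> space M" for \<omega> using P that by (simp add: random_mat_def)
  note m = random_mat_measurable[OF P]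
  have "l1_norm (col (P \<omega>) j - col P' j) = (\<Sum>i<d. \<bar>P \<omega> $$ (i, j) - P' $$ (i, j)\<bar>)"
    "l2_norm (col (P \<omega>) j - col P' j) = sqrt (\<Sum>i<d. (P \<omega> $$ (i, j) - P' $$ (i, j))\<^sup>2)"
    if "\<omega> \<in> space M" "j < d" for \<omega> j
    using c[OF that(1)] P' that(2) by (auto simp: l1_norm_def l2_norm_def intro!: arg_cong[where f = sqrt] sum.cong)
  note n = this
  have 1: "(\<lambda>\<omega>. l1_norm (col (P \<omega>) j - col P' j)) \<in> borel_measurable M" if "j < d" for j
    by (subst measurable_cong[OF n(1)[OF _ that]], assumption)
      (use that in \<open>auto intro!: borel_measurable_sum borel_measurable_abs borel_measurable_diff m\<close>)
  have 2: "(\<lambda>\<omega>. l2_norm (col (P \<omega>) j - col P' j)) \<in> borel_measurable M" if "j < d" for j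
    by (subst measurable_cong[OF n(2)[OF _ that]], assumption)
      (use that in \<open>auto intro!: measurable_sqrt borel_measurable_sum borel_measurable_power borel_measurable_diff m\<close>)
  show "(\<lambda>\<omega>. MAX j\<in>{..<d}. l1_norm (col (P \<omega>) j - col P' j)) \<in> borel_measurable M"
    "(\<lambda>\<omega>. MAX j\<in>{..<d}. l2_norm (col (P \<omega>) j - col P' j)) \<in> borel_measurable M"
    by (rule borel_measurable_Max; use 1 2 in auto)+
qed

section \<open>Rates and probability of the good event\<close>

lemma random_vec_dim: "random_vec M d X \<Longrightarrow> \<omega> \<in> space M \<Longrightarrow> dim_vec (X \<omega>) = d"
  by (auto simp: random_vec_def)

lemma (in prob_space) double_union_bound:
  fixes c \<epsilon> :: real
  assumes fin: "finite I" "finite J" and card: "card I \<le> c" "card J \<le> c"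
    and ev: "\<And>u v. u \<in> I \<Longrightarrow> v \<in> J \<Longrightarrow> E u v \<in> events"
    and p: "\<And>u v. u \<in> I \<Longrightarrow> v \<in> J \<Longrightarrow> prob (E u v) \<le> \<epsilon>" and eps: "0 \<le> \<epsilon>"
  shows "(\<Union>u\<in>I. \<Union>v\<in>J. E u v) \<in> events" and "prob (\<Union>u\<in>I. \<Union>v\<in>J. E u v) \<le> c\<^sup>2 * \<epsilon>"
proof -
  have ev': "(\<Union>v\<in>J. E u v) \<in> events" if "u \<in> I" for u using ev fin that by auto
  show "(\<Union>u\<in>I. \<Union>v\<in>J. E u v) \<in> events" using ev' fin by auto
  have "prob (\<Union>u\<in>I. \<Union>v\<in>J. E u v) \<le> (\<Sum>u\<in>I. prob (\<Union>v\<in>J. E u v))"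
    using ev' fin by (intro finite_measure_subadditive_finite) auto
  also have "\<dots> \<le> (\<Sum>u\<in>I. \<Sum>v\<in>J. prob (E u v))"
    using ev fin by (intro sum_mono finite_measure_subadditive_finite) auto
  also have "\<dots> \<le> (\<Sum>u\<in>I. \<Sum>v\<in>J. \<epsilon>)" using p by (intro sum_mono) auto
  also have "\<dots> = card I * (card J * \<epsilon>)" by simp
  also have "\<dots> \<le> c * (c * \<epsilon>)" using card eps by (intro mult_mono) auto
  finally show "prob (\<Union>u\<in>I. \<Union>v\<in>J. E u v) \<le> c\<^sup>2 * \<epsilon>" by (simp add: power2_eq_square mult.assoc)
qed

text \<open>Cauchy-Schwarz on the support.\<close>

lemma sum_abs_le_support:
  "(\<Sum>i\<in>I. \<bar>u i\<bar>) \<le> sqrt (card {i \<in> I. u i \<noteq> 0}) * L2_set u I" if "finite I" for u :: "nat \<Rightarrow> real"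
proof -
  let ?S = "{i \<in> I. u i \<noteq> 0}"
  have "(\<Sum>i\<in>I. \<bar>u i\<bar>) = (\<Sum>i\<in>?S. \<bar>1\<bar> * \<bar>u i\<bar>)"
    using that by (intro sum.mono_neutral_cong_right) auto
  also have "\<dots> \<le> L2_set (\<lambda>_. 1) ?S * L2_set u ?S" by (rule L2_set_mult_ineq)
  also have "L2_set (\<lambda>_. 1::real) ?S = sqrt (card ?S)" by (simp add: L2_set_def)
  also have "L2_set u ?S = L2_set u I"
    unfolding L2_set_def using that by (intro arg_cong[where f = sqrt] sum.mono_neutral_left) auto
  finally show ?thesis .
qed

lemma col_support_le:
  assumes "U \<in> carrier_mat p r" "k < r"
  shows "card {i \<in> {..<p}. col U k $ i \<noteq> 0} \<le> nonzero_rows U"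
  unfolding nonzero_rows_def
proof (intro card_mono subsetI)
  fix i assume "i \<in> {i \<in> {..<p}. col U k $ i \<noteq> 0}"
  then have i: "i < p" "U $$ (i, k) \<noteq> 0" using assms by auto
  have "row U i \<noteq> 0\<^sub>v (dim_col U)"
  proof
    assume "row U i = 0\<^sub>v (dim_col U)"
    then have "row U i $ k = 0" using assms by simp
    then show False using i assms by simp
  qed
  then show "i \<in> {i. i < dim_row U \<and> row U i \<noteq> 0\<^sub>v (dim_col U)}" using i assms by auto
qed simp

context cca_population begin

text \<open>Sparsity enters the deterministic bound through this estimate: the factor
  \<open>sqrt s\<close> is precisely the ratio of \<open>eta\<close> to \<open>del\<close>.\<close>

lemma leading_l1:
  "(\<Sum>i<p. \<bar>\<alpha> $ i\<bar>) \<le> sqrt (nonzero_rows U) * K0" "(\<Sum>i<q. \<bar>\<beta> $ i\<bar>) \<le> sqrt (nonzero_rows V) * K0"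
proof -
  have "(\<Sum>i<p. \<bar>\<alpha> $ i\<bar>) \<le> sqrt (card {i \<in> {..<p}. \<alpha> $ i \<noteq> 0}) * L2_set (vf \<alpha>) {..<p}"
    by (rule sum_abs_le_support) simp
  also have "\<dots> \<le> sqrt (nonzero_rows U) * K0"
    using col_support_le[OF carrier(4), of 0] r \<alpha>_le K0_ge unfolding \<alpha>_def by (intro mult_mono) auto
  finally show "(\<Sum>i<p. \<bar>\<alpha> $ i\<bar>) \<le> sqrt (nonzero_rows U) * K0" .
  have "(\<Sum>i<q. \<bar>\<beta> $ i\<bar>) \<le> sqrt (card {i \<in> {..<q}. \<beta> $ i \<noteq> 0}) * L2_set (vf \<beta>) {..<q}"
    by (rule sum_abs_le_support) simp
  also have "\<dots> \<le> sqrt (nonzero_rows V) * K0"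
    using col_support_le[OF carrier(5), of 0] r \<beta>_le K0_ge unfolding \<beta>_def by (intro mult_mono) auto
  finally show "(\<Sum>i<q. \<bar>\<beta> $ i\<bar>) \<le> sqrt (nonzero_rows V) * K0" .
qed

text \<open>The normalisation excludes \<open>\<alpha> = 0\<close>. With a sparsity of at least 1,
  powers of \<open>s\<close> increase with the exponent and \<open>sU = o(p)\<close> becomes a
  growth condition on \<open>p\<close>.\<close>

lemma nonzero_rows_pos: "1 \<le> nonzero_rows U"
proof (rule ccontr)
  assume "\<not> 1 \<le> nonzero_rows U"
  then have "card {i \<in> {..<p}. \<alpha> $ i \<noteq> 0} = 0"
    using col_support_le[OF carrier(4), of 0] r unfolding \<alpha>_def by linarith
  moreover have "finite {i \<in> {..<p}. \<alpha> $ i \<noteq> 0}" by simp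
  ultimately have "{i \<in> {..<p}. \<alpha> $ i \<noteq> 0} = {}" by (simp only: card_0_eq)
  then have "\<alpha> $ i = 0" if "i < p" for i using that by blast
  then have "bil p p (mf Sx) (vf \<alpha>) (vf \<alpha>) = 0" by (simp add: bil_def)
  then show False using norm_\<alpha> by simp
qed

text \<open>A union bound over pairs from the family. The factor 10 in \<open>C\<close> makes each
  tail as small as \<open>2 / m ^ 3\<close>, which beats the order of \<open>m\<^sup>2\<close>
  pairs; \<open>lam \<le> 4 / 5\<close> keeps the deviation in the range where the sub-exponential
  tail is Gaussian.\<close>

lemma concentration_event:
  fixes Xs Ys :: "nat \<Rightarrow> 'a \<Rightarrow> real vec" and n :: nat and M :: "'a measure"
  assumes M: "prob_space M" and n: "0 < n"
    and xx: "subgauss_pair M p p X X K T" and yy: "subgauss_pair M q q Y Y K T"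
    and xy: "subgauss_pair M p q X Y K T" and AT: "A = T\<^sup>2"
    and S: "Sx = cross_cov M p p X X" "Sy = cross_cov M q q Y Y" "Sxy = cross_cov M p q X Y"
    and iid: "iid_copies M (p + q) n (\<lambda>i \<omega>. Xs i \<omega> @\<^sub>v Ys i \<omega>) (\<lambda>\<omega>. X \<omega> @\<^sub>v Y \<omega>)"
    and Xs: "\<And>i. i < n \<Longrightarrow> random_vec M p (Xs i)" and Ys: "\<And>i. i < n \<Longrightarrow> random_vec M q (Ys i)"
    and m: "m = max p q" "1 \<le> m" and lam: "lam = sqrt (ln (real m) / n)" "lam \<le> 4 / 5"
  defines "Tx \<equiv> \<lambda>\<omega>. emp_cov n p p (\<lambda>i. Xs i \<omega>) (\<lambda>i. Xs i \<omega>)"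
    and "Ty \<equiv> \<lambda>\<omega>. emp_cov n q q (\<lambda>i. Ys i \<omega>) (\<lambda>i. Ys i \<omega>)"
    and "Txy \<equiv> \<lambda>\<omega>. emp_cov n p q (\<lambda>i. Xs i \<omega>) (\<lambda>i. Ys i \<omega>)"
    and "C \<equiv> 10 * A * K0\<^sup>2"
  defines "bad \<equiv> {\<omega> \<in> space M. deviates (Tx \<omega>) (Ty \<omega>) (Txy \<omega>) (C * lam)}"
  shows "bad \<in> sets M" and "measure M bad \<le> 216 / m"
proof -
  interpret prob_space M by (rule M)
  let ?Ex = "\<lambda>u v. {\<omega> \<in> space M. C * lam < \<bar>bil p p (\<lambda>i j. Tx \<omega> $$ (i, j) - Sx $$ (i, j)) u v\<bar>}"
  let ?Ey = "\<lambda>u v. {\<omega> \<in> space M. C * lam < \<bar>bil q q (\<lambda>i j. Ty \<omega> $$ (i, j) - Sy $$ (i, j)) u v\<bar>}"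
  let ?Exy = "\<lambda>u v. {\<omega> \<in> space M. C * lam < \<bar>bil p q (\<lambda>i j. Txy \<omega> $$ (i, j) - Sxy $$ (i, j)) u v\<bar>}"
  have bad: "bad = (\<Union>u\<in>F. \<Union>v\<in>F. ?Ex u v) \<union> (\<Union>u\<in>G. \<Union>v\<in>G. ?Ey u v) \<union> (\<Union>u\<in>F. \<Union>v\<in>G. ?Exy u v)"
    unfolding bad_def deviates_def by blast
  have K0: "0 < K0" using K0_ge by linarith
  have lnm: "0 \<le> ln (real m)" using m by simp
  have lam0: "0 \<le> lam" using lam lnm by simp
  have C: "0 \<le> C * lam" "C * lam \<le> 8 * (T\<^sup>2 * K0 * K0)"
  proof -
    show "0 \<le> C * lam" using lam0 A by (simp add: C_def)
    have "C * lam \<le> C * (4 / 5)" using lam A by (intro mult_left_mono) (auto simp: C_def)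
    then show "C * lam \<le> 8 * (T\<^sup>2 * K0 * K0)" by (simp add: C_def AT power2_eq_square)
  qed
  \<comment> \<open>With scale \<open>A * K0\<^sup>2\<close> the exponent is
    \<open>100 / 32 * ln m\<close>, and 100 / 32 exceeds 3.\<close>
  have tail: "2 * exp (- (n * (C * lam)\<^sup>2 / (32 * (T\<^sup>2 * K0 * K0)\<^sup>2))) \<le> 2 / real m ^ 3"
  proof -
    have l2: "lam\<^sup>2 = ln (real m) / n" using lam lnm by simp
    have "(C * lam)\<^sup>2 = 100 * (T\<^sup>2 * K0 * K0)\<^sup>2 * (ln (real m) / n)"
      unfolding power_mult_distrib[of C lam] l2 by (simp add: C_def AT power2_eq_square)
    then have "n * (C * lam)\<^sup>2 / (32 * (T\<^sup>2 * K0 * K0)\<^sup>2) = 100 / 32 * ln (real m)"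
      using n K0 A AT by simp
    then have "- (n * (C * lam)\<^sup>2 / (32 * (T\<^sup>2 * K0 * K0)\<^sup>2)) \<le> - (3 * ln (real m))" using lnm by linarith
    then have "exp (- (n * (C * lam)\<^sup>2 / (32 * (T\<^sup>2 * K0 * K0)\<^sup>2))) \<le> exp (- (3 * ln (real m)))" by simp
    also have "\<dots> = 1 / real m ^ 3"
      using m by (simp add: exp_minus exp_of_nat_mult[of 3, simplified] field_simps)
    finally show ?thesis by simp
  qed
  have selX: "(X \<omega> @\<^sub>v Y \<omega>) $ j = X \<omega> $ j" if "\<omega> \<in> space M" "j < p" for \<omega> j
    using random_vec_dim[OF subgauss_pair.X[OF xy]] random_vec_dim[OF subgauss_pair.Y[OF xy]] that
    by (simp add: append_vec_def)
  have selY: "(X \<omega> @\<^sub>v Y \<omega>) $ (p + k) = Y \<omega> $ k" if "\<omega> \<in> space M" "k < q" for \<omega> k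
    using random_vec_dim[OF subgauss_pair.X[OF xy]] random_vec_dim[OF subgauss_pair.Y[OF xy]] that
    by (simp add: append_vec_def)
  have selXs: "(Xs i \<omega> @\<^sub>v Ys i \<omega>) $ j = Xs i \<omega> $ j" if "\<omega> \<in> space M" "i < n" "j < p" for \<omega> j i
    using random_vec_dim[OF Xs[OF that(2)]] random_vec_dim[OF Ys[OF that(2)]] that
    by (simp add: append_vec_def)
  have selYs: "(Xs i \<omega> @\<^sub>v Ys i \<omega>) $ (p + k) = Ys i \<omega> $ k" if "\<omega> \<in> space M" "i < n" "k < q" for \<omega> k i
    using random_vec_dim[OF Xs[OF that(2)]] random_vec_dim[OF Ys[OF that(2)]] that
    by (simp add: append_vec_def)
  have px: "j < p \<Longrightarrow> j < p + q" and qx: "j < q \<Longrightarrow> p + j < p + q" for j by auto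
  have e1: "?Ex u v \<in> events"
    "prob (?Ex u v) \<le> 2 / real m ^ 3" if "u \<in> F" "v \<in> F" for u v
  proof -
    note c = subgauss_pair.emp_cov_concentration[where cx = "\<lambda>j. j" and cy = "\<lambda>j. j" and Xs = Xs and Ys = Xs,
      OF xx n iid px px selX[symmetric] selXs[symmetric] selX[symmetric] selXs[symmetric]
        F_le[OF that(1)] K0 F_le[OF that(2)] K0 C, folded S]
    show "?Ex u v \<in> events" unfolding Tx_def Ty_def Txy_def by (rule c(1))
    show "prob (?Ex u v) \<le> 2 / real m ^ 3" unfolding Tx_def Ty_def Txy_def by (rule order_trans[OF c(2) tail])
  qed
  have e2: "?Ey u v \<in> events"
    "prob (?Ey u v) \<le> 2 / real m ^ 3" if "u \<in> G" "v \<in> G" for u v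
  proof -
    note c = subgauss_pair.emp_cov_concentration[where cx = "\<lambda>j. p + j" and cy = "\<lambda>j. p + j" and Xs = Ys and Ys = Ys,
      OF yy n iid qx qx selY[symmetric] selYs[symmetric] selY[symmetric] selYs[symmetric]
        G_le[OF that(1)] K0 G_le[OF that(2)] K0 C, folded S]
    show "?Ey u v \<in> events" unfolding Tx_def Ty_def Txy_def by (rule c(1))
    show "prob (?Ey u v) \<le> 2 / real m ^ 3" unfolding Tx_def Ty_def Txy_def by (rule order_trans[OF c(2) tail])
  qed
  have e3: "?Exy u v \<in> events"
    "prob (?Exy u v) \<le> 2 / real m ^ 3" if "u \<in> F" "v \<in> G" for u v
  proof -
    note c = subgauss_pair.emp_cov_concentration[where cx = "\<lambda>j. j" and cy = "\<lambda>j. p + j" and Xs = Xs and Ys = Ys,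
      OF xy n iid px qx selX[symmetric] selXs[symmetric] selY[symmetric] selYs[symmetric]
        F_le[OF that(1)] K0 G_le[OF that(2)] K0 C, folded S]
    show "?Exy u v \<in> events" unfolding Tx_def Ty_def Txy_def by (rule c(1))
    show "prob (?Exy u v) \<le> 2 / real m ^ 3" unfolding Tx_def Ty_def Txy_def by (rule order_trans[OF c(2) tail])
  qed
  \<comment> \<open>Both families have at most \<open>2 * m + 4\<close> members, and
    \<open>m\<close> is at least 1. Three blocks with \<open>(6 * m)\<^sup>2\<close> pairs and tail
    \<open>2 / m ^ 3\<close> give the bound \<open>216 / m\<close>.\<close>
  have m6: "real (card F) \<le> 6 * real m" "real (card G) \<le> 6 * real m" using card_FG m by auto
  have nn: "0 \<le> 2 / real m ^ 3" by simp
  note u1 = double_union_bound[OF finite_FG(1) finite_FG(1) m6(1) m6(1) e1 nn]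
  note u2 = double_union_bound[OF finite_FG(2) finite_FG(2) m6(2) m6(2) e2 nn]
  note u3 = double_union_bound[OF finite_FG(1) finite_FG(2) m6(1) m6(2) e3 nn]
  show "bad \<in> sets M" unfolding bad using u1(1) u2(1) u3(1) by (intro sets.Un)
  have "prob bad \<le> (6 * real m)\<^sup>2 * (2 / real m ^ 3) + (6 * real m)\<^sup>2 * (2 / real m ^ 3) + (6 * real m)\<^sup>2 * (2 / real m ^ 3)"
    unfolding bad using u1 u2 u3 by (intro order_trans[OF measure_Un_le] add_mono sets.Un)
  also have "\<dots> = 216 / m" using m by (simp add: power2_eq_square power3_eq_cube)
  finally show "measure M bad \<le> 216 / m" .
qed

end

text \<open>All rate facts come from \<open>sU \<ge> 1\<close>, the two little-o conditions and
  \<open>1 / 2 \<le> kappa\<close>. The bridge between the last condition and \<open>s\<close>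
  itself is \<open>lam\<^sup>2 \<ge> 1 / n\<close>.\<close>

lemma rates_asymptotics:
  fixes s p q sU :: "nat \<Rightarrow> nat" and lam :: "nat \<Rightarrow> real"
  assumes lam: "\<And>n. lam n = sqrt (ln (real (max (p n) (q n))) / real n)"
    and sU_pos: "\<forall>n\<ge>1. 1 \<le> sU n" and s_pos: "\<forall>n\<ge>1. 1 \<le> s n"
    and o1: "(\<lambda>n. real (sU n)) \<in> o(\<lambda>n. real (p n))"
    and o2: "(\<lambda>n. real (s n) powr (2 * kappa) * (lam n)\<^sup>2) \<in> o(\<lambda>n. real n powr (- 1 / 2))"
    and kappa: "1 / 2 \<le> kappa"
  defines "del \<equiv> \<lambda>n. real (s n) powr kappa * lam n" and "eta \<equiv> \<lambda>n. real (s n) powr (kappa + 1 / 2) * lam n"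
  shows "\<forall>\<^sub>F n in sequentially. N \<le> real (p n)"
    and "0 < c \<Longrightarrow> \<forall>\<^sub>F n in sequentially. eta n < c"
    and "1 \<le> K \<Longrightarrow> \<forall>\<^sub>F n in sequentially. rates K (lam n) (del n) (eta n)"
    and "n \<ge> 1 \<Longrightarrow> eta n = sqrt (s n) * del n"
    and "n \<ge> 1 \<Longrightarrow> (del n)\<^sup>2 = real (s n) powr (2 * kappa) * (lam n)\<^sup>2"
    and "n \<ge> 1 \<Longrightarrow> 0 \<le> lam n \<Longrightarrow> lam n \<le> del n \<and> del n \<le> eta n"
proof -
  have sU: "n \<ge> 1 \<Longrightarrow> 1 \<le> sU n" and s: "n \<ge> 1 \<Longrightarrow> 1 \<le> s n" for n
    using sU_pos s_pos by auto
  \<comment> \<open>\<open>1 \<le> sU n \<le> c * p n\<close> with arbitrarily small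
    \<open>c\<close>.\<close>
  have p_large: "\<forall>\<^sub>F n in sequentially. N \<le> real (p n)" for N
  proof -
    define c where "c = 1 / max 1 N"
    have "0 < c" by (simp add: c_def)
    then have "\<forall>\<^sub>F n in sequentially. norm (real (sU n)) \<le> c * norm (real (p n))"
      by (rule landau_o.smallD[OF o1])
    then show ?thesis using eventually_ge_at_top[of 1]
    proof eventually_elim
      case (elim n)
      then have "1 \<le> c * real (p n)" using sU[of n] by simp
      then have "max 1 N \<le> real (p n)" by (simp add: c_def field_simps)
      then show ?case by simp
    qed
  qed
  then show "\<forall>\<^sub>F n in sequentially. N \<le> real (p n)" .
  have etaq: "eta n = sqrt (s n) * del n" if "n \<ge> 1" for n
    using s[OF that] by (simp add: eta_def del_def powr_add powr_half_sqrt)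
  show "n \<ge> 1 \<Longrightarrow> eta n = sqrt (s n) * del n" by (rule etaq)
  have delq: "(del n)\<^sup>2 = real (s n) powr (2 * kappa) * (lam n)\<^sup>2" if "n \<ge> 1" for n
    using s[OF that] by (simp add: del_def power_mult_distrib power2_eq_square powr_add[symmetric])
  show "n \<ge> 1 \<Longrightarrow> (del n)\<^sup>2 = real (s n) powr (2 * kappa) * (lam n)\<^sup>2" by (rule delq)
  have ord: "lam n \<le> del n" "del n \<le> eta n" if "n \<ge> 1" "0 \<le> lam n" for n
  proof -
    have "1 * lam n \<le> real (s n) powr kappa * lam n"
      using s[OF that(1)] kappa that(2) by (intro mult_right_mono ge_one_powr_ge_zero) auto
    then show "lam n \<le> del n" by (simp add: del_def)
    show "del n \<le> eta n" unfolding del_def eta_def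
      using s[OF that(1)] kappa that(2) by (intro mult_right_mono powr_mono) auto
  qed
  then show "n \<ge> 1 \<Longrightarrow> 0 \<le> lam n \<Longrightarrow> lam n \<le> del n \<and> del n \<le> eta n" by blast
  \<comment> \<open>Dimension 3 exceeds e, so the logarithm is at least 1.\<close>
  have lam_large: "\<forall>\<^sub>F n in sequentially. 1 / n \<le> (lam n)\<^sup>2 \<and> 0 < lam n \<and> 1 \<le> n"
    using p_large[of 3] eventually_ge_at_top[of 1]
  proof eventually_elim
    case (elim n)
    have "exp 1 \<le> real (max (p n) (q n))" using exp_le elim by simp
    then have "1 \<le> ln (real (max (p n) (q n)))" using elim
      by (subst ln_ge_iff) auto
    moreover have "(lam n)\<^sup>2 = ln (real (max (p n) (q n))) / n" using calculation by (simp add: lam)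
    ultimately show ?case using elim by (simp add: lam divide_right_mono)
  qed
  \<comment> \<open>With \<open>t = del\<^sup>2\<close> one has \<open>eta\<^sup>2 = s * t\<close>.
    The sparsity condition bounds \<open>t\<close> by a small multiple of \<open>1 / sqrt n\<close>.
    As \<open>s / n \<le> t\<close>, by \<open>1 \<le> 2 * kappa\<close>, it also bounds
    \<open>s\<close> by a small multiple of \<open>sqrt n\<close>; the roots cancel in the
    product.\<close>
  have eta_small: "\<forall>\<^sub>F n in sequentially. eta n < c" if c: "0 < c" for c
  proof -
    have "0 < c / 2" using c by simp
    then have "\<forall>\<^sub>F n in sequentially. norm (real (s n) powr (2 * kappa) * (lam n)\<^sup>2) \<le> c / 2 * norm (real n powr (- 1 / 2))"
      by (rule landau_o.smallD[OF o2])
    then show ?thesis using lam_large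
    proof eventually_elim
      case (elim n)
      define t where "t = real (s n) powr (2 * kappa) * (lam n)\<^sup>2"
      have n: "1 \<le> n" and sn: "1 \<le> real (s n)" using elim s[of n] by auto
      have t: "t \<le> c / 2 / sqrt n"
        using elim n by (simp add: t_def powr_minus powr_half_sqrt field_simps)
      have "real (s n) = real (s n) powr 1" using sn by simp
      also have "\<dots> \<le> real (s n) powr (2 * kappa)" using sn kappa by (intro powr_mono) auto
      finally have s1: "real (s n) \<le> real (s n) powr (2 * kappa)" .
      have "real (s n) * (1 / n) \<le> real (s n) powr (2 * kappa) * (lam n)\<^sup>2"
        using s1 elim by (intro mult_mono) auto
      then have "real (s n) / n \<le> c / 2 / sqrt n" using t by (simp add: t_def)
      then have "real (s n) \<le> c / 2 / sqrt n * n" using n by (simp add: field_simps)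
      also have "\<dots> = c / 2 * sqrt n" using n by (simp add: real_div_sqrt field_simps)
      finally have s2: "real (s n) \<le> c / 2 * sqrt n" .
      have "(eta n)\<^sup>2 = real (s n) * t"
        using etaq[OF n] delq[OF n] by (simp add: power_mult_distrib t_def)
      also have "\<dots> \<le> (c / 2 * sqrt n) * (c / 2 / sqrt n)"
        using s2 t c n by (intro mult_mono) (auto simp: t_def)
      also have "\<dots> = (c / 2)\<^sup>2" using n by (simp add: power2_eq_square)
      finally have "eta n \<le> c / 2" by (rule power2_le_imp_le) (use c in simp)
      then show ?case using c by simp
    qed
  qed
  then show "0 < c \<Longrightarrow> \<forall>\<^sub>F n in sequentially. eta n < c" .
  show "\<forall>\<^sub>F n in sequentially. rates K (lam n) (del n) (eta n)" if "1 \<le> K"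
    using eta_small[of 1, simplified] lam_large
  proof eventually_elim
    case (elim n)
    have n: "1 \<le> n" and l: "0 < lam n" and sn: "1 \<le> real (s n)" using elim s[of n] by auto
    note od = ord[OF n less_imp_le[OF l]]
    show ?case
    proof
      show "1 \<le> K" "0 < lam n" "lam n \<le> del n" "del n \<le> 1" "0 < eta n" using that l od elim by auto
      have "lam n * eta n = real (s n) powr (kappa + 1 / 2) * (lam n)\<^sup>2" by (simp add: eta_def power2_eq_square)
      also have "\<dots> \<le> real (s n) powr (2 * kappa) * (lam n)\<^sup>2"
        using sn kappa by (intro mult_right_mono powr_mono) auto
      finally show "lam n * eta n \<le> (del n)\<^sup>2" by (simp add: delq[OF n])
      \<comment> \<open>\<open>lam * eta\<^sup>2\<close> is \<open>s * lam\<close> times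
        \<open>del\<^sup>2\<close>, and \<open>s * lam\<close> is at most \<open>eta\<close>, hence
        below 1.\<close>
      have "real (s n) = real (s n) powr 1" using sn by simp
      also have "\<dots> \<le> real (s n) powr (kappa + 1 / 2)" using sn kappa by (intro powr_mono) auto
      finally have "real (s n) * lam n \<le> eta n" unfolding eta_def using l by (intro mult_right_mono) auto
      then have "real (s n) * lam n \<le> 1" using elim by simp
      then have "(real (s n) * lam n) * (del n)\<^sup>2 \<le> 1 * (del n)\<^sup>2" by (intro mult_right_mono) auto
      then show "lam n * (eta n)\<^sup>2 \<le> (del n)\<^sup>2"
        using etaq[OF n] by (simp add: power_mult_distrib mult_ac)
    qed
  qed
qed

text \<open>A canonical pair is determined only up to a common sign. The second alternative is the
  first one for the equally legitimate pair \<open>(- x0, - y0)\<close>, with the leading term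
  formed at that pair. Measurability of \<open>rem\<close> is part of the claim, since without it
  the bound in probability could hold vacuously.\<close>

theorem theorem1:
  fixes M :: "nat \<Rightarrow> 'a measure"
    and p q sU sV s :: "nat \<Rightarrow> nat" and r :: nat
    and X Y :: "nat \<Rightarrow> 'a \<Rightarrow> real vec"
    and Xs Ys :: "nat \<Rightarrow> nat \<Rightarrow> 'a \<Rightarrow> real vec"
    and Sx Sy Sxy U V :: "nat \<Rightarrow> real mat"
    and Lam :: "nat \<Rightarrow> nat \<Rightarrow> real"
    and Lam2 rho0 lam :: "nat \<Rightarrow> real"
    and alpha0 beta0 x0 y0 :: "nat \<Rightarrow> real vec"
    and Phi0 :: "nat \<Rightarrow> real mat"
    and Shx Shy Shxy Phih :: "nat \<Rightarrow> 'a \<Rightarrow> real mat"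
    and alphah betah xh yh xdb :: "nat \<Rightarrow> 'a \<Rightarrow> real vec"
    and rhoh :: "nat \<Rightarrow> 'a \<Rightarrow> real"
    and L1 :: "nat \<Rightarrow> 'a \<Rightarrow> real vec \<Rightarrow> real vec \<Rightarrow> real vec"
    and K B eps0 kappa :: real
  assumes prob: "\<And>n. n \<ge> 1 \<Longrightarrow> prob_space (M n)"
    and iid: "\<And>n. n \<ge> 1 \<Longrightarrow>
      iid_copies (M n) (p n + q n) n (\<lambda>i \<omega>. Xs n i \<omega> @\<^sub>v Ys n i \<omega>) (\<lambda>\<omega>. X n \<omega> @\<^sub>v Y n \<omega>)"
    and dims: "\<And>n. n \<ge> 1 \<Longrightarrow> random_vec (M n) (p n) (X n) \<and> random_vec (M n) (q n) (Y n)"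
      "\<And>n i. n \<ge> 1 \<Longrightarrow> i < n \<Longrightarrow>
        random_vec (M n) (p n) (Xs n i) \<and> random_vec (M n) (q n) (Ys n i)"
    and centered: "\<And>n. n \<ge> 1 \<Longrightarrow> centered (M n) (p n) (X n) \<and> centered (M n) (q n) (Y n)"
    and subgauss: "\<And>n. n \<ge> 1 \<Longrightarrow>
      subgauss_vec_norm (M n) (p n) (X n) \<le> ennreal K \<and>
      subgauss_vec_norm (M n) (q n) (Y n) \<le> ennreal K"
    \<comment> \<open>population covariances and the canonical decomposition\<close>
    and Sx: "\<And>n. Sx n = cross_cov (M n) (p n) (p n) (X n) (X n)"
    and Sy: "\<And>n. Sy n = cross_cov (M n) (q n) (q n) (Y n) (Y n)"
    and Sxy: "\<And>n. Sxy n = cross_cov (M n) (p n) (q n) (X n) (Y n)"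
    and rank: "r \<ge> 1" "\<And>n. n \<ge> 1 \<Longrightarrow> vec_space.rank (p n) (Sxy n) = r"
    and UV: "\<And>n. n \<ge> 1 \<Longrightarrow> U n \<in> carrier_mat (p n) r \<and> V n \<in> carrier_mat (q n) r"
    and decomp: "\<And>n. n \<ge> 1 \<Longrightarrow>
      Sxy n = Sx n * U n * mat_diag r (Lam n) * transpose_mat (V n) * Sy n"
    and ortho: "\<And>n. n \<ge> 1 \<Longrightarrow>
      transpose_mat (U n) * Sx n * U n = 1\<^sub>m r \<and> transpose_mat (V n) * Sy n * V n = 1\<^sub>m r"
    and Lam_pos: "\<And>n k. n \<ge> 1 \<Longrightarrow> k < r \<Longrightarrow> Lam n k > 0"
    and Lam_decr: "\<And>n k l. n \<ge> 1 \<Longrightarrow> k \<le> l \<Longrightarrow> l < r \<Longrightarrow> Lam n l \<le> Lam n k"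
    and rho0: "\<And>n. rho0 n = Lam n 0"
    and Lam2: "\<And>n. Lam2 n = (if r = 1 then 0 else Lam n 1)"
    and alpha0: "\<And>n. alpha0 n = col (U n) 0"
    and beta0: "\<And>n. beta0 n = col (V n) 0"
    and x0: "\<And>n. x0 n = sqrt (rho0 n) \<cdot>\<^sub>v alpha0 n"
    and y0: "\<And>n. y0 n = sqrt (rho0 n) \<cdot>\<^sub>v beta0 n"
    and s: "\<And>n. sU n = nonzero_rows (U n)" "\<And>n. sV n = nonzero_rows (V n)"
      "\<And>n. s n = sU n + sV n"
    and lam: "\<And>n. lam n = sqrt (ln (real (max (p n) (q n))) / real n)"
    \<comment> \<open>empirical covariances\<close>
    and Shx: "\<And>n \<omega>. Shx n \<omega> = emp_cov n (p n) (p n) (\<lambda>i. Xs n i \<omega>) (\<lambda>i. Xs n i \<omega>)"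
    and Shy: "\<And>n \<omega>. Shy n \<omega> = emp_cov n (q n) (q n) (\<lambda>i. Ys n i \<omega>) (\<lambda>i. Ys n i \<omega>)"
    and Shxy: "\<And>n \<omega>. Shxy n \<omega> = emp_cov n (p n) (q n) (\<lambda>i. Xs n i \<omega>) (\<lambda>i. Ys n i \<omega>)"
    \<comment> \<open>eigengap, bounded eigenvalues, sparsity\<close>
    and eigengap: "eps0 \<in> {0<..<1}" "\<And>n. n \<ge> 1 \<Longrightarrow> rho0 n - Lam2 n > eps0"
    and bounded_eigenvalues: "B > 0"
      "\<And>n e. n \<ge> 1 \<Longrightarrow> eigenvalue (Sx n) e \<Longrightarrow> e \<in> {1 / B..B}"
      "\<And>n e. n \<ge> 1 \<Longrightarrow> eigenvalue (Sy n) e \<Longrightarrow> e \<in> {1 / B..B}"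
    and kappa: "kappa \<in> {1 / 2..1}"
    and sparsity: "(\<lambda>n. real (sU n)) \<in> o(\<lambda>n. real (p n))"
      "(\<lambda>n. real (sV n)) \<in> o(\<lambda>n. real (q n))"
      "(\<lambda>n. real (s n) powr (2 * kappa) * (lam n)\<^sup>2) \<in> o(\<lambda>n. real n powr (- 1 / 2))"
    \<comment> \<open>preliminary estimators\<close>
    and estimators: "\<And>n. n \<ge> 1 \<Longrightarrow>
      random_vec (M n) (p n) (alphah n) \<and> random_vec (M n) (q n) (betah n)"
    and preliminary_l2: "bigOp M
      (\<lambda>n \<omega>. sign_dist l2_norm (alphah n \<omega>) (alpha0 n) + sign_dist l2_norm (betah n \<omega>) (beta0 n))
      (\<lambda>n. real (s n) powr kappa * lam n)"
    and preliminary_l1: "bigOp M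
      (\<lambda>n \<omega>. sign_dist l1_norm (alphah n \<omega>) (alpha0 n) + sign_dist l1_norm (betah n \<omega>) (beta0 n))
      (\<lambda>n. real (s n) powr (kappa + 1 / 2) * lam n)"
    \<comment> \<open>inverse Hessian\<close>
    and Phi0: "\<And>n. n \<ge> 1 \<Longrightarrow> Phi0 n \<in> carrier_mat (p n + q n) (p n + q n) \<and>
      inverts_mat (Phi0 n) (hessian (Sx n) (Sy n) (Sxy n) (rho0 n) (alpha0 n) (beta0 n)) \<and>
      inverts_mat (hessian (Sx n) (Sy n) (Sxy n) (rho0 n) (alpha0 n) (beta0 n)) (Phi0 n)"
    and Phih: "\<And>n. n \<ge> 1 \<Longrightarrow> random_mat (M n) (p n + q n) (p n + q n) (Phih n)"
    and inverse_hessian_l1: "bigOp M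
      (\<lambda>n \<omega>. MAX j\<in>{..<p n + q n}. l1_norm (col (Phih n \<omega>) j - col (Phi0 n) j))
      (\<lambda>n. real (s n) powr (kappa + 1 / 2) * lam n)"
    and inverse_hessian_l2: "bigOp M
      (\<lambda>n \<omega>. MAX j\<in>{..<p n + q n}. l2_norm (col (Phih n \<omega>) j - col (Phi0 n) j))
      (\<lambda>n. real (s n) powr kappa * lam n)"
    \<comment> \<open>de-biased estimator and leading term\<close>
    and rhoh: "\<And>n \<omega>. rhoh n \<omega> =
      canon_corr (Shx n \<omega>) (Shy n \<omega>) (Shxy n \<omega>) (alphah n \<omega>) (betah n \<omega>)"
    \<comment> \<open>the directions are oriented: the estimated canonical correlation is nonnegative\<close>
    and orientation:
      "(\<lambda>n. measure (M n) {\<omega> \<in> space (M n). rhoh n \<omega> < 0}) \<longlonglongrightarrow> 0"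
    and xh: "\<And>n \<omega>. xh n \<omega> = sqrt \<bar>rhoh n \<omega>\<bar> \<cdot>\<^sub>v alphah n \<omega>"
    and yh: "\<And>n \<omega>. yh n \<omega> = sqrt \<bar>rhoh n \<omega>\<bar> \<cdot>\<^sub>v betah n \<omega>"
    and xdb: "\<And>n \<omega>. xdb n \<omega> =
      vec_first (debiased (Phih n \<omega>) (Shx n \<omega>) (Shy n \<omega>) (Shxy n \<omega>) (xh n \<omega>) (yh n \<omega>)) (p n)"
    and L1: "\<And>n \<omega> x y. L1 n \<omega> x y =
      vec_first (leading_term (Phi0 n) (rho0 n) (Sx n) (Sy n) (Sxy n)
        (Shx n \<omega>) (Shy n \<omega>) (Shxy n \<omega>) x y) (p n)"
  shows "\<exists>rem :: nat \<Rightarrow> 'a \<Rightarrow> real vec.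
    (\<forall>n\<ge>1. random_vec (M n) (p n) (rem n)) \<and>
    (\<forall>n\<ge>1. \<forall>\<omega>\<in>space (M n).
       xdb n \<omega> = x0 n - L1 n \<omega> (x0 n) (y0 n) + rem n \<omega> \<or>
       xdb n \<omega> = - x0 n - L1 n \<omega> (- x0 n) (- y0 n) + rem n \<omega>) \<and>
    bigOp M (\<lambda>n \<omega>. linf_norm (rem n \<omega>)) (\<lambda>n. real (s n) powr (2 * kappa) * (lam n)\<^sup>2)"
proof -
  \<comment> \<open>Above \<open>K\<close>, as the infimum in the sub-Gaussian norm requires, and
    positive even if \<open>K\<close> is not.\<close>
  define T where "T = max K 0 + 1"
  have T: "K < T" "0 < T" by (auto simp: T_def)
  define A where "A = T\<^sup>2"
  have sgx: "subgauss_pair (M n) (p n) (p n) (X n) (X n) K T"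
    and sgy: "subgauss_pair (M n) (q n) (q n) (Y n) (Y n) K T"
    and sgxy: "subgauss_pair (M n) (p n) (q n) (X n) (Y n) K T" if "n \<ge> 1" for n
    using prob[OF that] dims(1)[OF that] centered[OF that] subgauss[OF that] T
    by (auto simp: subgauss_pair_def subgauss_pair_axioms_def)
  have pop: "cca_population (p n) (q n) r (Sx n) (Sy n) (Sxy n) (U n) (V n) (Phi0 n) (Lam n) (Lam2 n) A B eps0"
    if n: "n \<ge> 1" for n
  proof
    show "Sx n \<in> carrier_mat (p n) (p n)" "Sy n \<in> carrier_mat (q n) (q n)" "Sxy n \<in> carrier_mat (p n) (q n)"
      by (simp_all add: Sx Sy Sxy cross_cov_def)
    show "Sx n $$ (i, j) = Sx n $$ (j, i)" if "i < p n" "j < p n" for i j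
      unfolding Sx using that by (rule cross_cov_sym)
    show "Sy n $$ (i, j) = Sy n $$ (j, i)" if "i < q n" "j < q n" for i j
      unfolding Sy using that by (rule cross_cov_sym)
    show "\<bar>bil (p n) (p n) (mf (Sx n)) u v\<bar> \<le> A * a * b"
      if "0 < a" "0 < b" "L2_set u {..<p n} \<le> a" "L2_set v {..<p n} \<le> b" for u v a b
      unfolding Sx A_def by (rule subgauss_pair.cross_cov_bound[OF sgx[OF n] that])
    show "\<bar>bil (q n) (q n) (mf (Sy n)) u v\<bar> \<le> A * a * b"
      if "0 < a" "0 < b" "L2_set u {..<q n} \<le> a" "L2_set v {..<q n} \<le> b" for u v a b
      unfolding Sy A_def by (rule subgauss_pair.cross_cov_bound[OF sgy[OF n] that])
    show "\<bar>bil (p n) (q n) (mf (Sxy n)) u v\<bar> \<le> A * a * b"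
      if "0 < a" "0 < b" "L2_set u {..<p n} \<le> a" "L2_set v {..<q n} \<le> b" for u v a b
      unfolding Sxy A_def by (rule subgauss_pair.cross_cov_bound[OF sgxy[OF n] that])
    show "U n \<in> carrier_mat (p n) r" "V n \<in> carrier_mat (q n) r" using UV[OF n] by auto
    show "Phi0 n \<in> carrier_mat (p n + q n) (p n + q n)"
      "inverts_mat (hessian (Sx n) (Sy n) (Sxy n) (Lam n 0) (col (U n) 0) (col (V n) 0)) (Phi0 n)"
      using Phi0[OF n] by (auto simp: rho0 alpha0 beta0)
    show "0 < A" using T by (simp add: A_def)
    show "0 < B" by (rule bounded_eigenvalues(1))
    show "0 < eps0" using eigengap(1) by simp
    show "1 / B \<le> e" if "eigenvalue (Sx n) e" for e using bounded_eigenvalues(2)[OF n that] by simp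
    show "1 / B \<le> e" if "eigenvalue (Sy n) e" for e using bounded_eigenvalues(3)[OF n that] by simp
    show "Sxy n = Sx n * U n * mat_diag r (Lam n) * transpose_mat (V n) * Sy n" by (rule decomp[OF n])
    show "transpose_mat (U n) * Sx n * U n = 1\<^sub>m r" "transpose_mat (V n) * Sy n * V n = 1\<^sub>m r"
      using ortho[OF n] by auto
    show "1 \<le> r" by (rule rank(1))
    show "0 < Lam n k" if "k < r" for k using Lam_pos[OF n that] .
    show "Lam n l \<le> Lam n k" if "k \<le> l" "l < r" for k l using Lam_decr[OF n that] .
    show "Lam2 n = (if r = 1 then 0 else Lam n 1)" by (rule Lam2)
    show "eps0 < Lam n 0 - Lam2 n" using eigengap(2)[OF n] by (simp add: rho0)
  qed
  have names: "cca_population.\<alpha> (U n) = alpha0 n" "cca_population.\<beta> (V n) = beta0 n"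
    "cca_population.\<rho> (Lam n) = rho0 n" "cca_population.x0 (U n) (Lam n) = x0 n"
    "cca_population.y0 (V n) (Lam n) = y0 n" if "n \<ge> 1" for n
    using cca_population.\<alpha>_def[OF pop[OF that]] cca_population.\<beta>_def[OF pop[OF that]]
      cca_population.\<rho>_def[OF pop[OF that]] cca_population.x0_def[OF pop[OF that]]
      cca_population.y0_def[OF pop[OF that]]
    by (auto simp: alpha0 beta0 rho0 x0 y0)
  have vecs: "alpha0 n \<in> carrier_vec (p n)" "beta0 n \<in> carrier_vec (q n)"
    "x0 n \<in> carrier_vec (p n)" "y0 n \<in> carrier_vec (q n)" if "n \<ge> 1" for n
    using cca_population.vecs[OF pop[OF that]] unfolding names[OF that] .
  have S_carrier: "Phi0 n \<in> carrier_mat (p n + q n) (p n + q n)" "Sx n \<in> carrier_mat (p n) (p n)"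
    "Sy n \<in> carrier_mat (q n) (q n)" "Sxy n \<in> carrier_mat (p n) (q n)" if "n \<ge> 1" for n
    using cca_population.carrier[OF pop[OF that]] by auto
  have T_random: "random_mat (M n) (p n) (p n) (Shx n)" "random_mat (M n) (q n) (q n) (Shy n)"
    "random_mat (M n) (p n) (q n) (Shxy n)" if "n \<ge> 1" for n
    unfolding Shx Shy Shxy using dims(2)[OF that] by (auto intro!: random_mat_emp_cov)
  have rh_meas: "rhoh n \<in> borel_measurable (M n)" if "n \<ge> 1" for n
    using measurable_canon_corr[OF T_random[OF that]] estimators[OF that] unfolding rhoh by auto
  have hat_random: "random_vec (M n) (p n) (xh n)" "random_vec (M n) (q n) (yh n)" if "n \<ge> 1" for n
    unfolding xh yh using estimators[OF that] rh_meas[OF that]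
    by (auto intro!: random_vec_scale measurable_sqrt borel_measurable_abs)
  \<comment> \<open>The sign is read off from \<open>alphah\<close> alone; on the good event
    \<open>betah\<close> has the same one.\<close>
  define w where "w = (\<lambda>n \<omega>. best_sign (alphah n \<omega>) (alpha0 n))"
  have w_cases: "w n \<omega> = 1 \<or> w n \<omega> = - 1" for n \<omega> unfolding w_def by (rule best_sign_cases)
  have w_meas: "w n \<in> borel_measurable (M n)" if "n \<ge> 1" for n
    using measurable_best_sign[OF _ vecs(1)[OF that]] estimators[OF that] unfolding w_def by auto
  have sign_random: "random_vec (M n) (p n) (\<lambda>\<omega>. w n \<omega> \<cdot>\<^sub>v x0 n)"
    "random_vec (M n) (q n) (\<lambda>\<omega>. w n \<omega> \<cdot>\<^sub>v y0 n)" if "n \<ge> 1" for n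
    using vecs[OF that] w_meas[OF that] by (auto intro!: random_vec_scale random_vec_const)
  \<comment> \<open>Chosen so that the expansion is exact at every sample point, also outside the
    good event; only the size of \<open>rem\<close> is a matter of probability.\<close>
  define rem where "rem = (\<lambda>n \<omega>. xdb n \<omega> - w n \<omega> \<cdot>\<^sub>v x0 n + L1 n \<omega> (w n \<omega> \<cdot>\<^sub>v x0 n) (w n \<omega> \<cdot>\<^sub>v y0 n))"
  have xdb_c: "xdb n \<omega> \<in> carrier_vec (p n)" and L1_c: "L1 n \<omega> x y \<in> carrier_vec (p n)" for n \<omega> x y
    by (simp_all add: xdb L1)
  have rem_c: "rem n \<omega> \<in> carrier_vec (p n)" if "n \<ge> 1" for n \<omega>
    unfolding rem_def using xdb_c L1_c vecs[OF that] by auto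
  have rem_index: "rem n \<omega> $ j = xdb n \<omega> $ j - (w n \<omega> \<cdot>\<^sub>v x0 n) $ j
      + L1 n \<omega> (w n \<omega> \<cdot>\<^sub>v x0 n) (w n \<omega> \<cdot>\<^sub>v y0 n) $ j" if "n \<ge> 1" "j < p n" for n \<omega> j
    unfolding rem_def using that vecs[OF that(1)] carrier_vecD[OF xdb_c] carrier_vecD[OF L1_c] by simp
  have rem_random: "random_vec (M n) (p n) (rem n)" if n: "n \<ge> 1" for n
    unfolding random_vec_def
  proof (intro conjI ballI allI impI rem_c[OF n])
    fix j assume j: "j < p n"
    show "(\<lambda>\<omega>. rem n \<omega> $ j) \<in> borel_measurable (M n)"
      unfolding rem_index[OF n j] xdb L1
      by (intro borel_measurable_add borel_measurable_diff j
          measurable_debiased[OF Phih[OF n] T_random[OF n] hat_random[OF n]]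
          random_vec_measurable[OF sign_random(1)[OF n]]
          measurable_leading_term[OF S_carrier[OF n] T_random[OF n] sign_random[OF n]])
  qed
  have expansion: "xdb n \<omega> = x0 n - L1 n \<omega> (x0 n) (y0 n) + rem n \<omega> \<or>
      xdb n \<omega> = - x0 n - L1 n \<omega> (- x0 n) (- y0 n) + rem n \<omega>" if n: "n \<ge> 1" for n \<omega>
  proof -
    have neg: "- 1 \<cdot>\<^sub>v v = - v" for v :: "real vec" by (rule eq_vecI) auto
    have "xdb n \<omega> = w n \<omega> \<cdot>\<^sub>v x0 n - L1 n \<omega> (w n \<omega> \<cdot>\<^sub>v x0 n) (w n \<omega> \<cdot>\<^sub>v y0 n) + rem n \<omega>"
    proof (rule eq_vecI)
      fix j assume "j < dim_vec (w n \<omega> \<cdot>\<^sub>v x0 n - L1 n \<omega> (w n \<omega> \<cdot>\<^sub>v x0 n) (w n \<omega> \<cdot>\<^sub>v y0 n) + rem n \<omega>)"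
      then have j: "j < p n" using carrier_vecD[OF rem_c[OF n]] by simp
      then show "xdb n \<omega> $ j = (w n \<omega> \<cdot>\<^sub>v x0 n - L1 n \<omega> (w n \<omega> \<cdot>\<^sub>v x0 n) (w n \<omega> \<cdot>\<^sub>v y0 n) + rem n \<omega>) $ j"
        using carrier_vecD[OF rem_c[OF n]] carrier_vecD[OF L1_c] vecs[OF n] by (simp add: rem_index[OF n j])
    qed (use carrier_vecD[OF xdb_c] carrier_vecD[OF rem_c[OF n]] in simp)
    then show ?thesis using w_cases[of n \<omega>] by (auto simp: neg)
  qed
  \<comment> \<open>The same number for all \<open>n\<close>, so that the constants below can be
    fixed before \<open>n\<close>.\<close>
  define k0 where "k0 = cca_population.K0 A B eps0"
  have k0: "1 \<le> k0" unfolding k0_def by (rule cca_population.K0_ge(1)[OF pop[of 1]]) simp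
  define del where "del = (\<lambda>n. real (s n) powr kappa * lam n)"
  define eta where "eta = (\<lambda>n. real (s n) powr (kappa + 1 / 2) * lam n)"
  have sU1: "\<forall>n\<ge>1. 1 \<le> sU n"
    unfolding s(1) using cca_population.nonzero_rows_pos[OF pop] by blast
  then have s1: "\<forall>n\<ge>1. 1 \<le> s n" using s(3) by auto
  have kap: "1 / 2 \<le> kappa" using kappa by simp
  have del_eta_eq: "real (s n) powr kappa * lam n = del n" "real (s n) powr (kappa + 1 / 2) * lam n = eta n" for n
    by (simp_all add: del_def eta_def)
  note asym = rates_asymptotics[OF lam sU1 s1 sparsity(1,3) kap, unfolded del_eta_eq]
  define Z1 where "Z1 = (\<lambda>n \<omega>. sign_dist l2_norm (alphah n \<omega>) (alpha0 n) + sign_dist l2_norm (betah n \<omega>) (beta0 n))"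
  define Z2 where "Z2 = (\<lambda>n \<omega>. sign_dist l1_norm (alphah n \<omega>) (alpha0 n) + sign_dist l1_norm (betah n \<omega>) (beta0 n))"
  define Z3 where "Z3 = (\<lambda>n \<omega>. MAX j\<in>{..<p n + q n}. l2_norm (col (Phih n \<omega>) j - col (Phi0 n) j))"
  define Z4 where "Z4 = (\<lambda>n \<omega>. MAX j\<in>{..<p n + q n}. l1_norm (col (Phih n \<omega>) j - col (Phi0 n) j))"
  have A0: "0 < A" and B0: "0 < B" and e0: "0 < eps0"
    using T bounded_eigenvalues(1) eigengap(1) by (auto simp: A_def)
  have bound: "bigOp M (\<lambda>n \<omega>. linf_norm (rem n \<omega>)) (\<lambda>n. real (s n) powr (2 * kappa) * (lam n)\<^sup>2)"
    unfolding bigOp_def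
  proof (intro allI impI)
    fix d :: real assume d: "0 < d"
    \<comment> \<open>There are six ways to leave the good event: four from the estimator
      conditions, a negative correlation, and a deviating covariance.\<close>
    then have d6: "0 < d / 6" by simp
    obtain C1 where C1: "0 < C1"
        "\<forall>\<^sub>F n in sequentially. measure (M n) {\<omega> \<in> space (M n). C1 * \<bar>del n\<bar> < \<bar>Z1 n \<omega>\<bar>} \<le> d / 6"
      using preliminary_l2 d6 unfolding bigOp_def del_def Z1_def by blast
    obtain C2 where C2: "0 < C2"
        "\<forall>\<^sub>F n in sequentially. measure (M n) {\<omega> \<in> space (M n). C2 * \<bar>eta n\<bar> < \<bar>Z2 n \<omega>\<bar>} \<le> d / 6"
      using preliminary_l1 d6 unfolding bigOp_def eta_def Z2_def by blast
    obtain C3 where C3: "0 < C3"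
        "\<forall>\<^sub>F n in sequentially. measure (M n) {\<omega> \<in> space (M n). C3 * \<bar>del n\<bar> < \<bar>Z3 n \<omega>\<bar>} \<le> d / 6"
      using inverse_hessian_l2 d6 unfolding bigOp_def del_def Z3_def by blast
    obtain C4 where C4: "0 < C4"
        "\<forall>\<^sub>F n in sequentially. measure (M n) {\<omega> \<in> space (M n). C4 * \<bar>eta n\<bar> < \<bar>Z4 n \<omega>\<bar>} \<le> d / 6"
      using inverse_hessian_l1 d6 unfolding bigOp_def eta_def Z4_def by blast
    \<comment> \<open>Large enough for the population, for the four stochastic bounds at level
      \<open>d / 6\<close>, and for the deviation threshold.\<close>
    define K' where "K' = k0 + C1 + C2 + C3 + C4 + 10 * A * k0\<^sup>2"
    have "0 \<le> 10 * A * k0\<^sup>2" using A0 by simp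
    then have K': "1 \<le> K'" "k0 \<le> K'" "C1 \<le> K'" "C2 \<le> K'" "C3 \<le> K'" "C4 \<le> K'" "10 * A * k0\<^sup>2 \<le> K'"
      using k0 C1(1) C2(1) C3(1) C4(1) unfolding K'_def by linarith+
    define C where "C = 244 * (direction_const K' eps0 ^ 3)\<^sup>2"
    have C: "0 < C" using direction_const_ge[OF K'(1) e0] K'(1) by (simp add: C_def)
    \<comment> \<open>With \<open>lam \<le> del \<le> eta < c\<close>, the first three entries yield
      the three smallness conditions of \<open>good_event_bound\<close>, and \<open>4 / 5\<close>
      the range of the concentration bound. The factor 2 in the third accounts for the sum of the
      \<open>eta\<close> and \<open>del\<close> terms.\<close>
    define c where "c = min (1 / (14 * K' ^ 3)) (min (eps0 / (7 * K' ^ 3)) (min (1 / (2 * K' * sqrt A)) (4 / 5)))"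
    have c: "0 < c" using K'(1) e0 A0 by (simp add: c_def)
    have "\<forall>\<^sub>F n in sequentially. measure (M n) {\<omega> \<in> space (M n). \<bar>linf_norm (rem n \<omega>)\<bar>
        > C * \<bar>real (s n) powr (2 * kappa) * (lam n)\<^sup>2\<bar>} \<le> d"
      using eventually_ge_at_top[of 1] C1(2) C2(2) C3(2) C4(2) order_tendstoD(2)[OF orientation d6]
        asym(3)[OF K'(1)] asym(2)[OF c] asym(1)[of "1296 / d + 1"]
    proof eventually_elim
      case (elim n)
      note n = elim(1)
      interpret P: prob_space "M n" by (rule prob[OF n])
      interpret R: rates K' "lam n" "del n" "eta n" by (rule elim(7))
      interpret cca: cca_population "p n" "q n" r "Sx n" "Sy n" "Sxy n" "U n" "V n" "Phi0 n" "Lam n" "Lam2 n" A B eps0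
        by (rule pop[OF n])
      note nm = names[OF n]
      have del_eta: "del n \<le> eta n" "lam n \<le> eta n" using asym(6)[OF n] R.lam by auto
      have "0 < 1296 / d" using d by simp
      then have "0 < real (p n)" using elim(9) by linarith
      then have pn: "0 < p n" by simp
      define m where "m = max (p n) (q n)"
      have m1: "1 \<le> m" using pn by (simp add: m_def)
      define B1 where "B1 = {\<omega> \<in> space (M n). C1 * \<bar>del n\<bar> < \<bar>Z1 n \<omega>\<bar>}"
      define B2 where "B2 = {\<omega> \<in> space (M n). C2 * \<bar>eta n\<bar> < \<bar>Z2 n \<omega>\<bar>}"
      define B3 where "B3 = {\<omega> \<in> space (M n). C3 * \<bar>del n\<bar> < \<bar>Z3 n \<omega>\<bar>}"
      define B4 where "B4 = {\<omega> \<in> space (M n). C4 * \<bar>eta n\<bar> < \<bar>Z4 n \<omega>\<bar>}"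
      define B5 where "B5 = {\<omega> \<in> space (M n). rhoh n \<omega> < 0}"
      define B6 where "B6 = {\<omega> \<in> space (M n).
        cca.deviates (Shx n \<omega>) (Shy n \<omega>) (Shxy n \<omega>) (10 * A * cca.K0\<^sup>2 * lam n)}"
      have est: "random_vec (M n) (p n) (alphah n)" "random_vec (M n) (q n) (betah n)"
        using estimators[OF n] by auto
      note [measurable] = measurable_sign_dist[OF est(1) vecs(1)[OF n]] measurable_sign_dist[OF est(2) vecs(2)[OF n]]
        measurable_max_column[OF Phih[OF n] S_carrier(1)[OF n]] rh_meas[OF n]
      have B15: "B1 \<in> P.events" "B2 \<in> P.events" "B3 \<in> P.events" "B4 \<in> P.events" "B5 \<in> P.events"
        unfolding B1_def B2_def B3_def B4_def B5_def Z1_def Z2_def Z3_def Z4_def by measurable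
      have n0: "0 < n" and lam45: "lam n \<le> 4 / 5" using n elim(8) del_eta by (auto simp: c_def)
      have rXs: "random_vec (M n) (p n) (Xs n i)" and rYs: "random_vec (M n) (q n) (Ys n i)" if "i < n" for i
        using dims(2)[OF n that] by auto
      note conc = cca.concentration_event[OF prob[OF n] n0 sgx[OF n] sgy[OF n] sgxy[OF n] A_def Sx Sy Sxy
          iid[OF n] rXs rYs m_def m1 _ lam45, unfolded m_def, OF _ _ lam, folded Shx Shy Shxy, folded B6_def m_def]
      have B6: "B6 \<in> P.events" "P.prob B6 \<le> 216 / m" using conc by simp_all
      \<comment> \<open>1296 is 6 times 216, which brings \<open>216 / m\<close> below
        \<open>d / 6\<close>.\<close>
      have "1296 / d \<le> real m" using elim(9) by (simp add: m_def)
      then have "216 / m \<le> d / 6" using d m1 by (simp add: field_simps)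
      then have p6: "P.prob B6 \<le> d / 6" using B6 by simp
      have good: "linf_norm (rem n \<omega>) \<le> C * (del n)\<^sup>2 \<and> 0 \<le> linf_norm (rem n \<omega>)"
        if \<omega>: "\<omega> \<in> space (M n)" "\<omega> \<notin> B1" "\<omega> \<notin> B2" "\<omega> \<notin> B3" "\<omega> \<notin> B4" "\<omega> \<notin> B5" "\<omega> \<notin> B6" for \<omega>
      proof -
        have dp: "0 < del n" "0 < eta n" using R.del_pos R.eta by auto
        have sc: "C1 * del n \<le> K' * del n" "C3 * del n \<le> K' * del n" "C2 * eta n \<le> K' * eta n"
          "C4 * eta n \<le> K' * eta n" "10 * A * cca.K0\<^sup>2 * lam n \<le> K' * lam n"
          using K' dp R.lam(1) by (auto intro!: mult_right_mono simp: k0_def)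
        have carr: "Shx n \<omega> \<in> carrier_mat (p n) (p n)" "Shy n \<omega> \<in> carrier_mat (q n) (q n)"
          "Shxy n \<omega> \<in> carrier_mat (p n) (q n)" "Phih n \<omega> \<in> carrier_mat (p n + q n) (p n + q n)"
          "alphah n \<omega> \<in> carrier_vec (p n)" "betah n \<omega> \<in> carrier_vec (q n)"
          using T_random[OF n] Phih[OF n] est \<omega>(1) by (auto simp: random_mat_def random_vec_def)
        have sym: "Shx n \<omega> $$ (i, j) = Shx n \<omega> $$ (j, i)" if "i < p n" "j < p n" for i j
          unfolding Shx using that by (rule emp_cov_sym)
        have sym': "Shy n \<omega> $$ (i, j) = Shy n \<omega> $$ (j, i)" if "i < q n" "j < q n" for i j
          unfolding Shy using that by (rule emp_cov_sym)
        have dev: "\<not> cca.deviates (Shx n \<omega>) (Shy n \<omega>) (Shxy n \<omega>) (K' * lam n)"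
          using \<omega>(1,7) sc(5) unfolding B6_def cca.deviates_def by (auto dest: le_less_trans)
        have below: "z \<le> K' * t" if "\<not> c' * \<bar>t\<bar> < \<bar>z\<bar>" "0 < t" "c' * t \<le> K' * t" for c' t z
          using that by (simp only: abs_of_pos not_less)
        have l2: "sign_dist l2_norm (alphah n \<omega>) cca.\<alpha> + sign_dist l2_norm (betah n \<omega>) cca.\<beta> \<le> K' * del n"
          unfolding nm by (rule below[OF _ dp(1) sc(1)]) (use \<omega>(1,2) in \<open>unfold B1_def Z1_def, blast\<close>)
        have l1: "sign_dist l1_norm (alphah n \<omega>) cca.\<alpha> + sign_dist l1_norm (betah n \<omega>) cca.\<beta> \<le> K' * eta n"
          unfolding nm by (rule below[OF _ dp(2) sc(3)]) (use \<omega>(1,3) in \<open>unfold B2_def Z2_def, blast\<close>)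
        have P2: "l2_norm (col (Phih n \<omega>) j - col (Phi0 n) j) \<le> K' * del n" if "j < p n" for j
        proof -
          have "l2_norm (col (Phih n \<omega>) j - col (Phi0 n) j)
              \<le> (MAX j\<in>{..<p n + q n}. l2_norm (col (Phih n \<omega>) j - col (Phi0 n) j))"
            using that by (intro Max_ge) auto
          also have "\<dots> \<le> K' * del n"
            by (rule below[OF _ dp(1) sc(2)]) (use \<omega>(1,4) in \<open>unfold B3_def Z3_def, blast\<close>)
          finally show ?thesis .
        qed
        have P1: "l1_norm (col (Phih n \<omega>) j - col (Phi0 n) j) \<le> K' * eta n" if "j < p n" for j
        proof -
          have "l1_norm (col (Phih n \<omega>) j - col (Phi0 n) j)
              \<le> (MAX j\<in>{..<p n + q n}. l1_norm (col (Phih n \<omega>) j - col (Phi0 n) j))"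
            using that by (intro Max_ge) auto
          also have "\<dots> \<le> K' * eta n"
            by (rule below[OF _ dp(2) sc(4)]) (use \<omega>(1,5) in \<open>unfold B4_def Z4_def, blast\<close>)
          finally show ?thesis .
        qed
        have "eta n < 1 / (14 * K' ^ 3)" "eta n < eps0 / (7 * K' ^ 3)" "eta n < 1 / (2 * K' * sqrt A)"
          using elim(8) by (auto simp: c_def)
        then have et: "14 * K' ^ 3 * eta n < 1" "7 * K' ^ 3 * eta n < eps0" "2 * K' * eta n < 1 / sqrt A"
          using K'(1) A0 by (simp_all add: field_simps)
        have "K' ^ 3 * del n \<le> K' ^ 3 * eta n" "K' * del n \<le> K' * eta n"
          using del_eta K'(1) by (auto intro: mult_left_mono)
        then have small: "7 * K' ^ 3 * del n \<le> 1 / 2" "7 * K' ^ 3 * del n < eps0"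
          "K' * eta n + K' * del n < 1 / sqrt A"
          using et by linarith+
        \<comment> \<open>Here \<open>eta n = sqrt (s n) * del n\<close> is used.\<close>
        have root: "sqrt (real k) * k0 * del n \<le> K' * eta n" if "k \<le> s n" for k
        proof -
          have "sqrt (real k) * k0 * del n \<le> sqrt (real (s n)) * K' * del n"
            using that K'(2) k0 dp by (intro mult_right_mono mult_mono) auto
          then show ?thesis using asym(4)[OF n] by (simp add: mult_ac)
        qed
        have sparse: "(\<Sum>i<p n. \<bar>cca.\<alpha> $ i\<bar>) * del n \<le> K' * eta n"
          "(\<Sum>i<q n. \<bar>cca.\<beta> $ i\<bar>) * del n \<le> K' * eta n"
        proof -
          have "sU n \<le> s n" "sV n \<le> s n" using s(3) by simp_all
          note r = root[OF this(1)] root[OF this(2)]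
          show "(\<Sum>i<p n. \<bar>cca.\<alpha> $ i\<bar>) * del n \<le> K' * eta n"
            by (rule order_trans[OF mult_right_mono[OF cca.leading_l1(1)] r(1)[unfolded s(1) k0_def]])
              (use dp in simp)
          show "(\<Sum>i<q n. \<bar>cca.\<beta> $ i\<bar>) * del n \<le> K' * eta n"
            by (rule order_trans[OF mult_right_mono[OF cca.leading_l1(2)] r(2)[unfolded s(2) k0_def]])
              (use dp in simp)
        qed
        have rh: "0 \<le> canon_corr (Shx n \<omega>) (Shy n \<omega>) (Shxy n \<omega>) (alphah n \<omega>) (betah n \<omega>)"
          using \<omega>(1,6) unfolding B5_def rhoh by auto
        have le: "\<bar>rem n \<omega> $ j\<bar> \<le> C * (del n)\<^sup>2" if "j < p n" for j
          using cca.good_event_bound[OF carr sym sym' elim(7) K'(2)[unfolded k0_def] dev l2 l1 P2 P1 small sparse rh that]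
          unfolding nm rem_index[OF n that] xdb L1 xh yh rhoh w_def C_def .
        have "linf_norm (rem n \<omega>) = (MAX j\<in>{..<p n}. \<bar>rem n \<omega> $ j\<bar>)"
          unfolding linf_norm_def carrier_vecD[OF rem_c[OF n]] ..
        \<comment> \<open>The maximum runs over a nonempty set because \<open>p n\<close> is
          positive; on the empty set its value would say nothing.\<close>
        moreover have "0 \<le> (MAX j\<in>{..<p n}. \<bar>rem n \<omega> $ j\<bar>)"
          by (rule order_trans[OF abs_ge_zero[of "rem n \<omega> $ 0"] Max_ge]) (use pn in auto)
        moreover have "(MAX j\<in>{..<p n}. \<bar>rem n \<omega> $ j\<bar>) \<le> C * (del n)\<^sup>2"
          by (rule Max.boundedI) (use pn le in auto)
        ultimately show ?thesis by simp
      qed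
      have "{\<omega> \<in> space (M n). \<bar>linf_norm (rem n \<omega>)\<bar> > C * \<bar>real (s n) powr (2 * kappa) * (lam n)\<^sup>2\<bar>}
          \<subseteq> B1 \<union> B2 \<union> B3 \<union> B4 \<union> B5 \<union> B6"
      proof (rule subsetI, rule ccontr)
        fix \<omega> assume "\<omega> \<in> {\<omega> \<in> space (M n). \<bar>linf_norm (rem n \<omega>)\<bar> > C * \<bar>real (s n) powr (2 * kappa) * (lam n)\<^sup>2\<bar>}"
          and "\<omega> \<notin> B1 \<union> B2 \<union> B3 \<union> B4 \<union> B5 \<union> B6"
        then show False using good[of \<omega>] asym(5)[OF n] by auto
      qed
      then have "P.prob {\<omega> \<in> space (M n). \<bar>linf_norm (rem n \<omega>)\<bar> > C * \<bar>real (s n) powr (2 * kappa) * (lam n)\<^sup>2\<bar>}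
          \<le> P.prob (B1 \<union> B2 \<union> B3 \<union> B4 \<union> B5 \<union> B6)"
        using B15 B6(1) by (intro P.finite_measure_mono) auto
      also have "\<dots> \<le> P.prob B1 + P.prob B2 + P.prob B3 + P.prob B4 + P.prob B5 + P.prob B6"
        using B15 B6(1) by (intro order_trans[OF measure_Un_le] add_mono order_refl sets.Un)
      also have "\<dots> \<le> d / 6 + d / 6 + d / 6 + d / 6 + d / 6 + d / 6"
        using elim(2-6) p6 unfolding B1_def B2_def B3_def B4_def B5_def by (intro add_mono) auto
      finally show ?case by simp
    qed
    then show "\<exists>C>0. \<forall>\<^sub>F n in sequentially. measure (M n) {\<omega> \<in> space (M n). \<bar>linf_norm (rem n \<omega>)\<bar>
        > C * \<bar>real (s n) powr (2 * kappa) * (lam n)\<^sup>2\<bar>} \<le> d" using C by blast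
  qed
  show ?thesis using rem_random expansion bound by blast
qed

end
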